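(* Let $F$ be an algebraically closed field of characteristic $2$, and let $(Q,b_Q)$ be a self-centralizing Brauer pair of the alternating group $\mathfrak{A}_n$. (a) Let $\Omega\subseteq\{1,\ldots,n\}$ be such that $Q$ acts fixed point freely on $\Omega$ and fixes $\{1,\ldots,n\}\smallsetminus\Omega$ pointwise. Then $C_{\mathfrak{A}(\Omega)}(Q)=Z(Q)$. (b) Let $P$ be a defect group of the Brauer correspondent $B:=b_Q^{\mathfrak{A}_n}$ of $b_Q$ in $\mathfrak{A}_n$ such that $C_P(Q)\leq Q\leq P$, and let $\hat{\Omega}\subseteq\{1,\ldots,n\}$ be such that $P$ acts fixed point freely on $\hat{\Omega}$ and fixes $\{1,\ldots,n\}\smallsetminus\hat{\Omega}$ pointwise. Then even $C_{\mathfrak{A}(\hat{\Omega})}(Q)=Z(Q)$.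
   Context: A Brauer pair of a finite group $G$ (with respect to $p=\mathrm{char}(F)$, here $p=2$) is a pair $(Q,b)$ where $Q$ is a $p$-subgroup of $G$ and $b$ is a block of $F[QC_G(Q)]$. It is self-centralizing if $Q$ is a defect group of the block $b$. The Brauer correspondent $b^G$ is the block of $FG$ corresponding to $b$ under Brauer's block induction, which is always defined in this situation. A group acts fixed point freely on a set if no point of the set is fixed by the whole group. $\mathfrak{A}(\Omega)$ denotes the alternating group on $\Omega$, regarded as a subgroup of $\mathfrak{A}_n$ fixing the points outside $\Omega$. *)

theory Defs
  imports
    "HOL-Computational_Algebra.Polynomial"
    "HOL-Algebra.Sym_Groups"
    "HOL-Algebra.Left_Coset"
    "HOL-Algebra.Module"
begin

text \<open>
  Throughout, groups are \<^emph>\<open>finite\<close> (sums over the carrier are only meaningful in this case), and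
  for a subgroup \<open>H\<close> of \<open>G\<close> the record \<open>G\<lparr>carrier := H\<rparr>\<close> is used for \<open>H\<close> as a group.
\<close>

text \<open>Applied to a group this is \<open>Z(G)\<close>, applied to a ring it is the (carrier of the) centre.\<close>

definition centre :: "('a, 'm) monoid_scheme \<Rightarrow> 'a set" where
  "centre M = {z \<in> carrier M. \<forall>x\<in>carrier M. z \<otimes>\<^bsub>M\<^esub> x = x \<otimes>\<^bsub>M\<^esub> z}"

definition centralizer :: "('a, 'm) monoid_scheme \<Rightarrow> 'a set \<Rightarrow> 'a set" where
  "centralizer G S = {g \<in> carrier G. \<forall>s\<in>S. g \<otimes>\<^bsub>G\<^esub> s = s \<otimes>\<^bsub>G\<^esub> g}"

definition p_subgroup :: "nat \<Rightarrow> 'a set \<Rightarrow> ('a, 'm) monoid_scheme \<Rightarrow> bool" where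
  "p_subgroup p Q G \<longleftrightarrow> subgroup Q G \<and> (\<exists>k. card Q = p ^ k)"


subsection \<open>Group algebras and blocks\<close>

text \<open>
  Elements of \<open>FG\<close> are coefficient functions vanishing outside \<open>carrier G\<close>. Hence for a subgroup
  \<open>H\<close> of \<open>G\<close> the algebra \<open>FH\<close> is literally a subalgebra of \<open>FG\<close>.
\<close>

definition group_algebra ::
    "('a, 'm) monoid_scheme \<Rightarrow> ('f::field, 'a \<Rightarrow> 'f) module" where
  "group_algebra G =
    \<lparr> carrier = {a. \<forall>x. x \<notin> carrier G \<longrightarrow> a x = 0},
      mult = (\<lambda>a b x. \<Sum>(y, z) \<in> {(y, z) \<in> carrier G \<times> carrier G. y \<otimes>\<^bsub>G\<^esub> z = x}. a y * b z),
      one = (\<lambda>x. if x = \<one>\<^bsub>G\<^esub> then 1 else 0),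
      zero = (\<lambda>x. 0),
      add = (\<lambda>a b x. a x + b x),
      smult = (\<lambda>c a x. c * a x) \<rparr>"

definition central_idempotent :: "('a, 'm) ring_scheme \<Rightarrow> 'a \<Rightarrow> bool" where
  "central_idempotent A e \<longleftrightarrow> e \<in> centre A \<and> e \<otimes>\<^bsub>A\<^esub> e = e"

text \<open>
  A block is represented by its block idempotent, i.e. a primitive idempotent of the centre.
\<close>

definition block :: "('a, 'm) ring_scheme \<Rightarrow> 'a \<Rightarrow> bool" where
  "block A e \<longleftrightarrow> central_idempotent A e \<and> e \<noteq> \<zero>\<^bsub>A\<^esub> \<and>
     (\<forall>e1 e2. central_idempotent A e1 \<and> central_idempotent A e2 \<and>
        e1 \<otimes>\<^bsub>A\<^esub> e2 = \<zero>\<^bsub>A\<^esub> \<and> e = e1 \<oplus>\<^bsub>A\<^esub> e2 \<longrightarrow> e1 = \<zero>\<^bsub>A\<^esub> \<or> e2 = \<zero>\<^bsub>A\<^esub>)"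


subsection \<open>Defect groups\<close>

text \<open>\<open>conj_act G g a\<close> is \<open>g a g\<^sup>-\<^sup>1\<close>.\<close>

definition conj_act :: "('a, 'm) monoid_scheme \<Rightarrow> 'a \<Rightarrow> ('a \<Rightarrow> 'f::field) \<Rightarrow> ('a \<Rightarrow> 'f)" where
  "conj_act G g a = (\<lambda>x. if x \<in> carrier G then a (inv\<^bsub>G\<^esub> g \<otimes>\<^bsub>G\<^esub> x \<otimes>\<^bsub>G\<^esub> g) else 0)"

definition fixed_elements :: "('a, 'm) monoid_scheme \<Rightarrow> 'a set \<Rightarrow> ('a \<Rightarrow> 'f::field) set" where
  "fixed_elements G D = {a \<in> carrier (group_algebra G). \<forall>d\<in>D. conj_act G d a = a}"

text \<open>
  The relative trace map from \<open>(FG)\<^sup>D\<close> to \<open>(FG)\<^sup>G = Z(FG)\<close>. The representative chosen in a coset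
  \<open>gD\<close> is irrelevant for elements of \<open>(FG)\<^sup>D\<close>.
\<close>

definition rel_trace :: "('a, 'm) monoid_scheme \<Rightarrow> 'a set \<Rightarrow> ('a \<Rightarrow> 'f::field) \<Rightarrow> ('a \<Rightarrow> 'f)" where
  "rel_trace G D a = (\<lambda>x. \<Sum>C\<in>lcosets\<^bsub>G\<^esub> D. conj_act G (SOME g. g \<in> C) a x)"

text \<open>
  Defect groups in the sense of Green: the minimal subgroups \<open>D\<close> of \<open>G\<close> such that the block
  idempotent is a relative trace from \<open>D\<close>.
\<close>

definition defect_group ::
    "('a, 'm) monoid_scheme \<Rightarrow> ('a \<Rightarrow> 'f::field) \<Rightarrow> 'a set \<Rightarrow> bool" where
  "defect_group G b D \<longleftrightarrow> subgroup D G \<and> b \<in> rel_trace G D ` fixed_elements G D \<and>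
     (\<forall>E. subgroup E G \<and> E \<subseteq> D \<and> b \<in> rel_trace G E ` fixed_elements G E \<longrightarrow> E = D)"


subsection \<open>Block induction\<close>

text \<open>
  \<open>w\<close> (considered on the centre of \<open>A\<close> only) is the central character of the block \<open>e\<close>: the
  algebra homomorphism from the centre to \<open>F\<close> not vanishing on \<open>e\<close>. For split algebras such as
  group algebras over an algebraically closed field, it exists and is unique.
\<close>

definition central_character ::
    "('f::field, 'a, 'm) module_scheme \<Rightarrow> 'a \<Rightarrow> ('a \<Rightarrow> 'f) \<Rightarrow> bool" where
  "central_character A e w \<longleftrightarrow>
     (\<forall>x\<in>centre A. \<forall>y\<in>centre A. w (x \<oplus>\<^bsub>A\<^esub> y) = w x + w y \<and> w (x \<otimes>\<^bsub>A\<^esub> y) = w x * w y) \<and>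
     (\<forall>c. \<forall>x\<in>centre A. w (c \<odot>\<^bsub>A\<^esub> x) = c * w x) \<and>
     w \<one>\<^bsub>A\<^esub> = 1 \<and> w e = 1"

definition truncate :: "'a set \<Rightarrow> ('a \<Rightarrow> 'f::field) \<Rightarrow> ('a \<Rightarrow> 'f)" where
  "truncate H a = (\<lambda>x. if x \<in> H then a x else 0)"

text \<open>
  \<open>B = b\<^sup>G\<close> in the sense of Brauer, for a block \<open>b\<close> of \<open>FH\<close>: the central character of \<open>B\<close> is the
  central character of \<open>b\<close> composed with the truncation \<open>Z(FG) \<rightarrow> Z(FH)\<close>, which sends a class sum
  of \<open>G\<close> to the sum of the elements of the class lying in \<open>H\<close>. There is at most one such \<open>B\<close>;
  the relation therefore says that \<open>b\<^sup>G\<close> is defined and equal to \<open>B\<close>.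
\<close>

definition brauer_correspondent ::
    "('a, 'm) monoid_scheme \<Rightarrow> 'a set \<Rightarrow> ('a \<Rightarrow> 'f::field) \<Rightarrow> ('a \<Rightarrow> 'f) \<Rightarrow> bool" where
  "brauer_correspondent G H b B \<longleftrightarrow> block (group_algebra G) B \<and>
     (\<exists>w. central_character (group_algebra (G\<lparr>carrier := H\<rparr>)) b w \<and>
          central_character (group_algebra G) B (\<lambda>z. w (truncate H z)))"


subsection \<open>Brauer pairs\<close>

definition brauer_pair ::
    "('a, 'm) monoid_scheme \<Rightarrow> 'a set \<Rightarrow> ('a \<Rightarrow> 'f::field) \<Rightarrow> bool" where
  "brauer_pair G Q b \<longleftrightarrow> p_subgroup CHAR('f) Q G \<and>
     block (group_algebra (G\<lparr>carrier := Q <#>\<^bsub>G\<^esub> centralizer G Q\<rparr>)) b"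

definition self_centralizing_brauer_pair ::
    "('a, 'm) monoid_scheme \<Rightarrow> 'a set \<Rightarrow> ('a \<Rightarrow> 'f::field) \<Rightarrow> bool" where
  "self_centralizing_brauer_pair G Q b \<longleftrightarrow> brauer_pair G Q b \<and>
     defect_group (G\<lparr>carrier := Q <#>\<^bsub>G\<^esub> centralizer G Q\<rparr>) b Q"


subsection \<open>Permutations\<close>

text \<open>\<open>alt_on X\<close> is the alternating group on \<open>X\<close>; \<open>p permutes X\<close> includes that \<open>p\<close> fixes all
  points outside \<open>X\<close>, so it is a subset of \<open>alt_group n\<close> whenever \<open>X \<subseteq> {1..n}\<close>.\<close>

definition alt_on :: "'a set \<Rightarrow> ('a \<Rightarrow> 'a) set" where
  "alt_on X = {p. p permutes X \<and> evenperm p}"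

definition acts_fixed_point_freely :: "('a \<Rightarrow> 'a) set \<Rightarrow> 'a set \<Rightarrow> bool" where
  "acts_fixed_point_freely Q X \<longleftrightarrow> (\<forall>g\<in>Q. g ` X = X) \<and> (\<forall>x\<in>X. \<exists>g\<in>Q. g x \<noteq> x)"

definition fixes_pointwise :: "('a \<Rightarrow> 'a) set \<Rightarrow> 'a set \<Rightarrow> bool" where
  "fixes_pointwise Q X \<longleftrightarrow> (\<forall>g\<in>Q. \<forall>x\<in>X. g x = x)"

end

theory Submission
  imports
    Defs
    "HOL-Algebra.Group_Action"
    "HOL-Algebra.Sylow"
    "HOL-Algebra.Multiplicative_Group"
    "HOL-Library.Function_Algebras"
begin

text \<open>
  Let \<open>H = Q C(Q)\<close>. A normal 2-subgroup of \<open>H\<close> lies in every defect group of a block of \<open>H\<close>, hence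
  in \<open>Q\<close>. If \<open>g\<close> of odd order centralizes \<open>Q\<close> and moves a point \<open>x\<close> of \<open>\<Omega>\<close>, take a nontrivial
  permutation \<open>z\<close> of the orbit of \<open>x\<close> commuting with \<open>Q\<close>: then \<open>z (g z g\<^sup>-\<^sup>1)\<close> is even and lies in
  the normal 2-subgroup of \<open>C(Q)\<close> that preserves the orbits of \<open>Q\<close>, so it lies in \<open>Q\<close> and commutes
  with \<open>g\<close>, which its support contradicts. So the centralizer of \<open>Q\<close> in the symmetric group
  on \<open>\<Omega>\<close> is a 2-group, and its even part, being normal in \<open>C(Q)\<close>, lies in \<open>Q\<close>; this is (a).

  For (b), write a conjugation-invariant idempotent above \<open>b\<close> as a combination of class sums and pick
  a class on which the central character does not vanish. Its 2-regular part \<open>u\<close> moves only points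
  outside \<open>\<Omega>\<close>, and the class sum of \<open>u\<close> in the alternating group is not killed by the central
  character of \<open>B\<close>. Hence \<open>P\<close> is conjugate to a subgroup of a Sylow 2-subgroup of the centralizer
  of \<open>u\<close>. Since the 2-elements of \<open>H\<close> commuting with \<open>u\<close> lie in \<open>Q\<close>, every 2-element
  commuting with \<open>u\<close> fixes the points moved by \<open>u\<close>, and \<open>u\<close> has at most three fixed points outside
  \<open>\<Omega>\<close> (at most one if an odd permutation of \<open>\<Omega>\<close> commutes with \<open>Q\<close>). As \<open>P\<close> and \<open>Q\<close> move an even
  number of points, \<open>P\<close> moves at most two points more than \<open>Q\<close>, and (b) reduces to (a).
\<close>

subsection \<open>Actions of $p$-groups in characteristic $p$\<close>

text \<open>The recurring tool is that in characteristic p a sum invariant under a p-group reduces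
  to its fixed points; truncation to centralizers, conjugation into defect groups and the parity of
  orbits are all instances of it. The obstacle throughout is parity. The natural permutations to
  test with (transpositions, one-orbit permutations commuting with Q, the involution that a
  2-element induces on the points moved by u) can be odd, whereas the block lives on the even group
  H. Hence the product of z with a conjugate of itself, and hence the group \<open>\<Gamma>\<close>,
  Q times its full symmetric centralizer, in which H has index at most 2. Invariance under
  \<open>\<Gamma>\<close> is wanted because an odd involution has to act on the idempotent, and
  because the alternating class of u meets C(Q) in a \<open>\<Gamma>\<close>-class. The bounds three
  and one have the same origin: four fixed points of u outside \<Omega> carry two disjoint
  transpositions, whose product is even and commutes with u, while two points suffice when an odd
  permutation of \<Omega> corrects the sign. Such a 2-element would lie in Q although it moves
  points that Q fixes.\<close>

lemma sum_fixed_points_p_group: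
  fixes f :: "'s \<Rightarrow> 'f::comm_ring_1"
  assumes R: "group R" "card (carrier R) = p ^ k" and p: "prime p" "CHAR('f) = p"
    and S: "finite S"
    and act_closed: "\<And>r s. r \<in> carrier R \<Longrightarrow> s \<in> S \<Longrightarrow> act r s \<in> S"
    and act_one: "\<And>s. s \<in> S \<Longrightarrow> act \<one>\<^bsub>R\<^esub> s = s"
    and act_mult: "\<And>r r' s. r \<in> carrier R \<Longrightarrow> r' \<in> carrier R \<Longrightarrow> s \<in> S \<Longrightarrow>
        act (r \<otimes>\<^bsub>R\<^esub> r') s = act r (act r' s)"
    and inv: "\<And>r s. r \<in> carrier R \<Longrightarrow> s \<in> S \<Longrightarrow> f (act r s) = f s"
  shows "sum f S = sum f {s \<in> S. \<forall>r\<in>carrier R. act r s = s}"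
proof -
  interpret R: group R by fact
  define \<phi> where "\<phi> r = restrict (act r) S" for r
  have finR: "finite (carrier R)"
    using R(2) p(1) by (metis card.infinite not_prime_0 power_not_zero)
  have bij: "\<phi> r \<in> Bij S" if "r \<in> carrier R" for r
  proof -
    have "bij_betw (act r) S S"
      by (rule bij_betw_byWitness[where f' = "act (inv\<^bsub>R\<^esub> r)"])
         (use that in \<open>auto simp: act_closed act_one simp flip: act_mult\<close>)
    then show ?thesis
      unfolding \<phi>_def Bij_def by (auto simp: bij_betw_restrict_eq)
  qed
  have hom: "\<phi> \<in> hom R (BijGroup S)"
    unfolding hom_def BijGroup_def using bij
    by (auto simp: \<phi>_def act_mult act_closed compose_def restrict_def fun_eq_iff)
  interpret B: group "BijGroup S" by (rule group_BijGroup)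
  interpret group_action R S \<phi>
    by unfold_locales (rule hom)
  let ?Fix = "{s \<in> S. \<forall>r\<in>carrier R. act r s = s}"
  have orb: "orbit R \<phi> s = (\<lambda>r. act r s) ` carrier R" if "s \<in> S" for s
    unfolding orbit_def \<phi>_def using that by auto
  \<comment> \<open>Orbits have p-power length. A fixed point is its own orbit, and a longer orbit
    contributes a multiple of p times the constant value of \<open>f\<close> on it, hence 0.\<close>
  have *: "sum f X = sum f (X \<inter> ?Fix)" if X: "X \<in> orbits R S \<phi>" for X
  proof -
    obtain s where s: "s \<in> S" "X = orbit R \<phi> s"
      using X unfolding orbits_def by auto
    have fX: "f x = f s" if "x \<in> X" for x
      using that s inv by (auto simp: orb)
    have "card X dvd p ^ k"
      using orbit_stabilizer_theorem[OF s(1)] s(2) R(2) unfolding order_def by (metis dvd_triv_left)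
    then obtain j where j: "card X = p ^ j"
      using divides_primepow_nat[OF p(1)] by blast
    have sX: "s \<in> X"
      using s act_one by (force simp: orb)
    show ?thesis
    proof (cases "j = 0")
      case True
      then have "X = {s}"
        using j sX by (metis card_1_singletonE power_0 singletonD)
      moreover have "s \<in> ?Fix"
        using s \<open>X = {s}\<close> by (auto simp: orb)
      ultimately show ?thesis by auto
    next
      case False
      then have "p dvd card X" using j by simp
      then have "of_nat (card X) = (0::'f)"
        using p(2) of_nat_eq_0_iff_char_dvd by blast
      then have "sum f X = 0"
        using fX by simp
      moreover have "X \<inter> ?Fix = {}"
      proof (rule ccontr)
        assume "X \<inter> ?Fix \<noteq> {}"
        then obtain r where r: "r \<in> carrier R" "act r s \<in> ?Fix"
          using s by (auto simp: orb)
        have "act (inv\<^bsub>R\<^esub> r) (act r s) = s"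
          using r s act_mult[of "inv\<^bsub>R\<^esub> r" r s] by (simp add: act_one)
        then have "act r s = s"
          using r by auto
        then have "X = {s}"
          using r s R.one_closed by (auto simp: orb image_iff)
        then show False
          using j False p(1) by (metis card_1_singleton_iff is_singletonI is_singleton_altdef
            nat_power_eq_Suc_0_iff One_nat_def not_prime_1)
      qed
      ultimately show ?thesis by simp
    qed
  qed
  have orbS: "X \<subseteq> S" if "X \<in> orbits R S \<phi>" for X
    using that by (auto simp: orbits_def orb act_closed)
  have "sum f S = (\<Sum>X\<in>orbits R S \<phi>. \<Sum>x\<in>X. f x)"
    by (rule disjoint_sum[OF S, symmetric])
  also have "\<dots> = (\<Sum>X\<in>orbits R S \<phi>. \<Sum>x\<in>X. if x \<in> ?Fix then f x else 0)"
  proof (rule sum.cong[OF refl])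
    fix X assume X: "X \<in> orbits R S \<phi>"
    show "sum f X = (\<Sum>x\<in>X. if x \<in> ?Fix then f x else 0)"
      unfolding *[OF X] by (rule sum.inter_restrict) (rule finite_subset[OF orbS[OF X] S])
  qed
  also have "\<dots> = (\<Sum>x\<in>S. if x \<in> ?Fix then f x else 0)"
    by (rule disjoint_sum[OF S])
  also have "\<dots> = sum f (S \<inter> ?Fix)"
    by (rule sum.inter_restrict[symmetric, OF S])
  also have "S \<inter> ?Fix = ?Fix" by auto
  finally show ?thesis .
qed

subsection \<open>Group algebras\<close>

locale finite_group = group G for G (structure) +
  assumes finite_carrier [simp, intro]: "finite (carrier G)"
begin

abbreviation conv :: "('a \<Rightarrow> 'f::field) \<Rightarrow> ('a \<Rightarrow> 'f) \<Rightarrow> 'a \<Rightarrow> 'f" (infixl "\<star>" 70) where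
  "a \<star> b \<equiv> a \<otimes>\<^bsub>group_algebra G\<^esub> b"

definition supported :: "('a \<Rightarrow> 'f::field) \<Rightarrow> bool" where
  "supported a \<longleftrightarrow> (\<forall>x. x \<notin> carrier G \<longrightarrow> a x = 0)"

definition class_function :: "('a \<Rightarrow> 'f::field) \<Rightarrow> bool" where
  "class_function a \<longleftrightarrow> supported a \<and> (\<forall>g\<in>carrier G. \<forall>x\<in>carrier G. a (g \<otimes> x \<otimes> inv g) = a x)"

lemma supported_iff: "supported a \<longleftrightarrow> a \<in> carrier (group_algebra G)"
  by (simp add: supported_def group_algebra_def)

lemma conv_apply: "(a \<star> b) x = (if x \<in> carrier G then \<Sum>g\<in>carrier G. a g * b (inv g \<otimes> x) else 0)"
proof (cases "x \<in> carrier G")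
  case True
  have "(a \<star> b) x = (\<Sum>(y, z)\<in>{(y, z) \<in> carrier G \<times> carrier G. y \<otimes> z = x}. a y * b z)"
    by (simp add: group_algebra_def)
  also have "\<dots> = (\<Sum>g\<in>carrier G. a g * b (inv g \<otimes> x))"
    by (rule sum.reindex_bij_witness[where i = "\<lambda>g. (g, inv g \<otimes> x)" and j = fst])
       (use True in \<open>auto simp: m_assoc[symmetric] inv_solve_left\<close>)
  finally show ?thesis using True by simp
next
  case False
  then have *: "{(y, z) \<in> carrier G \<times> carrier G. y \<otimes> z = x} = {}" by auto
  have "(a \<star> b) x = (\<Sum>(y, z)\<in>{(y, z) \<in> carrier G \<times> carrier G. y \<otimes> z = x}. a y * b z)"
    by (simp add: group_algebra_def)
  then show ?thesis using False by (simp only: * sum.empty if_False)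
qed

lemma supported_conv [simp, intro]: "supported (a \<star> b)"
  by (simp add: supported_def conv_apply)

lemma class_function_supported: "class_function a \<Longrightarrow> supported a"
  by (simp add: class_function_def)

lemma class_functionD: "class_function a \<Longrightarrow> g \<in> carrier G \<Longrightarrow> x \<in> carrier G \<Longrightarrow> a (g \<otimes> x \<otimes> inv g) = a x"
  by (simp add: class_function_def)

lemma sum_shift_left: "y \<in> carrier G \<Longrightarrow> (\<Sum>g\<in>carrier G. f (y \<otimes> g)) = (\<Sum>g\<in>carrier G. f g)"
  by (rule sum.reindex_bij_witness[where i = "\<lambda>g. inv y \<otimes> g" and j = "\<lambda>g. y \<otimes> g"])
     (auto simp: m_assoc[symmetric])

lemma conv_assoc: "(a \<star> b) \<star> c = a \<star> (b \<star> c)"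
proof
  fix x
  show "((a \<star> b) \<star> c) x = (a \<star> (b \<star> c)) x"
  proof (cases "x \<in> carrier G")
    case x: True
    have "((a \<star> b) \<star> c) x
        = (\<Sum>h\<in>carrier G. \<Sum>g\<in>carrier G. a g * b (inv g \<otimes> h) * c (inv h \<otimes> x))"
      using x by (simp add: conv_apply sum_distrib_right)
    also have "\<dots> = (\<Sum>g\<in>carrier G. \<Sum>h\<in>carrier G. a g * b (inv g \<otimes> h) * c (inv h \<otimes> x))"
      by (rule sum.swap)
    also have "\<dots> = (\<Sum>g\<in>carrier G. \<Sum>k\<in>carrier G. a g * b k * c (inv k \<otimes> (inv g \<otimes> x)))"
    proof (rule sum.cong[OF refl])
      fix g assume g: "g \<in> carrier G"
      have "(\<Sum>h\<in>carrier G. a g * b (inv g \<otimes> h) * c (inv h \<otimes> x))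
          = (\<Sum>k\<in>carrier G. a g * b (inv g \<otimes> (g \<otimes> k)) * c (inv (g \<otimes> k) \<otimes> x))"
        using sum_shift_left[OF g, of "\<lambda>h. a g * b (inv g \<otimes> h) * c (inv h \<otimes> x)"] by simp
      also have "\<dots> = (\<Sum>k\<in>carrier G. a g * b k * c (inv k \<otimes> (inv g \<otimes> x)))"
        using g x by (intro sum.cong) (auto simp: m_assoc[symmetric] inv_mult_group)
      finally show "(\<Sum>h\<in>carrier G. a g * b (inv g \<otimes> h) * c (inv h \<otimes> x))
          = (\<Sum>k\<in>carrier G. a g * b k * c (inv k \<otimes> (inv g \<otimes> x)))" .
    qed
    also have "\<dots> = (a \<star> (b \<star> c)) x"
      using x by (simp add: conv_apply sum_distrib_left mult.assoc)
    finally show ?thesis .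
  qed (simp add: conv_apply)
qed

lemma conv_add_left: "(\<lambda>x. a x + b x) \<star> c = (\<lambda>x. (a \<star> c) x + (b \<star> c) x)"
  by (auto simp: conv_apply fun_eq_iff sum.distrib distrib_right)

lemma conv_add_right: "c \<star> (\<lambda>x. a x + b x) = (\<lambda>x. (c \<star> a) x + (c \<star> b) x)"
  by (auto simp: conv_apply fun_eq_iff sum.distrib distrib_left)

lemma conv_smult_left: "(\<lambda>x. k * a x) \<star> c = (\<lambda>x. k * (a \<star> c) x)"
  by (auto simp: conv_apply fun_eq_iff sum_distrib_left mult.assoc)

lemma conv_smult_right: "c \<star> (\<lambda>x. k * a x) = (\<lambda>x. k * (c \<star> a) x)"
  by (auto simp: conv_apply fun_eq_iff sum_distrib_left mult_ac)

lemma conv_zero_left [simp]: "(\<lambda>x. 0) \<star> c = (\<lambda>x. 0)"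
  by (auto simp: conv_apply)

lemma conv_zero_right [simp]: "c \<star> (\<lambda>x. 0) = (\<lambda>x. 0)"
  by (auto simp: conv_apply)

definition delta :: "'a \<Rightarrow> 'a \<Rightarrow> 'f::field" where
  "delta g = (\<lambda>x. if x = g then 1 else 0)"

lemma supported_delta [simp]: "g \<in> carrier G \<Longrightarrow> supported (delta g)"
  by (auto simp: supported_def delta_def)

lemma one_group_algebra: "\<one>\<^bsub>group_algebra G\<^esub> = delta \<one>"
  by (simp add: group_algebra_def delta_def)

lemma delta_conv:
  assumes g: "g \<in> carrier G" and x: "x \<in> carrier G"
  shows "(delta g \<star> a) x = a (inv g \<otimes> x)"
proof -
  have "(delta g \<star> a) x = (\<Sum>h\<in>carrier G. if h = g then a (inv g \<otimes> x) else 0)"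
    unfolding conv_apply if_P[OF x] by (rule sum.cong) (auto simp: delta_def)
  then show ?thesis using g by (simp add: sum.delta)
qed

lemma conv_delta:
  assumes g: "g \<in> carrier G" and x: "x \<in> carrier G"
  shows "(a \<star> delta g) x = a (x \<otimes> inv g)"
proof -
  have "(a \<star> delta g) x = (\<Sum>h\<in>carrier G. if h = x \<otimes> inv g then a (x \<otimes> inv g) else 0)"
  proof -
    have *: "inv h \<otimes> x = g \<longleftrightarrow> h = x \<otimes> inv g" if "h \<in> carrier G" for h
      using that g x by (metis inv_closed inv_equality inv_solve_left m_assoc m_closed r_inv r_one l_inv inv_inv l_one)
    show ?thesis
      unfolding conv_apply if_P[OF x] by (rule sum.cong) (auto simp: delta_def *)
  qed
  then show ?thesis using g x by (simp add: sum.delta)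
qed

text \<open>The substitution g = x k^-1 turns a(g) b(g^-1 x) into a(x k^-1) b(k), and x k^-1 is the
  conjugate of k^-1 x by k.\<close>

lemma class_function_conv_comm:
  assumes a: "class_function a" and b: "supported b"
  shows "a \<star> b = b \<star> a"
proof
  fix x
  show "(a \<star> b) x = (b \<star> a) x"
  proof (cases "x \<in> carrier G")
    case x: True
    have "(a \<star> b) x = (\<Sum>g\<in>carrier G. a g * b (inv g \<otimes> x))"
      using x by (simp add: conv_apply)
    also have "\<dots> = (\<Sum>k\<in>carrier G. a (x \<otimes> inv k) * b k)"
      by (rule sum.reindex_bij_witness[where i = "\<lambda>k. x \<otimes> inv k" and j = "\<lambda>g. inv g \<otimes> x"])
         (use x in \<open>auto simp: m_assoc inv_mult_group\<close>, auto simp: m_assoc[symmetric])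
    also have "\<dots> = (\<Sum>k\<in>carrier G. b k * a (inv k \<otimes> x))"
    proof (rule sum.cong[OF refl])
      fix k assume k: "k \<in> carrier G"
      have "a (k \<otimes> (inv k \<otimes> x) \<otimes> inv k) = a (inv k \<otimes> x)"
        using k x by (intro class_functionD[OF a]) auto
      also have "k \<otimes> (inv k \<otimes> x) \<otimes> inv k = x \<otimes> inv k"
        using k x by (simp add: m_assoc[symmetric])
      finally show "a (x \<otimes> inv k) * b k = b k * a (inv k \<otimes> x)" by simp
    qed
    finally show ?thesis using x by (simp add: conv_apply)
  qed (simp add: conv_apply)
qed

text \<open>Commuting with the group elements \<open>delta g\<close> already forces constancy on
  conjugacy classes. This lets the centre be handled through coefficients from here on.\<close>

lemma mem_centre_iff:
  fixes a :: "'a \<Rightarrow> 'f::field"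
  shows "a \<in> centre (group_algebra G) \<longleftrightarrow> class_function a"
proof
  assume a: "a \<in> centre (group_algebra G)"
  show "class_function a"
    unfolding class_function_def
  proof (intro conjI ballI)
    show "supported a"
      using a by (simp add: centre_def supported_iff)
    fix g x assume g: "g \<in> carrier G" and x: "x \<in> carrier G"
    have "a \<star> delta g = delta g \<star> a"
      using a supported_delta[OF g, where 'c = 'f] by (simp add: centre_def supported_iff)
    then have "(a \<star> delta g) (g \<otimes> x) = (delta g \<star> a) (g \<otimes> x)" by simp
    then show "a (g \<otimes> x \<otimes> inv g) = a x"
      using g x by (simp add: conv_delta delta_conv m_assoc[symmetric])
  qed
next
  assume "class_function a"
  then show "a \<in> centre (group_algebra G)"
    using class_function_conv_comm by (auto simp: centre_def class_function_supported supported_iff[symmetric])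
qed

lemma class_function_conv:
  assumes a: "class_function a" and b: "class_function b"
  shows "class_function (a \<star> b)"
proof -
  have "(a \<star> b) \<star> c = c \<star> (a \<star> b)" if "supported c" for c
    using that a b by (metis class_function_conv_comm conv_assoc)
  then show ?thesis
    unfolding mem_centre_iff[symmetric] by (auto simp: centre_def supported_iff[symmetric])
qed

lemma class_function_add: "class_function a \<Longrightarrow> class_function b \<Longrightarrow> class_function (\<lambda>x. a x + b x)"
  by (auto simp: class_function_def supported_def)

lemma class_function_smult: "class_function a \<Longrightarrow> class_function (\<lambda>x. k * a x)"
  by (auto simp: class_function_def supported_def)

lemma class_function_zero: "class_function (\<lambda>x. 0)"
  by (auto simp: class_function_def supported_def)

lemma central_idempotent_iff:
  "central_idempotent (group_algebra G) e \<longleftrightarrow> class_function e \<and> e \<star> e = e"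
  by (simp add: central_idempotent_def mem_centre_iff)

lemma central_character_iff:
  fixes w :: "('a \<Rightarrow> 'f::field) \<Rightarrow> 'f"
  shows "central_character (group_algebra G) e w \<longleftrightarrow>
    (\<forall>a b. class_function a \<longrightarrow> class_function b \<longrightarrow>
        w (\<lambda>x. a x + b x) = w a + w b \<and> w (a \<star> b) = w a * w b) \<and>
    (\<forall>c a. class_function a \<longrightarrow> w (\<lambda>x. c * a x) = c * w a) \<and> w (delta \<one>) = 1 \<and> w e = 1"
proof -
  have *: "x \<oplus>\<^bsub>group_algebra G\<^esub> y = (\<lambda>z. x z + y z)" "c \<odot>\<^bsub>group_algebra G\<^esub> x = (\<lambda>z. c * x z)" for x y :: "'a \<Rightarrow> 'f" and c
    by (simp_all add: group_algebra_def)
  then show ?thesis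
    unfolding central_character_def Ball_def mem_centre_iff one_group_algebra * by blast
qed


subsection \<open>Blocks and central characters\<close>

lemma block_iff:
  fixes e :: "'a \<Rightarrow> 'f::field"
  shows "block (group_algebra G) e \<longleftrightarrow> class_function e \<and> e \<star> e = e \<and> e \<noteq> (\<lambda>x. 0) \<and>
    (\<forall>e1 e2. class_function e1 \<and> e1 \<star> e1 = e1 \<and> class_function e2 \<and> e2 \<star> e2 = e2 \<and>
       e1 \<star> e2 = (\<lambda>x. 0) \<and> e = (\<lambda>x. e1 x + e2 x) \<longrightarrow> e1 = (\<lambda>x. 0) \<or> e2 = (\<lambda>x. 0))"
proof -
  have *: "x \<oplus>\<^bsub>group_algebra G\<^esub> y = (\<lambda>z. x z + y z)" "\<zero>\<^bsub>group_algebra G\<^esub> = (\<lambda>z. 0)" for x y :: "'a \<Rightarrow> 'f"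
    by (simp_all add: group_algebra_def)
  show ?thesis
    unfolding block_def central_idempotent_iff * by blast
qed

text \<open>The block splits into the orthogonal central idempotents ef and e - ef, and primitivity
  kills one of them.\<close>

lemma block_mult_idempotent:
  fixes e :: "'a \<Rightarrow> 'f::field"
  assumes b: "block (group_algebra G) e" and f: "class_function f" "f \<star> f = f"
  shows "e \<star> f = e \<or> e \<star> f = (\<lambda>x. 0)"
proof -
  have e: "class_function e" "e \<star> e = e"
    using b by (simp_all add: block_iff)
  define e1 e2 where "e1 = e \<star> f" and "e2 = (\<lambda>x. e x + (-1) * e1 x)"
  have e1: "class_function e1"
    unfolding e1_def by (intro class_function_conv e f)
  have e2: "class_function e2"
    unfolding e2_def by (intro class_function_add class_function_smult e e1)
  have fe: "f \<star> e = e \<star> f"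
    by (intro class_function_conv_comm f class_function_supported e)
  have ee1: "e \<star> e1 = e1" "e1 \<star> e = e1" "e1 \<star> e1 = e1"
    unfolding e1_def by (metis conv_assoc e(2)) (metis conv_assoc e(2) fe, metis conv_assoc e(2) f(2) fe)
  have "e1 \<star> e2 = (\<lambda>x. 0)" "e2 \<star> e2 = e2"
    unfolding e2_def conv_add_left conv_add_right conv_smult_left conv_smult_right ee1 e by auto
  moreover have "e = (\<lambda>x. e1 x + e2 x)"
    unfolding e2_def by auto
  ultimately have "e1 = (\<lambda>x. 0) \<or> e2 = (\<lambda>x. 0)"
    using b e1 e2 ee1 unfolding block_iff by blast
  then show ?thesis
    unfolding e1_def e2_def by (auto simp: fun_eq_iff)
qed

text \<open>In the application \<open>p k\<close> is \<open>x\<^sup>k e\<close> and \<open>T k\<close> is membership in \<open>x\<^sup>k\<^sup>+\<^sup>1 Z(FG) e\<close>: the descending chain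
  of these ideals becomes stationary.\<close>

lemma power_in_span_of_higher:
  fixes p :: "nat \<Rightarrow> 'a \<Rightarrow> 'f::field"
  assumes p: "\<And>i. supported (p i)"
    and T: "\<And>k. T k (\<lambda>x. 0)" "\<And>k a b. T k a \<Longrightarrow> T k b \<Longrightarrow> T k (\<lambda>x. a x + b x)"
      "\<And>k c a. T k a \<Longrightarrow> T k (\<lambda>x. c * a x)" "\<And>i k. i > k \<Longrightarrow> T k (p i)"
  shows "\<exists>k. T k (p k)"
proof (rule ccontr)
  assume neg: "\<not> (\<exists>k. T k (p k))"
  interpret V: vector_space "\<lambda>(c::'f) (f::'a \<Rightarrow> 'f) x. c * f x"
    by unfold_locales (auto simp: fun_eq_iff algebra_simps)
  have span: "V.span (p ` {k<..}) \<subseteq> {a. T k a}" for k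
    by (rule V.span_minimal) (use T in \<open>auto simp: V.subspace_def plus_fun_def zero_fun_def\<close>)
  \<comment> \<open>If no \<open>p k\<close> lies in the span of the later members, every stretch of
    the sequence is independent, as one sees by prepending members. A stretch longer than the number
    of group elements contradicts the dimension of FG.\<close>
  have indep: "V.independent (p ` {k..<k+d}) \<and> card (p ` {k..<k+d}) = d" for k d
  proof (induction d arbitrary: k)
    case (Suc d)
    have ins: "p ` {k..<k + Suc d} = insert (p k) (p ` {Suc k..<Suc k + d})"
      by (auto simp: image_iff) (metis Suc_leI atLeastLessThan_iff le_neq_implies_less)
    have "p ` {Suc k..<Suc k + d} \<subseteq> p ` {k<..}" by auto
    then have ni: "p k \<notin> V.span (p ` {Suc k..<Suc k + d})"
      using span[of k] neg V.span_mono by blast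
    then have "p k \<notin> p ` {Suc k..<Suc k + d}"
      using V.span_base by blast
    then show ?case
      unfolding ins using Suc.IH[of "Suc k"] ni by (auto simp: V.independent_insertI)
  qed (auto simp: V.independent_empty)
  define D :: "('a \<Rightarrow> 'f) set" where "D = delta ` carrier G"
  have sum_fun_apply: "(\<Sum>i\<in>I. h i) x = (\<Sum>i\<in>I. h i x)" for I :: "'a set" and h :: "'a \<Rightarrow> 'a \<Rightarrow> 'f" and x
    by (induction I rule: infinite_finite_induct) auto
  have "supported a \<Longrightarrow> a \<in> V.span D" for a :: "'a \<Rightarrow> 'f"
  proof -
    assume a: "supported a"
    have "a = (\<Sum>g\<in>carrier G. (\<lambda>x. a g * delta g x))"
    proof
      fix x
      have "(\<Sum>g\<in>carrier G. (\<lambda>x. a g * delta g x)) x = (\<Sum>g\<in>carrier G. if x = g then a g else 0)"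
        unfolding sum_fun_apply by (rule sum.cong) (auto simp: delta_def)
      then show "a x = (\<Sum>g\<in>carrier G. (\<lambda>x. a g * delta g x)) x"
        using a by (simp add: supported_def)
    qed
    also have "\<dots> \<in> V.span D"
      by (intro V.span_sum V.span_scale V.span_base) (auto simp: D_def)
    finally show ?thesis .
  qed
  then have "p ` {0..<0 + Suc (card D)} \<subseteq> V.span D"
    using p by auto
  from V.independent_span_bound[OF _ conjunct1[OF indep] this] conjunct2[OF indep, of 0 "Suc (card D)"]
  show False by (simp add: D_def)
qed

text \<open>Invertibility in Z(FG)e by Fitting's argument: where the chain of ideals x^k Z(FG)e
  becomes stationary it produces a central idempotent below e, which is e or 0 by primitivity, and
  the character excludes 0.\<close>

lemma central_character_unit:
  fixes e :: "'a \<Rightarrow> 'f::field"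
  assumes b: "block (group_algebra G) e" and w: "central_character (group_algebra G) e w"
    and x: "class_function x" "w x \<noteq> 0"
  obtains x' where "class_function x'" "x \<star> x' = e"
proof -
  have e [simp]: "class_function e" "e \<star> e = e"
    using b by (simp_all add: block_iff)
  have ww: "w (a \<star> c) = w a * w c" if "class_function a" "class_function c" for a c
    using w that unfolding central_character_iff by blast
  have we: "w e = 1"
    using w unfolding central_character_iff by blast
  have w0: "w (\<lambda>x. 0) = 0"
  proof -
    have "w (\<lambda>x. 0 * e x) = 0 * w e"
      using w e unfolding central_character_iff by blast
    then show ?thesis by simp
  qed
  have comm: "a \<star> c = c \<star> a" if "class_function a" "class_function c" for a c :: "'a \<Rightarrow> 'f"
    using that class_function_conv_comm class_function_supported by blast
  have lcomm: "a \<star> (c \<star> d) = c \<star> (a \<star> d)" if "class_function a" "class_function c" for a c d :: "'a \<Rightarrow> 'f"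
    using comm[OF that] by (metis conv_assoc)
  note ac = conv_assoc comm lcomm class_function_conv
  have ee: "e \<star> (e \<star> a) = e \<star> a" for a
    by (metis conv_assoc e(2))
  define p where "p y k = (((\<star>) y) ^^ k) e" for y k
  have p_cf [simp]: "class_function y \<Longrightarrow> class_function (p y k)" for y k
    by (induction k) (auto simp: p_def intro: class_function_conv)
  have p_0 [simp]: "p y 0 = e" and p_Suc: "p y (Suc k) = y \<star> p y k" for y k
    by (simp_all add: p_def)
  have pe: "p y k \<star> e = p y k" if "class_function y" for y k
    by (induction k) (use that in \<open>auto simp: p_Suc conv_assoc\<close>)
  have p_add: "p y (i + j) = p y i \<star> p y j" if y: "class_function y" for y i j
  proof (induction i)
    case 0
    then show ?case using pe[OF y, of j] comm[of e "p y j"] y by simp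
  qed (simp add: p_Suc conv_assoc)
  have wp: "w (p x k) = w x ^ k" for k
    by (induction k) (auto simp: p_Suc ww x we)
  obtain k where "\<exists>s. class_function s \<and> p x k = p x (Suc k) \<star> s"
  proof (atomize_elim, rule power_in_span_of_higher[where T = "\<lambda>k a. \<exists>s. class_function s \<and> a = p x (Suc k) \<star> s"])
    show "supported (p x i)" for i
      by (simp add: x class_function_supported)
    show "\<exists>s. class_function s \<and> (\<lambda>x. 0) = p x (Suc k) \<star> s" for k
      by (rule exI[of _ "\<lambda>x. 0"]) (simp add: class_function_zero)
    show "\<exists>s. class_function s \<and> (\<lambda>x. a x + b x) = p x (Suc k) \<star> s"
      if a: "\<exists>s. class_function s \<and> a = p x (Suc k) \<star> s" and b: "\<exists>s. class_function s \<and> b = p x (Suc k) \<star> s" for k a b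
    proof -
      from a b obtain s t where "class_function s" "a = p x (Suc k) \<star> s" "class_function t" "b = p x (Suc k) \<star> t"
        by blast
      then show ?thesis
        by (intro exI[of _ "\<lambda>x. s x + t x"]) (simp add: conv_add_right class_function_add)
    qed
    show "\<exists>s. class_function s \<and> (\<lambda>x. c * a x) = p x (Suc k) \<star> s"
      if a: "\<exists>s. class_function s \<and> a = p x (Suc k) \<star> s" for k c a
    proof -
      from a obtain s where "class_function s" "a = p x (Suc k) \<star> s"
        by blast
      then show ?thesis
        by (intro exI[of _ "\<lambda>x. c * s x"]) (simp add: conv_smult_right class_function_smult)
    qed
    show "\<exists>s. class_function s \<and> p x i = p x (Suc k) \<star> s" if "k < i" for i k
      using p_add[OF x(1), of "Suc k" "i - Suc k"] that x by (intro exI[of _ "p x (i - Suc k)"]) auto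
  qed
  then obtain s where s: "class_function s" "p x k = p x (Suc k) \<star> s" by blast
  have step: "p x k = p x (k + j) \<star> p s j" for j
  proof (induction j)
    case (Suc j)
    have "p x (k + Suc j) \<star> p s (Suc j) = p x (j + Suc k) \<star> (s \<star> p s j)"
      by (simp add: p_Suc add.commute)
    also have "\<dots> = p x j \<star> ((p x (Suc k) \<star> s) \<star> p s j)"
      using x s by (simp add: p_add conv_assoc del: add_Suc_right)
    also have "\<dots> = p x (j + k) \<star> p s j"
      using x s(2)[symmetric] by (simp add: p_add conv_assoc)
    finally show ?case using Suc by (simp add: add.commute)
  qed (use x in \<open>simp add: pe\<close>)
  \<comment> \<open>\<open>f\<close> is (x s)^k e. It acts as the identity on x^k e and is itself a
    multiple of x^k e, so it is idempotent.\<close>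
  define f where "f = p x k \<star> p s k"
  have f: "class_function f"
    using x s by (simp add: f_def class_function_conv)
  have kf: "p x k \<star> f = p x k"
    using step[of k] x unfolding f_def by (simp add: p_add conv_assoc)
  have ff: "f \<star> f = f"
  proof -
    have "f \<star> f = (p x k \<star> f) \<star> p s k"
      using x s f unfolding f_def by (simp add: ac)
    then show ?thesis unfolding kf by (simp add: f_def)
  qed
  have "e \<star> f = f"
    using pe[OF s(1)] x s comm[of e f] f unfolding f_def by (simp add: conv_assoc)
  with block_mult_idempotent[OF b f ff] have "f = e \<or> f = (\<lambda>x. 0)" by auto
  \<comment> \<open>If \<open>f\<close> were 0, then x^k e would be 0 as well, although its
    character value is the nonzero number (w x)^k.\<close>
  then have fe: "f = e"
  proof
    assume "f = (\<lambda>x. 0)"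
    then have "p x k = (\<lambda>x. 0)"
      using kf by simp
    then show ?thesis
      using wp[of k] x w0 by simp
  qed
  show thesis
  proof (cases k)
    \<comment> \<open>For k = 0 stationarity reads e = x e s, which already exhibits the inverse;
      for larger k a factor x is split off from \<open>f\<close>.\<close>
    case 0
    then show thesis
      using that[of "e \<star> s"] s by (simp add: p_Suc conv_assoc class_function_conv)
  next
    case (Suc k')
    have "x \<star> (p x k' \<star> p s k) = f"
      by (simp add: f_def Suc p_Suc[of x] conv_assoc)
    then show thesis
      using that[of "p x k' \<star> p s k"] x(1) s(1) fe by (simp add: class_function_conv)
  qed
qed


subsection \<open>Normal $p$-subgroups\<close>

lemma delta_conv_conv:
  assumes "g \<in> carrier G" "h \<in> carrier G"
  shows "delta g \<star> (delta h \<star> a) = (delta (g \<otimes> h) \<star> (a :: 'a \<Rightarrow> 'f::field))"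
proof
  fix x
  show "(delta g \<star> (delta h \<star> a)) x = (delta (g \<otimes> h) \<star> a) x"
  proof (cases "x \<in> carrier G")
    case True
    then show ?thesis using assms by (simp add: delta_conv inv_mult_group m_assoc)
  qed (simp add: conv_apply)
qed

lemma delta_one_conv: "supported a \<Longrightarrow> delta \<one> \<star> a = a"
  by (rule ext, rename_tac x, case_tac "x \<in> carrier G") (auto simp: delta_conv, auto simp: supported_def conv_apply)

lemma conv_sum_right: "c \<star> (\<lambda>x. \<Sum>i\<in>I. a i x) = (\<lambda>x. \<Sum>i\<in>I. (c \<star> a i) x)"
  by (induction I rule: infinite_finite_induct) (auto simp: conv_add_right)

text \<open>Only combinations with natural-number coefficients are formed: modulo p they make up a
  finite set even when the field is infinite, so that the vectors fixed by N can be counted in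
  characteristic p.\<close>

lemma p_group_fixed_vector:
  fixes v :: "'a \<Rightarrow> 'f::field"
  assumes N: "subgroup N G" "card N = p ^ k" and p: "prime p" "CHAR('f) = p"
    and v: "supported v" "v \<noteq> (\<lambda>x. 0)"
  obtains c :: "'a \<Rightarrow> nat" where
    "(\<lambda>x. \<Sum>n\<in>N. of_nat (c n) * (delta n \<star> v) x) \<noteq> (\<lambda>x. 0)"
    "\<And>m. m \<in> N \<Longrightarrow> delta m \<star> (\<lambda>x. \<Sum>n\<in>N. of_nat (c n) * (delta n \<star> v) x) =
       (\<lambda>x. \<Sum>n\<in>N. of_nat (c n) * (delta n \<star> v) x)"
proof -
  interpret N: subgroup N G by fact
  have finN: "finite N"
    using N.subset finite_subset by blast
  define comb where "comb c = (\<lambda>x. \<Sum>n\<in>N. of_nat (c n) * (delta n \<star> v) x)" for c :: "'a \<Rightarrow> nat"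
  define W where "W = range comb"
  have mod: "of_nat (m mod p) = (of_nat m :: 'f)" for m
  proof -
    have "(of_nat m :: 'f) = of_nat (p * (m div p) + m mod p)" by simp
    also have "\<dots> = of_nat (m mod p)"
      using p(2) of_nat_CHAR[where 'a = 'f] by (simp only: of_nat_add of_nat_mult) simp
    finally show ?thesis ..
  qed
  have "W \<subseteq> comb ` (N \<rightarrow>\<^sub>E {..<p})"
  proof
    fix u assume "u \<in> W"
    then obtain c where c: "u = comb c" by (auto simp: W_def)
    have "u = comb (restrict (\<lambda>n. c n mod p) N)"
      unfolding c comb_def by (intro ext sum.cong) (auto simp: mod)
    moreover have "restrict (\<lambda>n. c n mod p) N \<in> N \<rightarrow>\<^sub>E {..<p}"
      using p(1) by (auto simp: prime_gt_0_nat)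
    ultimately show "u \<in> comb ` (N \<rightarrow>\<^sub>E {..<p})" by blast
  qed
  then have finW: "finite W"
    by (rule finite_subset) (intro finite_imageI finite_PiE finN finite_lessThan)
  have act: "delta m \<star> comb c = comb (\<lambda>n. c (inv m \<otimes> n))" if m: "m \<in> N" for m c
  proof
    fix x
    have "(delta m \<star> comb c) x = (\<Sum>n\<in>N. of_nat (c n) * (delta (m \<otimes> n) \<star> v) x)"
      unfolding comb_def conv_sum_right conv_smult_right
      using m N.subset by (intro sum.cong) (auto simp: delta_conv_conv)
    also have "\<dots> = (\<Sum>n\<in>N. of_nat (c (inv m \<otimes> n)) * (delta n \<star> v) x)"
      by (rule sum.reindex_bij_witness[where i = "\<lambda>n. inv m \<otimes> n" and j = "\<lambda>n. m \<otimes> n"])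
         (use m N.subset in \<open>auto simp: m_assoc[symmetric]\<close>)
    finally show "(delta m \<star> comb c) x = comb (\<lambda>n. c (inv m \<otimes> n)) x"
      by (simp add: comb_def)
  qed
  have suppW: "supported u" if "u \<in> W" for u
    using that by (auto simp: W_def comb_def supported_def conv_apply)
  let ?Fix = "{u \<in> W. \<forall>m\<in>carrier (G\<lparr>carrier := N\<rparr>). delta m \<star> u = u}"
  have "(\<Sum>u\<in>W. 1) = (\<Sum>u\<in>?Fix. (1::'f))"
    by (rule sum_fixed_points_p_group[where p = p and k = k])
       (use N p finW N.subset in \<open>auto simp: W_def act delta_conv_conv delta_one_conv subgroup_imp_group
          subsetD suppW[unfolded W_def]\<close>)
  \<comment> \<open>Adding v permutes the finite set \<open>W\<close>. Summing the coordinate at x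
    before and after gives card W times v x = 0, hence the number of fixed vectors is 0 in the field
    too, and the zero vector cannot be the only one.\<close>
  moreover have zero: "(\<Sum>u\<in>W. 1) = (0::'f)"
  proof -
    obtain x where x: "v x \<noteq> 0" using v(2) by auto
    have vW: "v = comb (\<lambda>n. if n = \<one> then 1 else 0)"
    proof
      fix x
      have "comb (\<lambda>n. if n = \<one> then 1 else 0) x = (\<Sum>n\<in>N. if n = \<one> then (delta \<one> \<star> v) x else 0)"
        unfolding comb_def by (rule sum.cong) auto
      also have "\<dots> = v x"
        using finN v(1) by (simp add: delta_one_conv)
      finally show "v x = comb (\<lambda>n. if n = \<one> then 1 else 0) x" ..
    qed
    have addW: "(\<lambda>x. u x + v x) \<in> W" if "u \<in> W" for u
    proof -
      from that obtain c where c: "u = comb c" by (auto simp: W_def)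
      have "(\<lambda>x. u x + v x) = comb (\<lambda>n. c n + (if n = \<one> then 1 else 0))"
        unfolding c by (subst vW) (auto simp: comb_def fun_eq_iff distrib_right sum.distrib)
      then show ?thesis by (simp add: W_def)
    qed
    have inj: "inj_on (\<lambda>u x. u x + v x) W"
      by (auto simp: inj_on_def fun_eq_iff)
    have "(\<lambda>u x. u x + v x) ` W = W"
      using addW inj finW by (intro endo_inj_surj) auto
    then have "(\<Sum>u\<in>W. u x) = (\<Sum>u\<in>W. u x + v x)"
      using sum.reindex[OF inj, of "\<lambda>u. u x"] by simp
    then have "of_nat (card W) * v x = 0"
      by (simp add: sum.distrib)
    then show ?thesis using x by simp
  qed
  ultimately have z: "(\<Sum>u\<in>?Fix. (1::'f)) = 0" by simp
  have "\<exists>u\<in>?Fix. u \<noteq> (\<lambda>x. 0)"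
  proof (rule ccontr)
    assume "\<not> (\<exists>u\<in>?Fix. u \<noteq> (\<lambda>x. 0))"
    moreover have "(\<lambda>x. 0) \<in> ?Fix"
    proof -
      have "(\<lambda>x. 0) = comb (\<lambda>n. 0)" by (simp add: comb_def)
      then have "(\<lambda>x. 0) \<in> W" unfolding W_def by (rule range_eqI[where f = comb])
      then show ?thesis by simp
    qed
    ultimately have "?Fix = {\<lambda>x. 0}" by blast
    then show False using z by simp
  qed
  then obtain c where "comb c \<noteq> (\<lambda>x. 0)" "\<And>m. m \<in> N \<Longrightarrow> delta m \<star> comb c = comb c"
    by (auto simp: W_def)
  then show thesis
    using that[of c] unfolding comb_def by blast
qed

text \<open>If \<open>x\<close> vanished on the centralizer of \<open>N\<close>, it would annihilate every vector \<open>u\<close> fixed by \<open>N\<close>, because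
  \<open>h \<mapsto> x(h) u(h\<^sup>-\<^sup>1 g)\<close> is invariant under conjugation by \<open>N\<close>.\<close>

lemma normal_p_subgroup_support:
  fixes e :: "'a \<Rightarrow> 'f::field"
  assumes N: "subgroup N G" "card N = p ^ k" and p: "prime p" "CHAR('f) = p"
    and normal: "\<And>g n. g \<in> carrier G \<Longrightarrow> n \<in> N \<Longrightarrow> g \<otimes> n \<otimes> inv g \<in> N"
    and e: "class_function e" "e \<star> e = e" "e \<noteq> (\<lambda>x. 0)"
    and x: "class_function x" "class_function x'" "x \<star> x' = e"
  shows "\<exists>u\<in>centralizer G N. x u \<noteq> 0"
proof (rule ccontr)
  assume "\<not> ?thesis"
  then have x0: "\<And>u. u \<in> centralizer G N \<Longrightarrow> x u = 0" by blast
  interpret N: subgroup N G by fact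
  obtain c :: "'a \<Rightarrow> nat" where c: "(\<lambda>x. \<Sum>n\<in>N. of_nat (c n) * (delta n \<star> e) x) \<noteq> (\<lambda>x. 0)"
    "\<And>m. m \<in> N \<Longrightarrow> delta m \<star> (\<lambda>x. \<Sum>n\<in>N. of_nat (c n) * (delta n \<star> e) x) =
       (\<lambda>x. \<Sum>n\<in>N. of_nat (c n) * (delta n \<star> e) x)"
    using p_group_fixed_vector[OF N p class_function_supported[OF e(1)] e(3)] by blast
  define u where "u = (\<lambda>x. \<Sum>n\<in>N. of_nat (c n) * (delta n \<star> e) x)"
  have u0: "u \<noteq> (\<lambda>x. 0)"
    using c(1) by (simp add: u_def)
  have u: "u (inv m \<otimes> y) = u y" if "m \<in> N" "y \<in> carrier G" for m y
    using c(2)[OF that(1)] that N.subset delta_conv[of m y u] by (auto simp: u_def)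
  have "e \<star> (delta n \<star> e) = delta n \<star> e" if "n \<in> N" for n
  proof -
    have "e \<star> (delta n \<star> e) = (e \<star> delta n) \<star> e"
      by (rule conv_assoc[symmetric])
    also have "\<dots> = (delta n \<star> e) \<star> e"
      using that N.subset e(1) by (subst class_function_conv_comm) (auto simp: subsetD)
    finally show ?thesis by (simp add: conv_assoc e)
  qed
  then have eu: "e \<star> u = u"
    unfolding u_def conv_sum_right conv_smult_right by simp
  have "x \<star> u = (\<lambda>y. 0)"
  proof
    fix g
    show "(x \<star> u) g = 0"
    proof (cases "g \<in> carrier G")
      case g: True
      have uinv: "u (n \<otimes> y) = u y" if "n \<in> N" "y \<in> carrier G" for n y
        using u[of "inv n" y] that N.subset by auto
      have "(x \<star> u) g = (\<Sum>h\<in>carrier G. x h * u (inv h \<otimes> g))"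
        using g by (simp add: conv_apply)
      also have "\<dots> = (\<Sum>h\<in>{h \<in> carrier G. \<forall>n\<in>carrier (G\<lparr>carrier := N\<rparr>). n \<otimes> h \<otimes> inv n = h}. x h * u (inv h \<otimes> g))"
      proof (rule sum_fixed_points_p_group[where p = p and k = k])
        show "group (G\<lparr>carrier := N\<rparr>)" by (rule subgroup_imp_group) fact
        fix n h assume nh: "n \<in> carrier (G\<lparr>carrier := N\<rparr>)" "h \<in> carrier G"
        then have n: "n \<in> carrier G" "n \<in> N" using N.subset by auto
        show "n \<otimes> h \<otimes> inv n \<in> carrier G" using n nh by simp
        \<comment> \<open>By normality of N, all that conjugating h by n introduces can be collected
          into factors from N to the left of h^-1 g, where \<open>u\<close> absorbs them.\<close>
        have "inv (n \<otimes> h \<otimes> inv n) \<otimes> g = n \<otimes> ((inv h \<otimes> inv n \<otimes> inv (inv h)) \<otimes> (inv h \<otimes> g))"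
          using n nh g by (simp add: inv_mult_group m_assoc) (simp add: m_assoc[symmetric])
        moreover have "inv h \<otimes> inv n \<otimes> inv (inv h) \<in> N"
          using n nh by (intro normal) auto
        ultimately have "u (inv (n \<otimes> h \<otimes> inv n) \<otimes> g) = u (inv h \<otimes> g)"
          using n nh g by (simp add: uinv)
        then show "x (n \<otimes> h \<otimes> inv n) * u (inv (n \<otimes> h \<otimes> inv n) \<otimes> g) = x h * u (inv h \<otimes> g)"
          using class_functionD[OF x(1)] n nh by simp
      next
        fix n n' h assume "n \<in> carrier (G\<lparr>carrier := N\<rparr>)" "n' \<in> carrier (G\<lparr>carrier := N\<rparr>)" "h \<in> carrier G"
        then show "n \<otimes>\<^bsub>G\<lparr>carrier := N\<rparr>\<^esub> n' \<otimes> h \<otimes> inv (n \<otimes>\<^bsub>G\<lparr>carrier := N\<rparr>\<^esub> n') = n \<otimes> (n' \<otimes> h \<otimes> inv n') \<otimes> inv n"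
          using N.subset by (simp add: inv_mult_group m_assoc subsetD)
      qed (use N p in auto)
      also have "\<dots> = 0"
      proof (rule sum.neutral, rule ballI)
        fix h assume h: "h \<in> {h \<in> carrier G. \<forall>n\<in>carrier (G\<lparr>carrier := N\<rparr>). n \<otimes> h \<otimes> inv n = h}"
        have "h \<otimes> n = n \<otimes> h" if n: "n \<in> N" for n
        proof -
          have "n \<otimes> h \<otimes> inv n = h" using h n by auto
          then have "n \<otimes> h \<otimes> inv n \<otimes> n = h \<otimes> n" by simp
          then show ?thesis using h n N.subset by (simp add: m_assoc subsetD)
        qed
        then have "h \<in> centralizer G N"
          using h by (auto simp: centralizer_def)
        then show "x h * u (inv h \<otimes> g) = 0" by (simp add: x0)
      qed
      finally show ?thesis .
    qed (simp add: conv_apply)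
  qed
  \<comment> \<open>x kills \<open>u\<close>, but it is invertible on the block: x' x u = e u = u,
    which is nonzero.\<close>
  then have "x' \<star> (x \<star> u) = (\<lambda>y. 0)" by simp
  moreover have "x' \<star> (x \<star> u) = e \<star> u"
    using x class_function_conv_comm[OF x(1) class_function_supported[OF x(2)]] by (metis conv_assoc)
  ultimately show False
    using eu u0 by simp
qed


subsection \<open>Relative traces and class sums\<close>

text \<open>Two representatives of a coset differ by an element of X, which fixes a. This frees all
  later computations from the choice made in \<open>rel_trace\<close>.\<close>

lemma conj_act_coset_rep:
  assumes X: "subgroup X G" and a: "a \<in> fixed_elements G X" and C: "C \<in> lcosets X"
    and g: "g \<in> C" and x: "x \<in> carrier G"
  shows "conj_act G (SOME g. g \<in> C) a x = a (inv g \<otimes> x \<otimes> g)"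
proof -
  interpret X: subgroup X G by fact
  have gC: "(SOME g. g \<in> C) \<in> C" using g by (rule someI)
  obtain h where h: "h \<in> carrier G" "C = h <# X" using C by (auto simp: LCOSETS_def)
  obtain d1 d2 where d: "d1 \<in> X" "d2 \<in> X" "(SOME g. g \<in> C) = h \<otimes> d1" "g = h \<otimes> d2"
    using g gC unfolding h(2) l_coset_def by blast
  have dc: "d1 \<in> carrier G" "d2 \<in> carrier G" using d X.subset by auto
  define k where "k = inv d1 \<otimes> d2"
  have k: "k \<in> X" "k \<in> carrier G" "g = (SOME g. g \<in> C) \<otimes> k" "(SOME g. g \<in> C) \<in> carrier G"
    using d dc h by (auto simp: k_def m_assoc) (simp add: m_assoc[symmetric])
  let ?s = "SOME g. g \<in> C"
  have "conj_act G k a (inv ?s \<otimes> x \<otimes> ?s) = a (inv ?s \<otimes> x \<otimes> ?s)"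
    using a k(1) by (simp add: fixed_elements_def)
  then have "a (inv k \<otimes> (inv ?s \<otimes> x \<otimes> ?s) \<otimes> k) = a (inv ?s \<otimes> x \<otimes> ?s)"
    using k x by (simp add: conj_act_def)
  moreover have "inv k \<otimes> (inv ?s \<otimes> x \<otimes> ?s) \<otimes> k = inv g \<otimes> x \<otimes> g"
    using k(2,4) x unfolding k(3) by (simp add: inv_mult_group m_assoc)
  ultimately show ?thesis
    using x by (simp add: conj_act_def)
qed

lemma lcosets_left_mult: "subgroup X G \<Longrightarrow> C \<in> lcosets X \<Longrightarrow> r \<in> carrier G \<Longrightarrow> r <# C \<in> lcosets X"
  by (auto simp: LCOSETS_def lcos_m_assoc subgroup.subset)

lemma finite_lcosets: "subgroup X G \<Longrightarrow> finite (lcosets X)"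
  unfolding LCOSETS_def by auto

lemma lcosets_nonempty:
  assumes "subgroup X G" "C \<in> lcosets X"
  shows "\<exists>g. g \<in> C \<and> g \<in> carrier G"
proof -
  obtain a where "a \<in> carrier G" "C = a <# X" using assms(2) by (auto simp: LCOSETS_def)
  then show ?thesis using lcos_self[OF _ assms(1)] by blast
qed

lemma lcosets_subset: "subgroup X G \<Longrightarrow> C \<in> lcosets X \<Longrightarrow> C \<subseteq> carrier G"
  by (rule subgroup.lcosets_carrier[OF _ group_axioms])

text \<open>R acts on the left cosets of X by left multiplication, and the summands of the trace at
  x are invariant because R commutes with x. Since the sum is nonzero, R fixes some coset gX, which
  says that g^-1 R g lies in X.\<close>

lemma rel_trace_support:
  fixes z :: "'a \<Rightarrow> 'f::field"
  assumes X: "subgroup X G" and z: "z \<in> rel_trace G X ` fixed_elements G X" and zx: "z x \<noteq> 0"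
    and R: "subgroup R G" "card R = p ^ k" and p: "prime p" "CHAR('f) = p"
    and comm: "\<And>r. r \<in> R \<Longrightarrow> r \<otimes> x = x \<otimes> r"
  obtains g where "g \<in> carrier G" "\<And>r. r \<in> R \<Longrightarrow> inv g \<otimes> r \<otimes> g \<in> X"
proof -
  interpret X: subgroup X G by fact
  interpret R: subgroup R G by fact
  obtain a where a: "a \<in> fixed_elements G X" "z = rel_trace G X a" using z by auto
  have x: "x \<in> carrier G"
  proof (rule ccontr)
    assume "x \<notin> carrier G"
    then show False using zx by (simp add: a(2) rel_trace_def conj_act_def)
  qed
  let ?f = "\<lambda>C. conj_act G (SOME g. g \<in> C) a x"
  let ?Fix = "{C \<in> lcosets X. \<forall>r\<in>carrier (G\<lparr>carrier := R\<rparr>). r <# C = C}"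
  have "sum ?f (lcosets X) = sum ?f ?Fix"
  proof (rule sum_fixed_points_p_group[where p = p and k = k])
    show "group (G\<lparr>carrier := R\<rparr>)" by (rule subgroup_imp_group) fact
    show "finite (lcosets X)" by (rule finite_lcosets) fact
    fix r C assume rC: "r \<in> carrier (G\<lparr>carrier := R\<rparr>)" "C \<in> lcosets X"
    then have r: "r \<in> R" "r \<in> carrier G" by auto
    show 1: "r <# C \<in> lcosets X" using rC r X by (simp add: lcosets_left_mult)
    obtain g where g: "g \<in> C" "g \<in> carrier G" using lcosets_nonempty[OF X rC(2)] by blast
    have "r \<otimes> g \<in> r <# C" using g by (auto simp: l_coset_def)
    from conj_act_coset_rep[OF X a(1) 1 this x] have "?f (r <# C) = a (inv (r \<otimes> g) \<otimes> x \<otimes> (r \<otimes> g))" .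
    also have "inv (r \<otimes> g) \<otimes> x \<otimes> (r \<otimes> g) = inv g \<otimes> (inv r \<otimes> (x \<otimes> r)) \<otimes> g"
      using r g x by (simp add: inv_mult_group m_assoc)
    also have "\<dots> = inv g \<otimes> x \<otimes> g"
      unfolding comm[OF r(1), symmetric] using r g x by (simp add: m_assoc[symmetric])
    also have "a \<dots> = ?f C"
      by (rule conj_act_coset_rep[OF X a(1) rC(2) g(1) x, symmetric])
    finally show "?f (r <# C) = ?f C" .
  next
    fix r r' C assume "r \<in> carrier (G\<lparr>carrier := R\<rparr>)" "r' \<in> carrier (G\<lparr>carrier := R\<rparr>)" "C \<in> lcosets X"
    then show "r \<otimes>\<^bsub>G\<lparr>carrier := R\<rparr>\<^esub> r' <# C = r <# (r' <# C)"
      using lcosets_subset[OF X] by (simp add: lcos_m_assoc)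
  next
    fix C assume "C \<in> lcosets X"
    then show "\<one>\<^bsub>G\<lparr>carrier := R\<rparr>\<^esub> <# C = C"
      using lcosets_subset[OF X] by (simp add: lcos_mult_one)
  qed (use R p in auto)
  then have "sum ?f ?Fix \<noteq> 0"
    using zx a(2) unfolding rel_trace_def by simp
  then have "?Fix \<noteq> {}" by (metis (no_types, lifting) sum.empty)
  then obtain C where C: "C \<in> lcosets X" "\<And>r. r \<in> R \<Longrightarrow> r <# C = C" by auto
  then obtain g where g: "g \<in> carrier G" "C = g <# X" by (auto simp: LCOSETS_def)
  show thesis
  proof (rule that[OF g(1)])
    fix r assume r: "r \<in> R"
    have "g \<in> C" using lcos_self[OF g(1) X] g by simp
    then have "r \<otimes> g \<in> r <# C" by (auto simp: l_coset_def)
    then have "r \<otimes> g \<in> g <# X" using C(2)[OF r] g by simp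
    then have "inv g \<otimes> (r \<otimes> g) \<in> X"
      using X.lcos_module_imp[OF group_axioms g(1)] by blast
    then show "inv g \<otimes> r \<otimes> g \<in> X" using r g by (simp add: m_assoc)
  qed
qed

section \<open>Conjugacy classes and class sums\<close>

definition conj_class :: "'a \<Rightarrow> 'a set" where
  "conj_class x = (\<lambda>g. g \<otimes> x \<otimes> inv g) ` carrier G"

definition class_sum :: "'a \<Rightarrow> 'a \<Rightarrow> 'f::field" where
  "class_sum x = (\<lambda>y. if y \<in> conj_class x then 1 else 0)"

lemma mem_conj_class_self: "x \<in> carrier G \<Longrightarrow> x \<in> conj_class x"
  by (auto simp: conj_class_def image_iff intro!: bexI[of _ \<one>])

lemma conj_class_subset: "x \<in> carrier G \<Longrightarrow> conj_class x \<subseteq> carrier G"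
  by (auto simp: conj_class_def)

lemma conj_mem_conj_class:
  assumes "x \<in> carrier G" "y \<in> conj_class x" "g \<in> carrier G"
  shows "g \<otimes> y \<otimes> inv g \<in> conj_class x"
proof -
  obtain h where h: "h \<in> carrier G" "y = h \<otimes> x \<otimes> inv h" using assms by (auto simp: conj_class_def)
  have "g \<otimes> y \<otimes> inv g = (g \<otimes> h) \<otimes> x \<otimes> inv (g \<otimes> h)"
    using assms h by (simp add: inv_mult_group m_assoc)
  then show ?thesis using assms h by (auto simp: conj_class_def)
qed

lemma conj_mem_conj_class_iff:
  assumes "x \<in> carrier G" "y \<in> carrier G" "g \<in> carrier G"
  shows "g \<otimes> y \<otimes> inv g \<in> conj_class x \<longleftrightarrow> y \<in> conj_class x"
proof
  assume "g \<otimes> y \<otimes> inv g \<in> conj_class x"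
  from conj_mem_conj_class[OF assms(1) this, of "inv g"] have "inv g \<otimes> (g \<otimes> y \<otimes> inv g) \<otimes> g \<in> conj_class x"
    using assms by simp
  moreover have "inv g \<otimes> (g \<otimes> y \<otimes> inv g) \<otimes> g = y"
    using assms by (simp add: m_assoc) (simp add: m_assoc[symmetric])
  ultimately show "y \<in> conj_class x" by simp
qed (use assms conj_mem_conj_class in blast)

lemma class_function_class_sum: "x \<in> carrier G \<Longrightarrow> class_function (class_sum x)"
  using conj_class_subset by (auto simp: class_function_def supported_def class_sum_def conj_mem_conj_class_iff)

lemma conj_class_eq:
  assumes "x \<in> carrier G" "y \<in> conj_class x"
  shows "conj_class y = conj_class x"
proof -
  have y: "y \<in> carrier G" using assms conj_class_subset by blast
  have "conj_class y \<subseteq> conj_class x"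
    using conj_mem_conj_class[OF assms] by (auto simp: conj_class_def[of y])
  moreover have "x \<in> conj_class y"
  proof -
    obtain g where g: "g \<in> carrier G" "y = g \<otimes> x \<otimes> inv g" using assms by (auto simp: conj_class_def)
    have "x = inv g \<otimes> y \<otimes> inv (inv g)"
      using assms g by (simp add: m_assoc) (simp add: m_assoc[symmetric])
    then show ?thesis unfolding conj_class_def by (rule image_eqI) (use g in simp)
  qed
  then have "conj_class x \<subseteq> conj_class y"
    using conj_mem_conj_class[OF y, of x] by (auto simp: conj_class_def[of x])
  ultimately show ?thesis by blast
qed

lemma class_function_decomp:
  fixes a :: "'a \<Rightarrow> 'f::field"
  assumes a: "class_function a"
  shows "a = (\<lambda>y. \<Sum>K\<in>conj_class ` {x \<in> carrier G. a x \<noteq> 0}. a (SOME x. x \<in> K) * class_sum (SOME x. x \<in> K) y)"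
proof
  fix y
  let ?I = "conj_class ` {x \<in> carrier G. a x \<noteq> 0}"
  have rep: "(SOME x. x \<in> conj_class x0) \<in> conj_class x0" if "x0 \<in> carrier G" for x0
    using someI[of "\<lambda>x. x \<in> conj_class x0", OF mem_conj_class_self[OF that]] .
  have const: "a u = a x0" if "u \<in> conj_class x0" "x0 \<in> carrier G" for u x0
    using that class_functionD[OF a] by (auto simp: conj_class_def)
  have "(\<Sum>K\<in>?I. a (SOME x. x \<in> K) * class_sum (SOME x. x \<in> K) y) = (\<Sum>K\<in>?I. if K = conj_class y then a y else 0)"
  proof (rule sum.cong[OF refl])
    fix K assume "K \<in> ?I"
    then obtain x0 where x0: "x0 \<in> carrier G" "K = conj_class x0" by auto
    define s where "s = (SOME x. x \<in> K)"
    have s: "s \<in> conj_class x0" "s \<in> carrier G" "conj_class s = K"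
      using rep[OF x0(1)] conj_class_subset[OF x0(1)] conj_class_eq[OF x0(1)] unfolding s_def x0 by auto
    have "a s * class_sum s y = (if K = conj_class y then a y else 0)"
    proof (cases "y \<in> conj_class s")
      case True
      then show ?thesis using conj_class_eq[OF s(2) True] s const[OF True s(2)] by (simp add: class_sum_def)
    next
      case False
      have "a y = 0" if "K = conj_class y"
      proof (rule ccontr)
        assume "a y \<noteq> 0"
        then have "y \<in> carrier G" using class_function_supported[OF a] by (auto simp: supported_def)
        then show False using mem_conj_class_self that s False by auto
      qed
      then show ?thesis using False by (simp add: class_sum_def)
    qed
    then show "a (SOME x. x \<in> K) * class_sum (SOME x. x \<in> K) y = (if K = conj_class y then a y else 0)"
      by (simp add: s_def)
  qed
  also have "\<dots> = a y"
  proof -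
    have "a y = 0" if "conj_class y \<notin> ?I"
      using that class_function_supported[OF a] by (auto simp: supported_def)
    then show ?thesis by (simp add: sum.delta)
  qed
  finally show "a y = (\<Sum>K\<in>?I. a (SOME x. x \<in> K) * class_sum (SOME x. x \<in> K) y)" ..
qed

text \<open>Expand a in class sums: some term with nonzero coefficient must survive. The use lies in
  having one x with both properties, since a x controls centralizers of x from above through
  \<open>rel_trace_support\<close> and w controls them from below through invertibility of the class
  sum.\<close>

lemma functional_nonzero_on_class_sum:
  fixes a :: "'a \<Rightarrow> 'f::field"
  assumes a: "class_function a" and w: "w a \<noteq> (0::'f)"
    and add: "\<And>a b. class_function a \<Longrightarrow> class_function b \<Longrightarrow> w (\<lambda>x. a x + b x) = w a + w b"
    and smult: "\<And>c a. class_function a \<Longrightarrow> w (\<lambda>x. c * a x) = c * w a"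
  obtains x where "x \<in> carrier G" "a x \<noteq> 0" "w (class_sum x) \<noteq> 0"
proof -
  let ?I = "conj_class ` {x \<in> carrier G. a x \<noteq> 0}"
  let ?r = "\<lambda>K. SOME x. x \<in> K"
  have rep: "?r K \<in> carrier G \<and> a (?r K) \<noteq> 0" if "K \<in> ?I" for K
  proof -
    from that obtain x where x: "x \<in> carrier G" "a x \<noteq> 0" "K = conj_class x" by auto
    have "?r K \<in> conj_class x"
      unfolding x using someI[of "\<lambda>u. u \<in> conj_class x", OF mem_conj_class_self[OF x(1)]] .
    then show ?thesis using conj_class_subset[OF x(1)] class_functionD[OF a] x by (auto simp: conj_class_def[of x])
  qed
  have w0: "w (\<lambda>x. 0) = 0"
    using smult[OF class_function_zero, of 0] by simp
  have lin: "finite J \<Longrightarrow> J \<subseteq> ?I \<Longrightarrow> class_function (\<lambda>y. \<Sum>K\<in>J. a (?r K) * class_sum (?r K) y) \<and>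
      w (\<lambda>y. \<Sum>K\<in>J. a (?r K) * class_sum (?r K) y) = (\<Sum>K\<in>J. a (?r K) * w (class_sum (?r K)))" for J
    by (induction J rule: finite_induct)
       (auto simp: w0 class_function_zero add smult class_function_smult class_function_class_sum rep class_function_add)
  have "(\<Sum>K\<in>?I. a (?r K) * w (class_sum (?r K))) \<noteq> 0"
    using lin[of ?I] w class_function_decomp[OF a] by simp
  then obtain K where "K \<in> ?I" "a (?r K) * w (class_sum (?r K)) \<noteq> 0"
    by (meson sum.not_neutral_contains_not_neutral)
  then show thesis using rep[of K] that[of "?r K"] by auto
qed


subsection \<open>Defect groups\<close>

lemma subgroup_centralizer:
  assumes "S \<subseteq> carrier G"
  shows "subgroup (centralizer G S) G"
proof (rule subgroupI)
  show "centralizer G S \<subseteq> carrier G" by (auto simp: centralizer_def)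
  show "centralizer G S \<noteq> {}" using assms by (auto simp: centralizer_def intro!: exI[of _ \<one>])
next
  fix a assume a: "a \<in> centralizer G S"
  then have ac: "a \<in> carrier G" by (simp add: centralizer_def)
  have "inv a \<otimes> s = s \<otimes> inv a" if s: "s \<in> S" for s
  proof -
    have "a \<otimes> s = s \<otimes> a" using a s by (simp add: centralizer_def)
    then have "inv a \<otimes> (a \<otimes> s) \<otimes> inv a = inv a \<otimes> (s \<otimes> a) \<otimes> inv a" by simp
    moreover have "inv a \<otimes> (a \<otimes> s) \<otimes> inv a = s \<otimes> inv a" "inv a \<otimes> (s \<otimes> a) \<otimes> inv a = inv a \<otimes> s"
      using ac s assms by (simp_all add: m_assoc subsetD) (simp add: m_assoc[symmetric] subsetD)
    ultimately show ?thesis by simp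
  qed
  then show "inv a \<in> centralizer G S" using ac by (simp add: centralizer_def)
next
  fix a b assume "a \<in> centralizer G S" "b \<in> centralizer G S"
  then have ab: "a \<in> carrier G" "b \<in> carrier G" "\<And>s. s \<in> S \<Longrightarrow> a \<otimes> s = s \<otimes> a" "\<And>s. s \<in> S \<Longrightarrow> b \<otimes> s = s \<otimes> b"
    by (auto simp: centralizer_def)
  have "a \<otimes> b \<otimes> s = s \<otimes> (a \<otimes> b)" if s: "s \<in> S" for s
  proof -
    have sc: "s \<in> carrier G" using s assms by blast
    have "a \<otimes> b \<otimes> s = a \<otimes> (s \<otimes> b)" using ab(1,2) sc by (simp add: m_assoc ab(4)[OF s])
    also have "\<dots> = a \<otimes> s \<otimes> b" using ab(1,2) sc by (simp add: m_assoc)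
    also have "\<dots> = s \<otimes> (a \<otimes> b)" unfolding ab(3)[OF s] using ab(1,2) sc by (simp add: m_assoc)
    finally show ?thesis .
  qed
  then show "a \<otimes> b \<in> centralizer G S" using ab by (simp add: centralizer_def)
qed

lemma exists_sylow_subgroup:
  assumes p: "prime (p::nat)" and K: "subgroup K G"
  obtains S a m where "subgroup S G" "S \<subseteq> K" "card S = p ^ a" "card S * m = card K" "\<not> p dvd m"
proof -
  interpret K: subgroup K G by fact
  have finK: "finite K" using K.subset finite_subset by blast
  have "card K \<noteq> 0" using finK K.one_closed by (metis card_eq_0_iff empty_iff)
  then obtain m where m: "card K = p ^ multiplicity p (card K) * m" "\<not> p dvd m"
    using multiplicity_decompose'[of "card K" p] p by (metis not_prime_unit)
  obtain S where S: "subgroup S (G\<lparr>carrier := K\<rparr>)" "card S = p ^ multiplicity p (card K)"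
    using sylow_thm[OF p subgroup_imp_group[OF K], of "multiplicity p (card K)" m] m finK by (auto simp: order_def)
  have "subgroup S G" using incl_subgroup[OF K S(1)] .
  moreover have "S \<subseteq> K" using subgroup.subset[OF S(1)] by simp
  ultimately show thesis using that S m by metis
qed

text \<open>The index m of R in the centralizer of x is invertible in F, so the class sum of x is
  the trace of x/m from R. Multiplying by the central inverse x' of the class sum on the block
  exhibits e as the trace of x x'/m, which is the element \<open>a\<close> of the proof.\<close>

lemma block_in_rel_trace_of_class:
  fixes e :: "'a \<Rightarrow> 'f::field"
  assumes b: "block (group_algebra G) e" and w: "central_character (group_algebra G) e w"
    and x: "x \<in> carrier G" "w (class_sum x) \<noteq> 0"
    and R: "subgroup R G" "\<And>r. r \<in> R \<Longrightarrow> r \<otimes> x = x \<otimes> r"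
    and m: "card R * m = card (centralizer G {x})" "\<not> CHAR('f) dvd m"
  shows "e \<in> rel_trace G R ` fixed_elements G R"
proof -
  interpret R: subgroup R G by fact
  have finR: "finite R" using R.subset finite_subset by blast
  have m0: "(of_nat m :: 'f) \<noteq> 0" using m(2) of_nat_eq_0_iff_char_dvd by blast
  obtain x' where x': "class_function x'" "class_sum x \<star> x' = e"
    using central_character_unit[OF b w class_function_class_sum[OF x(1)] x(2)] by blast
  define a where "a = (\<lambda>y. if y \<in> carrier G then x' (inv x \<otimes> y) / of_nat m else 0)"
  have x'c: "x' (g \<otimes> y \<otimes> inv g) = x' y" if "g \<in> carrier G" "y \<in> carrier G" for g y
    using class_functionD[OF x'(1) that] .
  have aval: "a (inv g \<otimes> y \<otimes> g) = x' (inv (g \<otimes> x \<otimes> inv g) \<otimes> y) / of_nat m"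
    if g: "g \<in> carrier G" and y: "y \<in> carrier G" for g y
  proof -
    have "inv (g \<otimes> x \<otimes> inv g) \<otimes> y = g \<otimes> (inv x \<otimes> (inv g \<otimes> y \<otimes> g)) \<otimes> inv g"
      using g y x by (simp add: inv_mult_group m_assoc)
    then show ?thesis
      using g y x x'c[OF g, of "inv x \<otimes> (inv g \<otimes> y \<otimes> g)"] by (simp add: a_def)
  qed
  have a_fixed: "a \<in> fixed_elements G R"
  proof -
    have "conj_act G r a y = a y" if r: "r \<in> R" for r y
    proof (cases "y \<in> carrier G")
      case y: True
      have rc: "r \<in> carrier G" using r by simp
      have "r \<otimes> x \<otimes> inv r = x" using R(2)[OF r] rc x by (simp add: m_assoc)
      then have "inv (r \<otimes> x \<otimes> inv r) \<otimes> y = inv x \<otimes> y" by simp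
      then show ?thesis using aval[OF rc y] y by (simp add: conj_act_def a_def)
    qed (simp add: conj_act_def a_def)
    then show ?thesis by (auto simp: fixed_elements_def supported_iff[symmetric] supported_def a_def)
  qed
  define rep where "rep C = (SOME g. g \<in> C)" for C :: "'a set"
  have rep: "rep C \<in> C" "rep C \<in> carrier G" if C: "C \<in> lcosets R" for C
  proof -
    obtain g where "g \<in> C" using lcosets_nonempty[OF R(1) C] by blast
    then show "rep C \<in> C" unfolding rep_def by (rule someI)
    then show "rep C \<in> carrier G" using lcosets_subset[OF R(1) C] by blast
  qed
  define \<pi> where "\<pi> C = rep C \<otimes> x \<otimes> inv (rep C)" for C
  have pi: "\<pi> C = g \<otimes> x \<otimes> inv g" if C: "C \<in> lcosets R" and g: "g \<in> C" for C g
  proof -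
    have gc: "g \<in> carrier G" using lcosets_subset[OF R(1) C] g by blast
    obtain h where h: "h \<in> carrier G" "C = h <# R" using C by (auto simp: LCOSETS_def)
    have *: "u \<otimes> x \<otimes> inv u = h \<otimes> x \<otimes> inv h" if uC: "u \<in> C" for u
    proof -
      obtain d where d: "d \<in> R" "u = h \<otimes> d" using uC h by (auto simp: l_coset_def)
      have dc: "d \<in> carrier G" using d by simp
      have "u \<otimes> x \<otimes> inv u = h \<otimes> (d \<otimes> x \<otimes> inv d) \<otimes> inv h"
        using d dc h x by (simp add: inv_mult_group m_assoc)
      also have "d \<otimes> x \<otimes> inv d = x" using R(2)[OF d(1)] dc x by (simp add: m_assoc)
      finally show ?thesis .
    qed
    show ?thesis unfolding \<pi>_def using *[OF g] *[OF rep(1)[OF C]] by simp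
  qed
  have pi_image: "\<pi> ` (lcosets R) = conj_class x"
  proof
    show "\<pi> ` (lcosets R) \<subseteq> conj_class x" using rep by (auto simp: \<pi>_def conj_class_def)
    show "conj_class x \<subseteq> \<pi> ` (lcosets R)"
    proof
      fix h assume "h \<in> conj_class x"
      then obtain g where g: "g \<in> carrier G" "h = g \<otimes> x \<otimes> inv g" by (auto simp: conj_class_def)
      have "g <# R \<in> lcosets R" using g by (auto simp: LCOSETS_def)
      moreover from this have "\<pi> (g <# R) = h" using pi lcos_self[OF g(1) R(1)] g by auto
      ultimately show "h \<in> \<pi> ` (lcosets R)" by blast
    qed
  qed
  \<comment> \<open>The cosets of R that carry x to h fill the single coset of the centralizer of x
    through \<open>g0\<close>, so their number is the index m.\<close>
  have fibre: "card {C \<in> lcosets R. \<pi> C = h} = m" if h: "h \<in> conj_class x" for h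
  proof -
    obtain g0 where g0: "g0 \<in> carrier G" "h = g0 \<otimes> x \<otimes> inv g0" using h by (auto simp: conj_class_def)
    have "card R * card {C \<in> lcosets R. \<pi> C = h} = card (\<Union>{C \<in> lcosets R. \<pi> C = h})"
    proof (rule card_partition)
      show "finite {C \<in> lcosets R. \<pi> C = h}" using finite_lcosets[OF R(1)] by simp
      show "finite (\<Union>{C \<in> lcosets R. \<pi> C = h})"
        by (rule finite_subset[OF _ finite_carrier]) (use lcosets_subset[OF R(1)] in blast)
      show "card c = card R" if "c \<in> {C \<in> lcosets R. \<pi> C = h}" for c
        using that l_card_cosets_equal[OF _ R.subset finite_carrier, of c] by simp
      show "c1 \<inter> c2 = {}" if "c1 \<in> {C \<in> lcosets R. \<pi> C = h}" "c2 \<in> {C \<in> lcosets R. \<pi> C = h}" "c1 \<noteq> c2" for c1 c2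
        using that lcos_disjoint[OF R(1)] by (auto simp: pairwise_def disjnt_def)
    qed
    also have "\<Union>{C \<in> lcosets R. \<pi> C = h} = (\<lambda>c. g0 \<otimes> c) ` centralizer G {x}"
    proof (intro equalityI subsetI)
      fix g assume "g \<in> \<Union>{C \<in> lcosets R. \<pi> C = h}"
      then obtain C where C: "C \<in> lcosets R" "\<pi> C = h" "g \<in> C" by blast
      have g: "g \<in> carrier G" using lcosets_subset[OF R(1) C(1)] C(3) by blast
      have "g \<otimes> x \<otimes> inv g = g0 \<otimes> x \<otimes> inv g0" using pi[OF C(1,3)] C(2) g0 by simp
      then have "inv g0 \<otimes> (g \<otimes> x \<otimes> inv g) \<otimes> g = inv g0 \<otimes> (g0 \<otimes> x \<otimes> inv g0) \<otimes> g" by simp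
      then have "inv g0 \<otimes> g \<otimes> x = x \<otimes> (inv g0 \<otimes> g)"
        using g g0 x by (simp add: m_assoc) (simp add: m_assoc[symmetric])
      then have "inv g0 \<otimes> g \<in> centralizer G {x}" using g g0 by (simp add: centralizer_def)
      moreover have "g = g0 \<otimes> (inv g0 \<otimes> g)" using g g0 by (simp add: m_assoc[symmetric])
      ultimately show "g \<in> (\<lambda>c. g0 \<otimes> c) ` centralizer G {x}" by blast
    next
      fix g assume "g \<in> (\<lambda>c. g0 \<otimes> c) ` centralizer G {x}"
      then obtain c where c: "c \<in> carrier G" "c \<otimes> x = x \<otimes> c" "g = g0 \<otimes> c" by (auto simp: centralizer_def)
      have g: "g \<in> carrier G" using c g0 by simp
      have "g <# R \<in> lcosets R" using g by (auto simp: LCOSETS_def)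
      moreover from this have "\<pi> (g <# R) = g \<otimes> x \<otimes> inv g" using pi lcos_self[OF g R(1)] by auto
      moreover have "g \<otimes> x \<otimes> inv g = g0 \<otimes> (c \<otimes> x \<otimes> inv c) \<otimes> inv g0"
        using c(1,3) g0 x(1) by (simp add: inv_mult_group m_assoc)
      moreover have "c \<otimes> x \<otimes> inv c = x" using c x by (simp add: m_assoc)
      ultimately show "g \<in> \<Union>{C \<in> lcosets R. \<pi> C = h}"
        using lcos_self[OF g R(1)] g0 by auto
    qed
    also have "card \<dots> = card (centralizer G {x})"
      by (rule card_image) (use g0 in \<open>auto simp: inj_on_def centralizer_def\<close>)
    finally have "card R * card {C \<in> lcosets R. \<pi> C = h} = card R * m" using m(1) by simp
    moreover have "card R \<noteq> 0" using finR R.one_closed by (metis card_eq_0_iff empty_iff)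
    ultimately show ?thesis by simp
  qed
  have "rel_trace G R a = e"
  proof
    fix y
    show "rel_trace G R a y = e y"
    proof (cases "y \<in> carrier G")
      case y: True
      let ?\<phi> = "\<lambda>h. x' (inv h \<otimes> y) / of_nat m"
      have "rel_trace G R a y = (\<Sum>C\<in>lcosets R. ?\<phi> (\<pi> C))"
        unfolding rel_trace_def using y rep aval
        by (intro sum.cong) (auto simp: conj_act_def \<pi>_def rep_def[symmetric])
      also have "\<dots> = (\<Sum>h\<in>conj_class x. \<Sum>C\<in>{C \<in> lcosets R. \<pi> C = h}. ?\<phi> (\<pi> C))"
        using sum.image_gen[OF finite_lcosets[OF R(1)], of "\<lambda>C. ?\<phi> (\<pi> C)" \<pi>] by (simp add: pi_image)
      also have "\<dots> = (\<Sum>h\<in>conj_class x. x' (inv h \<otimes> y))"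
      proof (rule sum.cong[OF refl])
        fix h assume h: "h \<in> conj_class x"
        have "(\<Sum>C\<in>{C \<in> lcosets R. \<pi> C = h}. ?\<phi> (\<pi> C)) = (\<Sum>C\<in>{C \<in> lcosets R. \<pi> C = h}. ?\<phi> h)"
          by (rule sum.cong) auto
        also have "\<dots> = x' (inv h \<otimes> y)" using fibre[OF h] m0 by simp
        finally show "(\<Sum>C\<in>{C \<in> lcosets R. \<pi> C = h}. ?\<phi> (\<pi> C)) = x' (inv h \<otimes> y)" .
      qed
      also have "\<dots> = (\<Sum>h\<in>carrier G. if h \<in> conj_class x then x' (inv h \<otimes> y) else 0)"
        using sum.inter_restrict[OF finite_carrier, of "\<lambda>h. x' (inv h \<otimes> y)" "conj_class x"]
          conj_class_subset[OF x(1)] by (simp add: Int_absorb1)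
      also have "\<dots> = (class_sum x \<star> x') y"
        unfolding conv_apply if_P[OF y] by (rule sum.cong) (auto simp: class_sum_def)
      finally show ?thesis by (simp add: x')
    next
      case False
      then show ?thesis using x'(2)[symmetric] by (simp add: rel_trace_def conj_act_def conv_apply)
    qed
  qed
  then show ?thesis using a_fixed by blast
qed

text \<open>Choose a class on which both e and its character are nonzero. Its Sylow centralizer is
  conjugate into P because e is supported there, and e is a trace from it because the character does
  not vanish; minimality makes P equal to such a Sylow subgroup, for a conjugate x' of x. In
  particular P is a p-group, and e x' being nonzero, P is conjugate into every R from which e is a
  trace.\<close>

lemma defect_group_in_conjugate:
  fixes e :: "'a \<Rightarrow> 'f::field"
  assumes p: "prime p" "CHAR('f) = p"
    and b: "block (group_algebra G) e" and w: "central_character (group_algebra G) e w"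
    and P: "defect_group G e P"
    and R: "subgroup R G" "e \<in> rel_trace G R ` fixed_elements G R"
  obtains k g where "card P = p ^ k" "g \<in> carrier G" "\<And>r. r \<in> P \<Longrightarrow> inv g \<otimes> r \<otimes> g \<in> R"
proof -
  have e: "class_function e" using b by (simp add: block_iff)
  have Ps: "subgroup P G" "e \<in> rel_trace G P ` fixed_elements G P" using P by (auto simp: defect_group_def)
  obtain x where x: "x \<in> carrier G" "e x \<noteq> 0" "w (class_sum x) \<noteq> 0"
    by (rule functional_nonzero_on_class_sum[OF e, of w]) (use w in \<open>auto simp: central_character_iff\<close>)
  have Cx: "subgroup (centralizer G {x}) G" using x by (intro subgroup_centralizer) auto
  obtain S k m where S: "subgroup S G" "S \<subseteq> centralizer G {x}" "card S = p ^ k"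
      "card S * m = card (centralizer G {x})" "\<not> p dvd m"
    using exists_sylow_subgroup[OF p(1) Cx] by blast
  have Scomm: "r \<otimes> x = x \<otimes> r" "r \<in> carrier G" if "r \<in> S" for r
    using S(2) that by (auto simp: centralizer_def)
  obtain g where g: "g \<in> carrier G" "\<And>r. r \<in> S \<Longrightarrow> inv g \<otimes> r \<otimes> g \<in> P"
    using rel_trace_support[OF Ps x(2) S(1,3) p Scomm(1)] by blast
  let ?c = "\<lambda>r. inv g \<otimes> r \<otimes> g"
  have cmult: "?c (r \<otimes> s) = ?c r \<otimes> ?c s" if "r \<in> carrier G" "s \<in> carrier G" for r s
    using that g(1) by (simp add: m_assoc) (simp add: m_assoc[symmetric])
  have chom: "?c \<in> hom G G" using g(1) cmult by (auto simp: hom_def)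
  have cinj: "inj_on ?c (carrier G)" using g(1) by (auto simp: inj_on_def)
  define S' x' where "S' = ?c ` S" and "x' = ?c x"
  have S'sub: "subgroup S' G"
    unfolding S'_def using group_hom.subgroup_img_is_subgroup[of G G ?c S] chom S(1)
    by (simp add: group_hom_def group_hom_axioms_def group_axioms)
  have cardS': "card S' = card S"
    unfolding S'_def by (rule card_image) (use cinj Scomm in \<open>auto intro: inj_on_subset\<close>)
  have x'c: "x' \<in> carrier G" using g x by (simp add: x'_def)
  have x'cl: "x' \<in> conj_class x"
    using g(1) by (auto simp: x'_def conj_class_def intro!: image_eqI[of _ _ "inv g"])
  have "centralizer G {x'} = ?c ` centralizer G {x}"
  proof (intro equalityI subsetI)
    fix u assume "u \<in> ?c ` centralizer G {x}"
    then obtain v where v: "v \<in> carrier G" "v \<otimes> x = x \<otimes> v" "u = ?c v" by (auto simp: centralizer_def)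
    then show "u \<in> centralizer G {x'}"
      using g(1) x(1) cmult[of v x] cmult[of x v] by (simp add: centralizer_def x'_def)
  next
    fix u assume "u \<in> centralizer G {x'}"
    then have u: "u \<in> carrier G" "u \<otimes> x' = x' \<otimes> u" by (auto simp: centralizer_def)
    define v where "v = g \<otimes> u \<otimes> inv g"
    have v: "v \<in> carrier G" "u = ?c v" using u g by (simp_all add: v_def m_assoc) (simp add: m_assoc[symmetric])
    have "?c (v \<otimes> x) = ?c (x \<otimes> v)" using u v x(1) by (simp add: cmult x'_def)
    then have "v \<otimes> x = x \<otimes> v" using cinj v x(1) by (auto simp: inj_on_def)
    then show "u \<in> ?c ` centralizer G {x}" using v by (auto simp: centralizer_def)
  qed
  then have cardC: "card (centralizer G {x'}) = card (centralizer G {x})"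
    by (simp add: card_image inj_on_subset[OF cinj] centralizer_def)
  have "e \<in> rel_trace G S' ` fixed_elements G S'"
  proof (rule block_in_rel_trace_of_class[OF b w x'c])
    show "w (class_sum x') \<noteq> 0"
      using x(3) conj_class_eq[OF x(1) x'cl] by (simp add: class_sum_def)
    show "subgroup S' G" by fact
    show "r \<otimes> x' = x' \<otimes> r" if r: "r \<in> S'" for r
    proof -
      obtain s where s: "s \<in> S" "r = ?c s" using r by (auto simp: S'_def)
      then show ?thesis using Scomm[OF s(1)] x(1) cmult[of s x] cmult[of x s] by (simp add: x'_def)
    qed
    show "card S' * m = card (centralizer G {x'})" using S cardS' cardC by simp
    show "\<not> CHAR('f) dvd m" using S p by simp
  qed
  moreover have "S' \<subseteq> P" using g by (auto simp: S'_def)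
  ultimately have PS': "S' = P" using P S'sub unfolding defect_group_def by blast
  have ex: "e x' \<noteq> 0"
    using x(2) class_functionD[OF e, of "inv g" x] g x by (simp add: x'_def)
  have Pcard: "card P = p ^ k" using S cardS' PS' by simp
  have Pcomm: "r \<otimes> x' = x' \<otimes> r" if r: "r \<in> P" for r
  proof -
    obtain s where s: "s \<in> S" "r = ?c s" using r PS' by (auto simp: S'_def)
    then show ?thesis using Scomm[OF s(1)] x(1) cmult[of s x] cmult[of x s] by (simp add: x'_def)
  qed
  obtain h where "h \<in> carrier G" "\<And>r. r \<in> P \<Longrightarrow> inv h \<otimes> r \<otimes> h \<in> R"
    using rel_trace_support[OF R ex Ps(1) Pcard p Pcomm] by blast
  then show thesis using that Pcard by blast
qed

text \<open>Some u in the support of e centralizes N, so N is conjugate into D, and normality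
  removes the conjugation.\<close>

lemma normal_p_subgroup_in_defect_group:
  fixes e :: "'a \<Rightarrow> 'f::field"
  assumes p: "prime p" "CHAR('f) = p" and b: "block (group_algebra G) e"
    and D: "subgroup D G" "e \<in> rel_trace G D ` fixed_elements G D"
    and N: "subgroup N G" "card N = p ^ k"
      "\<And>g n. g \<in> carrier G \<Longrightarrow> n \<in> N \<Longrightarrow> g \<otimes> n \<otimes> inv g \<in> N"
  shows "N \<subseteq> D"
proof
  fix n assume n: "n \<in> N"
  have e: "class_function e" "e \<star> e = e" "e \<noteq> (\<lambda>x. 0)" using b by (auto simp: block_iff)
  obtain u where u: "u \<in> centralizer G N" "e u \<noteq> 0"
    using normal_p_subgroup_support[OF N(1,2) p N(3) e e(1,1,2)] by blast
  obtain g where g: "g \<in> carrier G" "\<And>n. n \<in> N \<Longrightarrow> inv g \<otimes> n \<otimes> g \<in> D"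
    by (rule rel_trace_support[OF D u(2) N(1,2) p]) (use u in \<open>auto simp: centralizer_def\<close>)
  have nc: "n \<in> carrier G" using n N(1) by (meson subgroup.mem_carrier)
  have "inv g \<otimes> (g \<otimes> n \<otimes> inv g) \<otimes> g \<in> D" using g N(3)[OF g(1) n] by blast
  moreover have "inv g \<otimes> (g \<otimes> n \<otimes> inv g) \<otimes> g = n" using g nc by (simp add: m_assoc) (simp add: m_assoc[symmetric])
  ultimately show "n \<in> D" by simp
qed


text \<open>The cyclic group generated by r is the p-group to which \<open>rel_trace_support\<close>
  is applied.\<close>

lemma rel_trace_support_p_element:
  fixes z :: "'a \<Rightarrow> 'f::field"
  assumes X: "subgroup X G" and z: "z \<in> rel_trace G X ` fixed_elements G X" and zx: "z x \<noteq> 0"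
    and p: "prime p" "CHAR('f) = p"
    and x: "x \<in> carrier G"
    and r: "r \<in> carrier G" "r [^] (p ^ j) = \<one>" "r \<otimes> x = x \<otimes> r"
  obtains g where "g \<in> carrier G" "inv g \<otimes> r \<otimes> g \<in> X"
proof -
  have "ord r dvd p ^ j" using r pow_eq_id by blast
  then obtain k where k: "ord r = p ^ k" using divides_primepow_nat[OF p(1)] by blast
  have R: "subgroup (generate G {r}) G" using r by (intro generate_is_subgroup) auto
  have "{r} \<subseteq> centralizer G {x}" using r by (auto simp: centralizer_def)
  then have comm: "generate G {r} \<subseteq> centralizer G {x}"
    by (rule generate_subgroup_incl) (use x subgroup_centralizer[of "{x}"] in auto)
  obtain g where "g \<in> carrier G" "\<And>s. s \<in> generate G {r} \<Longrightarrow> inv g \<otimes> s \<otimes> g \<in> X"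
  proof (rule rel_trace_support[OF X z zx R _ p])
    show "card (generate G {r}) = p ^ k" using k generate_pow_card[OF r(1)] by simp
  qed (use comm in \<open>auto simp: centralizer_def\<close>)
  moreover have "r \<in> generate G {r}" by (rule generate.incl) simp
  ultimately show thesis using that by blast
qed

text \<open>Otherwise another prime q divides the order, and the elements of a Sylow q-subgroup have
  orders dividing both a power of p and a power of q.\<close>

lemma card_prime_power_if_p_elements:
  assumes p: "prime (p::nat)" and K: "subgroup K G"
    and el: "\<And>x. x \<in> K \<Longrightarrow> \<exists>j::nat. x [^] (p ^ j) = \<one>"
  shows "\<exists>k. card K = p ^ k"
proof -
  obtain S a m where S: "subgroup S G" "S \<subseteq> K" "card S = p ^ a" "card S * m = card K" "\<not> p dvd m"
    using exists_sylow_subgroup[OF p K] by blast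
  have "m = 1"
  proof (rule ccontr)
    assume "m \<noteq> 1"
    then obtain q where q: "prime q" "q dvd m" using prime_factor_nat by blast
    have qp: "q \<noteq> p" using q S(5) by auto
    obtain T c k where T: "subgroup T G" "T \<subseteq> K" "card T = q ^ c" "card T * k = card K" "\<not> q dvd k"
      using exists_sylow_subgroup[OF q(1) K] by blast
    have "q dvd card K" using q(2) S(4) by (metis dvd_mult)
    then have "c \<noteq> 0" using T(3,4,5) by (metis mult_1 power_0)
    have "x = \<one>" if x: "x \<in> T" for x
    proof -
      have xG: "x \<in> carrier G" using x T(1) subgroup.subset by blast
      obtain j :: nat where j: "x [^] (p ^ j) = \<one>" using el x T(2) by blast
      interpret T: group "G\<lparr>carrier := T\<rparr>" by (rule subgroup_imp_group) (rule T(1))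
      have "x [^]\<^bsub>G\<lparr>carrier := T\<rparr>\<^esub> order (G\<lparr>carrier := T\<rparr>) = \<one>\<^bsub>G\<lparr>carrier := T\<rparr>\<^esub>"
        by (rule T.pow_order_eq_1) (use x in simp)
      then have "x [^] (q ^ c) = \<one>"
        using T(3) by (simp add: order_def flip: nat_pow_consistent)
      then have "ord x dvd q ^ c" "ord x dvd p ^ j" using j pow_eq_id[OF xG] by auto
      moreover have "coprime (q ^ c) (p ^ j)"
        using q(1) p qp by (simp add: primes_coprime)
      ultimately have "ord x = 1" using coprime_common_divisor_nat by blast
      then show ?thesis using ord_eq_1[OF xG] by simp
    qed
    then have "T \<subseteq> {\<one>}" by blast
    then have "card T \<le> 1" by (metis card.empty card_mono finite.emptyI finite_insert card_insert_if One_nat_def empty_iff)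
    then have "q ^ c \<le> 1" using T(3) by simp
    then show False using q(1) \<open>c \<noteq> 0\<close> by (metis One_nat_def le_less_trans less_one linorder_not_less
       one_less_power prime_gt_1_nat neq0_conv)
  qed
  then have "card K = p ^ a" using S(3,4) by simp
  then show ?thesis by blast
qed

text \<open>Needed for conjugation of H by an odd permutation, which is not given by an element of
  H. Cutting off outside the carrier keeps the transported functions in the group algebra.\<close>

lemma conv_automorphism:
  fixes a c :: "'a \<Rightarrow> 'f::field"
  assumes \<phi>: "bij_betw \<phi> (carrier G) (carrier G)" "\<And>x y. x \<in> carrier G \<Longrightarrow> y \<in> carrier G \<Longrightarrow> \<phi> (x \<otimes> y) = \<phi> x \<otimes> \<phi> y"
    and x: "x \<in> carrier G"
  shows "((\<lambda>y. if y \<in> carrier G then a (\<phi> y) else 0) \<star> (\<lambda>y. if y \<in> carrier G then c (\<phi> y) else 0)) x = (a \<star> c) (\<phi> x)"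
proof -
  have \<phi>c: "\<phi> y \<in> carrier G" if "y \<in> carrier G" for y using \<phi>(1) that by (auto simp: bij_betw_def)
  have \<phi>inv: "\<phi> (inv y) = inv (\<phi> y)" if "y \<in> carrier G" for y
    using group_hom.hom_inv[of G G \<phi> y] \<phi> that \<phi>c
    by (simp add: group_hom_def group_hom_axioms_def group_axioms hom_def)
  have "((\<lambda>y. if y \<in> carrier G then a (\<phi> y) else 0) \<star> (\<lambda>y. if y \<in> carrier G then c (\<phi> y) else 0)) x
      = (\<Sum>g\<in>carrier G. a (\<phi> g) * c (inv (\<phi> g) \<otimes> \<phi> x))"
    unfolding conv_apply if_P[OF x] by (rule sum.cong) (auto simp: \<phi> \<phi>inv x)
  also have "\<dots> = (\<Sum>g\<in>carrier G. a g * c (inv g \<otimes> \<phi> x))"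
    by (rule sum.reindex_bij_betw[OF \<phi>(1), of "\<lambda>g. a g * c (inv g \<otimes> \<phi> x)"])
  finally show ?thesis using \<phi>c[OF x] by (simp add: conv_apply)
qed

end

subsection \<open>Permutation groups\<close>

text \<open>One record for all permutation groups that occur: replacing the carrier gives a
  \<open>perm_group\<close> again, and \<open>alt_group n\<close> unfolds to one, so the subgroups
  in the theorem are reached by rewriting.\<close>

definition perm_group :: "('a \<Rightarrow> 'a) set \<Rightarrow> ('a \<Rightarrow> 'a) monoid" where
  "perm_group K = \<lparr>carrier = K, mult = (\<circ>), one = id\<rparr>"

lemma perm_group_simps [simp]:
  "carrier (perm_group K) = K" "g \<otimes>\<^bsub>perm_group K\<^esub> h = g \<circ> h" "\<one>\<^bsub>perm_group K\<^esub> = id"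
  "(perm_group K)\<lparr>carrier := L\<rparr> = perm_group L"
  by (simp_all add: perm_group_def)

lemma perm_group_pow [simp]: "x [^]\<^bsub>perm_group K\<^esub> (m::nat) = x ^^ m"
proof (induction m)
  case 0
  then show ?case by (simp add: nat_pow_def)
next
  case (Suc m)
  then show ?case
    using funpow_Suc_right[of m x] by (simp add: nat_pow_def)
qed

text \<open>Closure under inverses is a consequence when S is finite, the inverse of a permutation
  being one of its powers; leaving it out shortens every verification that a set of permutations is
  a group.\<close>

definition perm_closed :: "'a set \<Rightarrow> ('a \<Rightarrow> 'a) set \<Rightarrow> bool" where
  "perm_closed S K \<longleftrightarrow> id \<in> K \<and> (\<forall>g\<in>K. g permutes S) \<and> (\<forall>g\<in>K. \<forall>h\<in>K. g \<circ> h \<in> K)"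

lemma perm_closed_funpow: "perm_closed S K \<Longrightarrow> g \<in> K \<Longrightarrow> g ^^ m \<in> K"
  by (induction m) (auto simp: perm_closed_def)

lemma permutes_eventually_id:
  assumes "finite S" "g permutes S"
  obtains N where "N > 0" "g ^^ N = id"
proof -
  have "finite {p. p permutes S}" using assms(1) by (rule finite_permutations)
  moreover have "range (\<lambda>i. g ^^ i) \<subseteq> {p. p permutes S}"
  proof -
    have "(g ^^ i) permutes S" for i
      by (induction i) (simp_all only: funpow.simps permutes_id permutes_compose[OF _ assms(2)])
    then show ?thesis by auto
  qed
  ultimately have "finite (range (\<lambda>i. g ^^ i))" by (rule rev_finite_subset)
  then have "\<not> inj (\<lambda>i. g ^^ i)" using finite_imageD infinite_UNIV_nat by blast
  then obtain i j where ij: "g ^^ i = g ^^ j" "i \<noteq> j" by (auto simp: inj_def)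
  have main: thesis if "i < j" "g ^^ i = g ^^ j" for i j
  proof -
    have "g ^^ j = g ^^ i \<circ> g ^^ (j - i)" using that(1) by (simp flip: funpow_add)
    moreover have "inj (g ^^ i)" using assms(2) by (simp add: permutes_inj)
    ultimately have "g ^^ (j - i) = id" using that(2) by (metis fun.inj_map_strong comp_id injD fun_eq_iff o_apply id_apply)
    then show thesis using \<open>i < j\<close> by (intro \<open>\<And>N. N > 0 \<Longrightarrow> g ^^ N = id \<Longrightarrow> thesis\<close>[of "j - i"]) auto
  qed
  show thesis using ij main[of i j] main[of j i] by (cases "i < j") auto
qed

lemma perm_closed_inv:
  assumes "finite S" "perm_closed S K" "g \<in> K"
  shows "Hilbert_Choice.inv g \<in> K"
proof -
  have g: "g permutes S" using assms by (auto simp: perm_closed_def)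
  obtain N where N: "N > 0" "g ^^ N = id" using permutes_eventually_id[OF assms(1) g] by blast
  then obtain M where "g ^^ Suc M = id" by (metis Suc_pred)
  then have "g \<circ> g ^^ M = id" by simp
  then have "Hilbert_Choice.inv g = g ^^ M"
    using permutes_inv_o(2)[OF g] by (metis comp_assoc comp_id id_comp)
  then show ?thesis using perm_closed_funpow[OF assms(2,3)] by simp
qed

lemma finite_group_perm_group:
  assumes "finite S" "perm_closed S K"
  shows "finite_group (perm_group K)"
proof -
  have "group (perm_group K)"
  proof (rule groupI)
    fix g assume "g \<in> carrier (perm_group K)"
    then have "Hilbert_Choice.inv g \<in> K" "Hilbert_Choice.inv g \<circ> g = id"
      using perm_closed_inv[OF assms] assms(2) permutes_inv_o(2) by (auto simp: perm_closed_def)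
    then show "\<exists>h\<in>carrier (perm_group K). h \<otimes>\<^bsub>perm_group K\<^esub> g = \<one>\<^bsub>perm_group K\<^esub>" by auto
  qed (use assms(2) in \<open>auto simp: perm_closed_def comp_assoc\<close>)
  moreover have "finite K"
    by (rule finite_subset[OF _ finite_permutations[OF assms(1)]]) (use assms(2) in \<open>auto simp: perm_closed_def\<close>)
  ultimately show ?thesis by (simp add: finite_group_def finite_group_axioms_def)
qed

lemma perm_group_inv:
  assumes "finite S" "perm_closed S K" "g \<in> K"
  shows "inv\<^bsub>perm_group K\<^esub> g = Hilbert_Choice.inv g"
proof -
  interpret finite_group "perm_group K" by (rule finite_group_perm_group) fact+
  show ?thesis
    using inv_equality[of "Hilbert_Choice.inv g" g] perm_closed_inv[OF assms] assms permutes_inv_o(2)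
    by (auto simp: perm_closed_def)
qed

lemma subgroup_perm_group:
  assumes "finite S" "perm_closed S K" "perm_closed S L" "L \<subseteq> K"
  shows "subgroup L (perm_group K)"
proof -
  interpret finite_group "perm_group K" by (rule finite_group_perm_group) fact+
  show ?thesis
    by (rule subgroupI) (use assms perm_closed_inv[OF assms(1,3)] perm_group_inv[OF assms(1,2)] in \<open>auto simp: perm_closed_def\<close>)
qed

lemma perm_closed_of_subgroup:
  assumes "finite S" "perm_closed S K" "subgroup L (perm_group K)"
  shows "perm_closed S L"
  using subgroup.subset[OF assms(3)] subgroup.one_closed[OF assms(3)] subgroup.m_closed[OF assms(3)] assms(2)
  by (auto simp: perm_closed_def)

lemma conj_eq_iff:
  assumes "g permutes S"
  shows "g \<circ> u \<circ> Hilbert_Choice.inv g = v \<longleftrightarrow> g \<circ> u = v \<circ> g"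
  using permutes_inv_o[OF assms] by (metis comp_assoc comp_id)

section \<open>Powers of commuting permutations and the splitting into a 2-part and an odd
  part\<close>

lemma funpow_commute: "f \<circ> g = g \<circ> f \<Longrightarrow> f \<circ> g ^^ m = g ^^ m \<circ> (f :: 'a \<Rightarrow> 'a)"
proof (induction m)
  case (Suc m)
  then show ?case by (simp add: fun_eq_iff)
qed simp

lemma funpow_comp_commute: "f \<circ> g = g \<circ> f \<Longrightarrow> (f \<circ> g) ^^ m = f ^^ m \<circ> (g ^^ m :: 'a \<Rightarrow> 'a)"
proof (induction m)
  case (Suc m)
  have "g (f x) = f (g x)" "g ((f ^^ m) x) = (f ^^ m) (g x)" for x
    using Suc.prems funpow_commute[of g f m] by (simp_all add: fun_eq_iff)
  moreover have "((f \<circ> g) ^^ m) x = (f ^^ m) ((g ^^ m) x)" for x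
    using Suc.IH[OF Suc.prems] by (metis comp_apply)
  ultimately show ?case by (simp add: fun_eq_iff del: o_apply) (simp add: o_def)
qed simp

lemma two_part_decomposition:
  fixes y :: "'a \<Rightarrow> 'a"
  assumes "finite S" "y permutes S"
  obtains a m i j where "odd m" "y ^^ (2 ^ a * m) = id" "y = y ^^ i \<circ> y ^^ j" "(y ^^ i) ^^ (2 ^ a) = id" "(y ^^ j) ^^ m = id"
proof -
  obtain N where N: "N > 0" "y ^^ N = id" using permutes_eventually_id[OF assms] by blast
  obtain m where m: "N = 2 ^ multiplicity 2 N * m" "\<not> 2 dvd m"
    using multiplicity_decompose'[of N 2] N(1) by auto
  define a where "a = multiplicity 2 N"
  have ya: "y ^^ (2 ^ a * m) = id" using m N by (simp add: a_def)
  obtain s t where st: "2 ^ a * s = m * t + gcd (2 ^ a) m"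
    using bezout_nat[of "2 ^ a" m] by auto
  moreover have "coprime (2 ^ a) m" using m(2) by simp
  ultimately have st: "2 ^ a * s = m * t + 1" by (simp add: coprime_iff_gcd_eq_1)
  have pw: "y ^^ (2 ^ a * m * k) = id" for k
    using ya by (metis funpow_mult id_funpow)
  show thesis
  \<comment> \<open>With 2^a s = m t + 1, the odd part is y^(2^a s) and the 2-part should be y^(-m
    t). Replacing the factor -1 by 2^a - 1 makes the exponent natural and changes it by a multiple
    of 2^a m.\<close>
  proof (rule that[of m a "m * t * (2 ^ a - 1)" "2 ^ a * s"])
    have "m * t * (2 ^ a - 1) + 2 ^ a * s = 2 ^ a * m * t + 1"
      unfolding st by (cases "2 ^ a :: nat") (auto simp: algebra_simps)
    then have "y ^^ (m * t * (2 ^ a - 1)) \<circ> y ^^ (2 ^ a * s) = y ^^ (2 ^ a * m * t + 1)"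
      by (metis funpow_add)
    also have "\<dots> = y" using pw[of t] by (simp add: funpow_add)
    finally show "y = y ^^ (m * t * (2 ^ a - 1)) \<circ> y ^^ (2 ^ a * s)" ..
    have "(y ^^ (m * t * (2 ^ a - 1))) ^^ 2 ^ a = y ^^ (2 ^ a * m * (t * (2 ^ a - 1)))"
      by (simp add: funpow_mult mult_ac)
    then show "(y ^^ (m * t * (2 ^ a - 1))) ^^ 2 ^ a = id" using pw by simp
    have "(y ^^ (2 ^ a * s)) ^^ m = y ^^ (2 ^ a * m * s)" by (simp add: funpow_mult mult_ac)
    then show "(y ^^ (2 ^ a * s)) ^^ m = id" using pw by simp
  qed (use m ya in auto)
qed

subsection \<open>Self-centralizing pairs of permutation groups\<close>

definition cent_perms :: "'a set \<Rightarrow> ('a \<Rightarrow> 'a) set \<Rightarrow> ('a \<Rightarrow> 'a) set" where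
  "cent_perms S Q = {g. g permutes S \<and> (\<forall>q\<in>Q. g \<circ> q = q \<circ> g)}"

locale perm_2_group =
  fixes S :: "'a set" and Q :: "('a \<Rightarrow> 'a) set"
  assumes finS [simp]: "finite S" and closedQ: "perm_closed S Q"
    and evenQ: "q \<in> Q \<Longrightarrow> evenperm q" and card_Q: "\<exists>k. card Q = 2 ^ k"
begin

abbreviation C where "C \<equiv> cent_perms S Q"

definition \<Gamma> where "\<Gamma> = {q \<circ> c | q c. q \<in> Q \<and> c \<in> C}"

text \<open>Since Q consists of even permutations, this even part is the product of Q with its
  centralizer in the alternating group, which is the group the block b belongs to.\<close>

definition H where "H = {g \<in> \<Gamma>. evenperm g}"

definition \<Omega> where "\<Omega> = {x. \<exists>q\<in>Q. q x \<noteq> x}"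

lemma permQ: "q \<in> Q \<Longrightarrow> q permutes S"
  using closedQ by (simp add: perm_closed_def)

lemma idQ: "id \<in> Q" and compQ: "q \<in> Q \<Longrightarrow> r \<in> Q \<Longrightarrow> q \<circ> r \<in> Q"
  using closedQ by (simp_all add: perm_closed_def)

lemma invQ: "q \<in> Q \<Longrightarrow> inv' q \<in> Q"
  by (rule perm_closed_inv[OF finS closedQ])

lemma permC: "c \<in> C \<Longrightarrow> c permutes S"
  by (simp add: cent_perms_def)

lemma commC: "c \<in> C \<Longrightarrow> q \<in> Q \<Longrightarrow> c (q x) = q (c x)"
  by (auto simp: cent_perms_def fun_eq_iff)

lemma closedC: "perm_closed S C"
  unfolding perm_closed_def
  by (auto simp: cent_perms_def permutes_id fun_eq_iff intro: permutes_compose)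

lemma invC: "c \<in> C \<Longrightarrow> inv' c \<in> C"
  by (rule perm_closed_inv[OF finS closedC])

lemma compC: "c \<in> C \<Longrightarrow> d \<in> C \<Longrightarrow> c \<circ> d \<in> C"
  using closedC by (simp add: perm_closed_def)

lemma permutation_of: "g permutes S \<Longrightarrow> permutation g"
  using finS permutation_permutes by blast

lemma evenperm_comp': "g permutes S \<Longrightarrow> h permutes S \<Longrightarrow> evenperm (g \<circ> h) \<longleftrightarrow> evenperm g = evenperm h"
  by (intro evenperm_comp permutation_of)

lemma evenperm_inv': "g permutes S \<Longrightarrow> evenperm (inv' g) = evenperm g"
  by (intro evenperm_inv permutation_of)

lemma evenperm_conj: "g permutes S \<Longrightarrow> h permutes S \<Longrightarrow> evenperm (g \<circ> h \<circ> inv' g) = evenperm h"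
  by (simp add: evenperm_comp' evenperm_inv' permutes_compose permutes_inv) blast

lemma in_\<Gamma>: "q \<in> Q \<Longrightarrow> c \<in> C \<Longrightarrow> q \<circ> c \<in> \<Gamma>"
  by (auto simp: \<Gamma>_def)

lemma C_sub_\<Gamma>: "C \<subseteq> \<Gamma>"
  using in_\<Gamma>[OF idQ] by auto

lemma Q_sub_\<Gamma>: "Q \<subseteq> \<Gamma>"
proof
  fix q assume "q \<in> Q"
  then show "q \<in> \<Gamma>" using in_\<Gamma>[of q id] closedC by (simp add: perm_closed_def)
qed

lemma closed\<Gamma>: "perm_closed S \<Gamma>"
proof -
  have "(q \<circ> c) \<circ> (r \<circ> d) = (q \<circ> r) \<circ> (c \<circ> d)" if "q \<in> Q" "r \<in> Q" "c \<in> C" "d \<in> C" for q r c d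
    using commC[OF that(3,2)] by (simp add: fun_eq_iff)
  then have "g \<circ> h \<in> \<Gamma>" if "g \<in> \<Gamma>" "h \<in> \<Gamma>" for g h
    using that in_\<Gamma>[OF compQ compC] by (force simp: \<Gamma>_def)
  moreover have "g permutes S" if "g \<in> \<Gamma>" for g
    using that permutes_compose[OF permC permQ] by (auto simp: \<Gamma>_def)
  ultimately show ?thesis
    using Q_sub_\<Gamma> idQ by (auto simp: perm_closed_def)
qed

lemma perm\<Gamma>: "g \<in> \<Gamma> \<Longrightarrow> g permutes S"
  using closed\<Gamma> by (simp add: perm_closed_def)

lemma comp\<Gamma>: "g \<in> \<Gamma> \<Longrightarrow> h \<in> \<Gamma> \<Longrightarrow> g \<circ> h \<in> \<Gamma>"
  using closed\<Gamma> by (simp add: perm_closed_def)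

lemma inv\<Gamma>: "g \<in> \<Gamma> \<Longrightarrow> inv' g \<in> \<Gamma>"
  by (rule perm_closed_inv[OF finS closed\<Gamma>])

lemma H_sub_\<Gamma>: "H \<subseteq> \<Gamma>"
  by (auto simp: H_def)

lemma closedH: "perm_closed S H"
  using closed\<Gamma> by (auto simp: perm_closed_def H_def evenperm_comp')

lemma permH: "g \<in> H \<Longrightarrow> g permutes S"
  using closedH by (simp add: perm_closed_def)

lemma Q_sub_H: "Q \<subseteq> H"
  using Q_sub_\<Gamma> evenQ by (auto simp: H_def)

lemma C_even_in_H: "c \<in> C \<Longrightarrow> evenperm c \<Longrightarrow> c \<in> H"
  using C_sub_\<Gamma> by (auto simp: H_def)

lemma conjH: "g \<in> \<Gamma> \<Longrightarrow> h \<in> H \<Longrightarrow> g \<circ> h \<circ> inv' g \<in> H"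
  using comp\<Gamma>[OF comp\<Gamma>[of g h] inv\<Gamma>[of g]] perm\<Gamma> by (auto simp: H_def evenperm_conj)

text \<open>Q acts trivially on C by conjugation. Hence a subgroup of C is normalized by
  \<open>\<Gamma>\<close>, and so by \<open>H\<close>, as soon as it is normalized by C.\<close>

lemma conj_\<Gamma>_C:
  assumes "q \<in> Q" "c \<in> C" "u \<in> C"
  shows "(q \<circ> c) \<circ> u \<circ> inv' (q \<circ> c) = c \<circ> u \<circ> inv' c"
proof -
  have v: "c \<circ> u \<circ> inv' c \<in> C" using assms by (intro compC invC)
  have "(q \<circ> c) \<circ> u = (c \<circ> u \<circ> inv' c) \<circ> (q \<circ> c)"
  proof
    fix x
    have "(c \<circ> u \<circ> inv' c) (q (c x)) = q ((c \<circ> u \<circ> inv' c) (c x))" by (rule commC[OF v assms(1)])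
    also have "\<dots> = q (c (u x))" using permutes_inverses(2)[OF permC[OF assms(2)]] by simp
    finally show "((q \<circ> c) \<circ> u) x = ((c \<circ> u \<circ> inv' c) \<circ> (q \<circ> c)) x" by simp
  qed
  then show ?thesis
    using conj_eq_iff[OF perm\<Gamma>[OF in_\<Gamma>[OF assms(1,2)]]] by blast
qed

lemma conjC: "g \<in> \<Gamma> \<Longrightarrow> u \<in> C \<Longrightarrow> g \<circ> u \<circ> inv' g \<in> C"
proof -
  assume "g \<in> \<Gamma>" "u \<in> C"
  then obtain q c where qc: "q \<in> Q" "c \<in> C" "g = q \<circ> c" by (auto simp: \<Gamma>_def)
  then show ?thesis using conj_\<Gamma>_C[OF qc(1,2) \<open>u \<in> C\<close>] \<open>u \<in> C\<close> by (metis compC invC)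
qed

lemma conjQ: "g \<in> \<Gamma> \<Longrightarrow> r \<in> Q \<Longrightarrow> g \<circ> r \<circ> inv' g \<in> Q"
proof -
  assume g: "g \<in> \<Gamma>" and r: "r \<in> Q"
  then obtain q c where qc: "q \<in> Q" "c \<in> C" "g = q \<circ> c" by (auto simp: \<Gamma>_def)
  have "g \<circ> r = (q \<circ> r \<circ> inv' q) \<circ> g"
    using qc commC[OF qc(2) r] permutes_inverses(2)[OF permQ[OF qc(1)]] by (simp add: fun_eq_iff)
  then have "g \<circ> r \<circ> inv' g = q \<circ> r \<circ> inv' q"
    using conj_eq_iff[OF perm\<Gamma>[OF g]] by blast
  then show ?thesis using qc r by (simp add: compQ invQ)
qed

lemma H_comm_Q_in_C: "h \<in> H \<Longrightarrow> (\<And>q. q \<in> Q \<Longrightarrow> h \<circ> q = q \<circ> h) \<Longrightarrow> h \<in> C"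
  using permH by (auto simp: cent_perms_def)

section \<open>The points moved by Q\<close>

lemma \<Omega>_sub_S: "\<Omega> \<subseteq> S"
  using permQ by (auto simp: \<Omega>_def permutes_def)

lemma Q_fixes: "q \<in> Q \<Longrightarrow> x \<notin> \<Omega> \<Longrightarrow> q x = x"
  by (auto simp: \<Omega>_def)

lemma C_\<Omega>:
  assumes "c \<in> C"
  shows "c x \<in> \<Omega> \<longleftrightarrow> x \<in> \<Omega>"
proof -
  have "q (c x) \<noteq> c x \<longleftrightarrow> q x \<noteq> x" if "q \<in> Q" for q
    using commC[OF assms that, of x] injD[OF permutes_inj[OF permC[OF assms]], of "q x" x] by auto
  then show ?thesis by (simp add: \<Omega>_def cong: bex_cong)
qed

lemma Q_\<Omega>: "q \<in> Q \<Longrightarrow> q x \<in> \<Omega> \<longleftrightarrow> x \<in> \<Omega>"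
  by (metis Q_fixes permQ permutes_inj injD)

lemma sup_compl_in_C:
  assumes "g permutes S" "\<And>x. x \<in> \<Omega> \<Longrightarrow> g x = x"
  shows "g \<in> C"
proof -
  have "g (q x) = q (g x)" if q: "q \<in> Q" for q x
  proof (cases "x \<in> \<Omega>")
    case True
    then show ?thesis using assms(2) Q_\<Omega>[OF q] by simp
  next
    case False
    have "g x \<notin> \<Omega>" using False assms by (metis permutes_inj injD)
    then show ?thesis using Q_fixes[OF q] False by simp
  qed
  then show ?thesis using assms(1) by (auto simp: cent_perms_def fun_eq_iff)
qed

lemma fixing_compl_comm_fixing:
  assumes "\<And>x. x \<in> \<Omega> \<Longrightarrow> u x = x" "\<And>x. x \<notin> \<Omega> \<Longrightarrow> v x = x" "u permutes S" "v permutes S"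
  shows "u \<circ> v = v \<circ> u"
proof
  fix x
  show "(u \<circ> v) x = (v \<circ> u) x"
  proof (cases "x \<in> \<Omega>")
    case True
    then have "v x \<in> \<Omega>" using assms by (metis permutes_inj injD)
    then show ?thesis using True assms by simp
  next
    case False
    then have "u x \<notin> \<Omega>" using assms by (metis permutes_inj injD)
    then show ?thesis using False assms by simp
  qed
qed

sublocale H: finite_group "perm_group H"
  by (rule finite_group_perm_group[OF finS closedH])

sublocale \<Gamma>: finite_group "perm_group \<Gamma>"
  by (rule finite_group_perm_group[OF finS closed\<Gamma>])

lemma H_inv: "h \<in> H \<Longrightarrow> inv\<^bsub>perm_group H\<^esub> h = inv' h"
  by (rule perm_group_inv[OF finS closedH])

lemma \<Gamma>_inv: "h \<in> \<Gamma> \<Longrightarrow> inv\<^bsub>perm_group \<Gamma>\<^esub> h = inv' h"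
  by (rule perm_group_inv[OF finS closed\<Gamma>])

lemma two_element_Q:
  assumes "q \<in> Q"
  obtains j where "q ^^ (2 ^ j) = id" "card Q = 2 ^ j"
proof -
  interpret Q: finite_group "perm_group Q" by (rule finite_group_perm_group[OF finS closedQ])
  obtain k where k: "card Q = 2 ^ k" using card_Q by blast
  have "q [^]\<^bsub>perm_group Q\<^esub> order (perm_group Q) = \<one>\<^bsub>perm_group Q\<^esub>"
    by (rule Q.pow_order_eq_1) (use assms in simp)
  then show thesis using that k by (simp add: order_def)
qed

lemma card_2_power_if_2_elements:
  assumes "perm_closed S N" "\<And>n. n \<in> N \<Longrightarrow> \<exists>j. n ^^ (2 ^ j) = id"
  shows "\<exists>k. card N = 2 ^ k"
proof -
  interpret N: finite_group "perm_group N" by (rule finite_group_perm_group[OF finS assms(1)])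
  have "subgroup N (perm_group N)" using subgroup_perm_group[OF finS assms(1,1)] by simp
  then show ?thesis
    using N.card_prime_power_if_p_elements[of 2 N] assms(2) two_is_prime_nat by simp
qed

lemma sum_fixed_points_perms:
  fixes f :: "'x \<Rightarrow> 'f::comm_ring_1"
  assumes "CHAR('f) = 2" "perm_closed S N" "\<exists>k. card N = 2 ^ k" "finite X"
    "\<And>r s. r \<in> N \<Longrightarrow> s \<in> X \<Longrightarrow> act r s \<in> X" "\<And>s. s \<in> X \<Longrightarrow> act id s = s"
    "\<And>r r' s. r \<in> N \<Longrightarrow> r' \<in> N \<Longrightarrow> s \<in> X \<Longrightarrow> act (r \<circ> r') s = act r (act r' s)"
    "\<And>r s. r \<in> N \<Longrightarrow> s \<in> X \<Longrightarrow> f (act r s) = f s"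
  shows "sum f X = sum f {s \<in> X. \<forall>r\<in>N. act r s = s}"
proof -
  interpret N: finite_group "perm_group N" by (rule finite_group_perm_group[OF finS assms(2)])
  obtain k where k: "card N = 2 ^ k" using assms(3) by blast
  show ?thesis
    using sum_fixed_points_p_group[OF N.group_axioms, of 2 k X act f] assms k two_is_prime_nat by simp
qed

text \<open>The stabilizer of x in Q must fix a second point y of the orbit, because the orbit has
  even length and the stabilizer is a 2-group. Then q x \<mapsto> q y is the required permutation.
  The field type enters through its characteristic: cardinalities modulo 2 are read off in
  it.\<close>

lemma exists_orbit_centralizing:
  assumes x: "x \<in> \<Omega>" and char2: "CHAR('f::comm_ring_1) = 2"
  obtains z where "z \<in> C" "z x \<noteq> x" "\<And>v. \<exists>q\<in>Q. z v = q v" "\<And>v. v \<notin> (\<lambda>q. q x) ` Q \<Longrightarrow> z v = v"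
proof -
  define Orb where "Orb = (\<lambda>q. q x) ` Q"
  have "finite Q"
    using closedQ finite_subset[OF _ finite_permutations[OF finS]] by (auto simp: perm_closed_def)
  then have finO: "finite Orb" by (simp add: Orb_def)
  have xO: "x \<in> Orb" unfolding Orb_def by (rule image_eqI[of _ _ id]) (simp_all add: idQ)
  have QO: "q v \<in> Orb \<longleftrightarrow> v \<in> Orb" if q: "q \<in> Q" for q v
  proof
    assume "v \<in> Orb"
    then obtain r where "r \<in> Q" "v = r x" by (auto simp: Orb_def)
    then show "q v \<in> Orb"
      using imageI[OF compQ[OF q], of r "\<lambda>q. q x"] by (simp add: Orb_def)
  next
    assume "q v \<in> Orb"
    then obtain r where r: "r \<in> Q" "q v = r x" by (auto simp: Orb_def)
    then have "v = (inv' q \<circ> r) x" using permutes_inverses(2)[OF permQ[OF q]] by (metis o_apply)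
    then show "v \<in> Orb"
      using imageI[OF compQ[OF invQ[OF q] r(1)], of "\<lambda>q. q x"] by (simp add: Orb_def)
  qed
  have "(\<Sum>v\<in>Orb. 1) = (\<Sum>v\<in>{v \<in> Orb. \<forall>q\<in>Q. q v = v}. (1::'f))"
    by (rule sum_fixed_points_perms[OF char2 closedQ card_Q finO]) (auto simp: QO)
  also have "{v \<in> Orb. \<forall>q\<in>Q. q v = v} = {}"
  proof -
    have "x \<notin> \<Omega>" if q: "q \<in> Q" "\<forall>r\<in>Q. r (q x) = q x" for q
      using that invQ[OF q(1)] Q_\<Omega>[OF q(1)] by (auto simp: \<Omega>_def)
    then show ?thesis using x by (auto simp: Orb_def)
  qed
  finally have O0: "(\<Sum>v\<in>Orb. 1) = (0::'f)" by simp
  define T where "T = {q \<in> Q. q x = x}"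
  have closedT: "perm_closed S T" using closedQ by (auto simp: perm_closed_def T_def)
  have "\<exists>k. card T = 2 ^ k"
    by (rule card_2_power_if_2_elements[OF closedT]) (auto simp: T_def elim: two_element_Q)
  then have "(\<Sum>v\<in>Orb. 1) = (\<Sum>v\<in>{v \<in> Orb. \<forall>q\<in>T. q v = v}. (1::'f))"
    by (intro sum_fixed_points_perms[OF char2 closedT _ finO]) (auto simp: QO T_def)
  with O0 have "(\<Sum>v\<in>{v \<in> Orb. \<forall>q\<in>T. q v = v}. (1::'f)) = 0" by simp
  then have "{v \<in> Orb. \<forall>q\<in>T. q v = v} \<noteq> {x}" by auto
  moreover have "x \<in> {v \<in> Orb. \<forall>q\<in>T. q v = v}" using xO by (auto simp: T_def)
  ultimately obtain y where y: "y \<in> Orb" "y \<noteq> x" "\<And>q. q \<in> Q \<Longrightarrow> q x = x \<Longrightarrow> q y = y"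
    by (auto simp: T_def)
  obtain q0 where q0: "q0 \<in> Q" "y = q0 x" using y(1) by (auto simp: Orb_def)
  \<comment> \<open>The value does not depend on the chosen q: two choices differ by an element of
    the stabilizer of x, which fixes y.\<close>
  define z where "z v = (if v \<in> Orb then (SOME q. q \<in> Q \<and> q x = v) y else v)" for v
  have zq: "z (q x) = q y" if q: "q \<in> Q" for q
  proof -
    define r where "r = (SOME r. r \<in> Q \<and> r x = q x)"
    have r: "r \<in> Q" "r x = q x"
      using someI[of "\<lambda>r. r \<in> Q \<and> r x = q x" q] q by (auto simp: r_def)
    have "(inv' q \<circ> r) x = x" using r permutes_inverses(2)[OF permQ[OF q]] by simp
    then have "(inv' q \<circ> r) y = y" using y(3) compQ[OF invQ[OF q] r(1)] by blast
    then have "r y = q y" using permutes_inverses(1)[OF permQ[OF q]] by (metis o_apply)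
    moreover have "q x \<in> Orb" using q by (simp add: Orb_def)
    ultimately show ?thesis by (simp add: z_def r_def)
  qed
  have zO: "v \<notin> Orb \<Longrightarrow> z v = v" for v by (simp add: z_def)
  have img: "z ` Orb = Orb"
  proof
    show "z ` Orb \<subseteq> Orb" using zq y(1) QO by (auto simp: Orb_def)
    show "Orb \<subseteq> z ` Orb"
    proof
      fix v assume "v \<in> Orb"
      then obtain q where q: "q \<in> Q" "v = q x" by (auto simp: Orb_def)
      have "z ((q \<circ> inv' q0) x) = (q \<circ> inv' q0) y" by (rule zq) (use q q0 compQ invQ in blast)
      also have "\<dots> = v" using q q0 permutes_inverses(2)[OF permQ[OF q0(1)]] by simp
      finally have "v = z ((q \<circ> inv' q0) x)" ..
      moreover have "(q \<circ> inv' q0) x \<in> Orb"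
        unfolding Orb_def by (rule imageI) (intro compQ invQ q(1) q0(1))
      ultimately show "v \<in> z ` Orb" by blast
    qed
  qed
  have "inj_on z Orb" by (rule eq_card_imp_inj_on[OF finO]) (simp add: img)
  then have "z permutes Orb" using img zO by (intro bij_imp_permutes) (auto simp: bij_betw_def)
  moreover have "Orb \<subseteq> S" using x \<Omega>_sub_S permutes_in_image[OF permQ] by (auto simp: Orb_def)
  ultimately have zS: "z permutes S" by (rule permutes_subset)
  have zcomm: "z (r v) = r (z v)" if r: "r \<in> Q" for r v
  proof (cases "v \<in> Orb")
    case True
    then obtain q where q: "q \<in> Q" "v = q x" by (auto simp: Orb_def)
    have "z ((r \<circ> q) x) = (r \<circ> q) y" by (rule zq) (use q r compQ in blast)
    then show ?thesis using q zq[OF q(1)] by simp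
  next
    case False
    then show ?thesis using zO QO[OF r] by simp
  qed
  have "z \<in> C" using zS zcomm by (auto simp: cent_perms_def fun_eq_iff)
  moreover have "z x \<noteq> x" using zq[OF idQ] y by simp
  moreover have "\<exists>q\<in>Q. z v = q v" for v
  proof (cases "v \<in> Orb")
    case True
    then obtain q where q: "q \<in> Q" "v = q x" by (auto simp: Orb_def)
    have "z v = (q \<circ> q0 \<circ> inv' q) v" using q q0 zq[OF q(1)] permutes_inverses(2)[OF permQ[OF q(1)]] by simp
    then show ?thesis using compQ[OF compQ[OF q(1) q0(1)] invQ[OF q(1)]] by blast
  next
    case False
    then show ?thesis by (intro bexI[of _ id]) (simp_all add: zO idQ)
  qed
  ultimately show thesis using that zO unfolding Orb_def by blast
qed

end

locale self_centralizing_perm_pair = perm_2_group +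
  fixes b :: "('a \<Rightarrow> 'a) \<Rightarrow> 'f::field"
  assumes char2: "CHAR('f) = 2"
    and blockb: "block (group_algebra (perm_group H)) b"
    and defectb: "defect_group (perm_group H) b Q"
begin

lemma Q_trace: "subgroup Q (perm_group H)" "b \<in> rel_trace (perm_group H) Q ` fixed_elements (perm_group H) Q"
  using defectb by (simp_all add: defect_group_def)

lemma normal_2_subgroup_sub_Q:
  assumes N: "perm_closed S N" "\<And>n. n \<in> N \<Longrightarrow> \<exists>j. n ^^ (2 ^ j) = id" "\<And>n. n \<in> N \<Longrightarrow> n \<in> C \<and> evenperm n"
    and normal: "\<And>c n. c \<in> C \<Longrightarrow> n \<in> N \<Longrightarrow> c \<circ> n \<circ> inv' c \<in> N"
  shows "N \<subseteq> Q"
proof -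
  obtain k where k: "card N = 2 ^ k" using card_2_power_if_2_elements[OF N(1,2)] by blast
  have NH: "N \<subseteq> H" using N(3) C_even_in_H by blast
  have "subgroup N (perm_group H)" by (rule subgroup_perm_group[OF finS closedH N(1) NH])
  then show ?thesis
  proof (rule H.normal_p_subgroup_in_defect_group[OF two_is_prime_nat char2 blockb Q_trace _ k])
    fix g n assume g: "g \<in> carrier (perm_group H)" and n: "n \<in> N"
    then obtain q c where qc: "q \<in> Q" "c \<in> C" "g = q \<circ> c" using H_sub_\<Gamma> by (auto simp: \<Gamma>_def)
    then show "g \<otimes>\<^bsub>perm_group H\<^esub> n \<otimes>\<^bsub>perm_group H\<^esub> inv\<^bsub>perm_group H\<^esub> g \<in> N"
      using normal[OF qc(2) n] conj_\<Gamma>_C[OF qc(1,2)] N(3)[OF n] g H_inv by simp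
  qed
qed

lemma odd_order_fixes_\<Omega>:
  assumes g: "g \<in> C" "g ^^ m = id" "odd m" and x: "x \<in> \<Omega>"
  shows "g x = x"
proof (rule ccontr)
  assume gx: "g x \<noteq> x"
  let ?O = "(\<lambda>q. q x) ` Q"
  obtain z where z: "z \<in> C" "z x \<noteq> x" "\<And>v. \<exists>q\<in>Q. z v = q v" "\<And>v. v \<notin> ?O \<Longrightarrow> z v = v"
    using exists_orbit_centralizing[OF x char2] by blast
  obtain k where k: "card Q = 2 ^ k" using card_Q by blast
  have Qpow: "q ^^ (2 ^ k) = id" if "q \<in> Q" for q
    using two_element_Q[OF that] k by (metis power_inject_exp one_less_numeral_iff semiring_norm(76))
  \<comment> \<open>If g^i agrees at x with an element q of Q, then so do all powers, as g and q
    commute. Hence g to the power i 2^k fixes x, and this exponent is prime to the odd m. The values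
    1 and 2 of i keep g x and g (g x) out of the orbit of x, which is what the contradiction at the
    end needs.\<close>
  have key: "g x = x" if i: "(g ^^ i) x = q x" "q \<in> Q" "i = 1 \<or> i = 2" for i q
  proof -
    have comm: "(g ^^ i) (q v) = q ((g ^^ i) v)" for v
      using perm_closed_funpow[OF closedC g(1)] commC i(2) by blast
    have "((g ^^ i) ^^ j) x = (q ^^ j) x" for j
    proof (induction j)
      case (Suc j)
      have "(g ^^ i) ((q ^^ j) x) = (q ^^ j) ((g ^^ i) x)"
        using funpow_commute[of "g ^^ i" q j] comm by (auto simp: fun_eq_iff)
      then show ?case using Suc i(1) by (simp add: funpow_swap1)
    qed simp
    then have gi: "(g ^^ (i * 2 ^ k)) x = x" using Qpow[OF i(2)] by (simp add: funpow_mult)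
    have "coprime (i * 2 ^ k) m" using g(3) i(3) by auto
    moreover have "m \<noteq> 0" using g(3) by (cases m) auto
    ultimately obtain s t where st: "(i * 2 ^ k) * s = m * t + 1"
      using bezout_nat[of "i * 2 ^ k" m] i(3) by (auto simp: coprime_iff_gcd_eq_1)
    have "(g ^^ ((i * 2 ^ k) * s)) x = x"
    proof -
      have "((g ^^ (i * 2 ^ k)) ^^ s) x = x" by (induction s) (simp_all add: gi)
      then show ?thesis by (simp add: funpow_mult)
    qed
    moreover have "g ^^ (m * t + 1) = g"
      using g(2) by (metis One_nat_def Suc_eq_plus1 funpow.simps(2) funpow_mult id_funpow comp_id)
    ultimately show ?thesis unfolding st by metis
  qed
  have n1: "g x \<notin> ?O" using key[of 1] gx by auto
  have n2: "g (g x) \<notin> ?O" using key[of 2] gx by (auto simp: numeral_2_eq_2)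
  have gp: "g permutes S" using g(1) by (rule permC)
  define z' where "z' = z \<circ> (g \<circ> z \<circ> inv' g)"
  have zg: "g \<circ> z \<circ> inv' g \<in> C" using g z by (intro compC invC)
  have orb: "\<exists>q\<in>Q. (g \<circ> z \<circ> inv' g) v = q v" for v
  proof -
    obtain q where q: "q \<in> Q" "z (inv' g v) = q (inv' g v)" using z(3) by blast
    then have "g (z (inv' g v)) = q v" using commC[OF g(1) q(1)] permutes_inverses(1)[OF gp] by simp
    then show ?thesis using q(1) by auto
  qed
  have z'C: "z' \<in> C" using z zg by (simp add: z'_def compC)
  have z'even: "evenperm z'"
    using evenperm_comp' permC[OF z(1)] permC[OF zg] evenperm_conj[OF gp permC[OF z(1)]] by (simp add: z'_def)
  have z'orb: "\<exists>q\<in>Q. z' v = q v" for v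
  proof -
    obtain q where q: "q \<in> Q" "(g \<circ> z \<circ> inv' g) v = q v" using orb by blast
    obtain r where r: "r \<in> Q" "z (q v) = r (q v)" using z(3) by blast
    have "z' v = (r \<circ> q) v" using q r by (simp add: z'_def)
    then show ?thesis using compQ[OF r(1) q(1)] by blast
  qed
  \<comment> \<open>Elements that agree at each point with some member of Q. Commuting with that
    member, such a w has at the point the same powers as it, so the order of Q also annihilates w
    and the group is a 2-group; conjugation by C preserves the condition.\<close>
  let ?N = "{w \<in> C. evenperm w \<and> (\<forall>v. \<exists>q\<in>Q. w v = q v)}"
  have "?N \<subseteq> Q"
  proof (rule normal_2_subgroup_sub_Q)
    show "perm_closed S ?N"
      unfolding perm_closed_def
    proof (intro conjI ballI)
      show "id \<in> ?N" using closedC by (auto simp: perm_closed_def intro!: bexI[of _ id] idQ)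
      show "w permutes S" if "w \<in> ?N" for w using that permC by blast
      show "w \<circ> w' \<in> ?N" if w: "w \<in> ?N" "w' \<in> ?N" for w w'
      proof -
        have "\<exists>q\<in>Q. (w \<circ> w') v = q v" for v
        proof -
          obtain q where q: "q \<in> Q" "w' v = q v" using w by blast
          obtain r where r: "r \<in> Q" "w (q v) = r (q v)" using w by blast
          have "(w \<circ> w') v = (r \<circ> q) v" using q r by simp
          then show ?thesis using compQ[OF r(1) q(1)] by blast
        qed
        then show ?thesis using w compC evenperm_comp' permC by auto
      qed
    qed
    show "\<exists>j. w ^^ (2 ^ j) = id" if w: "w \<in> ?N" for w
    proof -
      have "(w ^^ (2 ^ k)) v = v" for v
      proof -
        obtain q where q: "q \<in> Q" "w v = q v" using w by blast
        have "(w ^^ j) v = (q ^^ j) v" for j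
        proof (induction j)
          case (Suc j)
          have "w ((q ^^ j) v) = (q ^^ j) (w v)"
            using commC[of w "q ^^ j"] perm_closed_funpow[OF closedQ q(1)] w by blast
          then show ?case using Suc q(2) by (simp add: funpow_swap1)
        qed simp
        then show ?thesis using Qpow[OF q(1)] by simp
      qed
      then show ?thesis by (auto simp: fun_eq_iff)
    qed
    show "w \<in> C \<and> evenperm w" if "w \<in> ?N" for w using that by blast
    show "c \<circ> w \<circ> inv' c \<in> ?N" if c: "c \<in> C" and w: "w \<in> ?N" for c w
    proof -
      have "\<exists>q\<in>Q. (c \<circ> w \<circ> inv' c) v = q v" for v
      proof -
        obtain q where q: "q \<in> Q" "w (inv' c v) = q (inv' c v)" using w by blast
        then have "c (w (inv' c v)) = q v" using commC[OF c q(1)] permutes_inverses(1)[OF permC[OF c]] by simp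
        then show ?thesis using q(1) by auto
      qed
      then show ?thesis using c w compC invC evenperm_conj permC by simp
    qed
  qed
  then have "z' \<in> Q" using z'C z'even z'orb by blast
  then have "z' (g v) = g (z' v)" for v using commC[OF g(1)] by simp
  \<comment> \<open>At x the permutation \<open>z'\<close> acts as z, while it is trivial at g (g
    x), a point in neither the orbit of x nor that of g x. Commuting with g twice then forces z x =
    x.\<close>
  then have 1: "z' (g (g x)) = g (g (z' x))" by simp
  have inv_nO: "inv' g x \<notin> ?O"
  proof
    assume "inv' g x \<in> ?O"
    then obtain q where q: "q \<in> Q" "inv' g x = q x" by auto
    then have "x = q (g x)" using commC[OF g(1) q(1)] permutes_inverses(1)[OF gp] by metis
    then have "g x = inv' q x" using permutes_inverses(2)[OF permQ[OF q(1)]] by metis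
    then show False using n1 invQ[OF q(1)] by auto
  qed
  have "z' x = z x"
    using z(4)[OF inv_nO] permutes_inverses(1)[OF gp] by (simp add: z'_def)
  moreover have "z' (g (g x)) = g (g x)"
    using z(4)[OF n1] z(4)[OF n2] permutes_inverses(2)[OF gp] by (simp add: z'_def)
  ultimately have "g (g (z x)) = g (g x)" using 1 by simp
  then show False using z(2) permutes_inj[OF gp] by (metis injD)
qed

text \<open>The power g^(2^a) has odd order, so it is trivial on \<Omega> by
  \<open>odd_order_fixes_\<Omega>\<close>, and it is trivial elsewhere because g is.\<close>

lemma C_two_element_on_\<Omega>:
  assumes "g \<in> C" "\<And>x. x \<notin> \<Omega> \<Longrightarrow> g x = x"
  shows "\<exists>j. g ^^ (2 ^ j) = id"
proof -
  obtain a m i j where am: "odd m" "g ^^ (2 ^ a * m) = id"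
    using two_part_decomposition[OF finS permC[OF assms(1)]] by metis
  have "(g ^^ (2 ^ a)) x = x" for x
  proof (cases "x \<in> \<Omega>")
    case True
    show ?thesis
      by (rule odd_order_fixes_\<Omega>[OF perm_closed_funpow[OF closedC assms(1)] _ am(1) True]) (simp add: funpow_mult am)
  next
    case False
    have "(g ^^ i) x = x" for i by (induction i) (simp_all add: assms(2)[OF False])
    then show ?thesis .
  qed
  then show ?thesis by (auto simp: fun_eq_iff)
qed

lemma C_alt_\<Omega>_sub_Q:
  assumes "g \<in> C" "\<And>x. x \<notin> \<Omega> \<Longrightarrow> g x = x" "evenperm g"
  shows "g \<in> Q"
proof -
  let ?N = "{w \<in> C. (\<forall>x. x \<notin> \<Omega> \<longrightarrow> w x = x) \<and> evenperm w}"
  have "?N \<subseteq> Q"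
  proof (rule normal_2_subgroup_sub_Q)
    show "perm_closed S ?N"
      using closedC evenperm_comp' permC by (auto simp: perm_closed_def)
    show "\<exists>j. w ^^ (2 ^ j) = id" if "w \<in> ?N" for w using that C_two_element_on_\<Omega> by blast
    show "w \<in> C \<and> evenperm w" if "w \<in> ?N" for w using that by blast
    show "c \<circ> w \<circ> inv' c \<in> ?N" if c: "c \<in> C" and w: "w \<in> ?N" for c w
      using c w compC invC evenperm_conj permC C_\<Omega>[OF invC[OF c]] permutes_inverses(1)[OF permC[OF c]] by auto
  qed
  then show ?thesis using assms by blast
qed

end

subsection \<open>The central character of a self-centralizing pair\<close>

lemma conj_conj:
  assumes "g permutes S" "h permutes S"
  shows "g \<circ> (h \<circ> x \<circ> inv' h) \<circ> inv' g = (g \<circ> h) \<circ> x \<circ> inv' (g \<circ> h)"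
  using assms by (simp add: o_inv_distrib permutes_bij comp_assoc)

lemma conj_comp:
  assumes "g permutes S"
  shows "g \<circ> (x \<circ> y) \<circ> inv' g = (g \<circ> x \<circ> inv' g) \<circ> (g \<circ> y \<circ> inv' g)"
  using permutes_inverses(2)[OF assms] by (simp add: fun_eq_iff)

lemma conj_inv_conj:
  assumes "g permutes S"
  shows "inv' g \<circ> (g \<circ> x \<circ> inv' g) \<circ> g = x" "g \<circ> (inv' g \<circ> x \<circ> g) \<circ> inv' g = x"
  using permutes_inverses[OF assms] by (simp_all add: fun_eq_iff)

lemma conj_funpow:
  assumes "g permutes S"
  shows "(g \<circ> r \<circ> inv' g) ^^ m = g \<circ> r ^^ m \<circ> inv' g"
proof (induction m)
  case 0
  then show ?case using permutes_inv_o(1)[OF assms] by simp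
next
  case (Suc m)
  then show ?case by (simp only: funpow.simps conj_comp[OF assms])
qed

context perm_2_group
begin

lemma H_class_function_iff:
  "H.class_function a \<longleftrightarrow> (\<forall>x. x \<notin> H \<longrightarrow> a x = 0) \<and> (\<forall>g\<in>H. \<forall>x\<in>H. a (g \<circ> x \<circ> inv' g) = a x)"
  by (auto simp: H.class_function_def H.supported_def H_inv)

lemma \<Gamma>_class_function_iff:
  "\<Gamma>.class_function a \<longleftrightarrow> (\<forall>x. x \<notin> \<Gamma> \<longrightarrow> a x = 0) \<and> (\<forall>g\<in>\<Gamma>. \<forall>x\<in>\<Gamma>. a (g \<circ> x \<circ> inv' g) = a x)"
  by (auto simp: \<Gamma>.class_function_def \<Gamma>.supported_def \<Gamma>_inv)

lemma conj_in_H_iff: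
  assumes "g \<in> \<Gamma>"
  shows "g \<circ> x \<circ> inv' g \<in> H \<longleftrightarrow> x \<in> H"
proof
  assume "g \<circ> x \<circ> inv' g \<in> H"
  from conjH[OF inv\<Gamma>[OF assms] this] show "x \<in> H"
    using conj_inv_conj(1)[OF perm\<Gamma>[OF assms]] permutes_inv_inv[OF perm\<Gamma>[OF assms]] by simp
qed (rule conjH[OF assms])

lemma conj_in_C_iff:
  assumes "g \<in> \<Gamma>"
  shows "g \<circ> x \<circ> inv' g \<in> C \<longleftrightarrow> x \<in> C"
proof
  assume "g \<circ> x \<circ> inv' g \<in> C"
  from conjC[OF inv\<Gamma>[OF assms] this] show "x \<in> C"
    using conj_inv_conj(1)[OF perm\<Gamma>[OF assms]] permutes_inv_inv[OF perm\<Gamma>[OF assms]] by simp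
qed (rule conjC[OF assms])

lemma conj_in_Q_iff:
  assumes "g \<in> \<Gamma>"
  shows "g \<circ> x \<circ> inv' g \<in> Q \<longleftrightarrow> x \<in> Q"
proof
  assume "g \<circ> x \<circ> inv' g \<in> Q"
  from conjQ[OF inv\<Gamma>[OF assms] this] show "x \<in> Q"
    using conj_inv_conj(1)[OF perm\<Gamma>[OF assms]] permutes_inv_inv[OF perm\<Gamma>[OF assms]] by simp
qed (rule conjQ[OF assms])

text \<open>Equivalently, every Sylow 2-subgroup of the centralizer of y in H lies in Q, that is,
  the class of y has its defect groups inside Q. The elementwise form is the one applied to explicit
  2-elements.\<close>

definition small_centralizer :: "('a \<Rightarrow> 'a) \<Rightarrow> bool" where
  "small_centralizer y \<longleftrightarrow> (\<forall>r\<in>H. r \<circ> y = y \<circ> r \<longrightarrow> (\<exists>j. r ^^ (2 ^ j) = id) \<longrightarrow> r \<in> Q)"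

lemma small_centralizerD:
  "small_centralizer y \<Longrightarrow> r \<in> C \<Longrightarrow> evenperm r \<Longrightarrow> r \<circ> y = y \<circ> r \<Longrightarrow> r ^^ (2 ^ j) = id \<Longrightarrow> r \<in> Q"
  using C_even_in_H unfolding small_centralizer_def by blast

lemma small_centralizer_conj:
  assumes "g \<in> \<Gamma>" "small_centralizer (g \<circ> y \<circ> inv' g)"
  shows "small_centralizer y"
  unfolding small_centralizer_def
proof (intro ballI impI)
  fix r assume r: "r \<in> H" "r \<circ> y = y \<circ> r" "\<exists>j. r ^^ (2 ^ j) = id"
  note pg = perm\<Gamma>[OF assms(1)]
  let ?r = "g \<circ> r \<circ> inv' g"
  obtain j where "r ^^ (2 ^ j) = id" using r by blast
  then have "?r ^^ (2 ^ j) = id"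
    unfolding conj_funpow[OF pg] using permutes_inv_o(1)[OF pg] by simp
  moreover have "?r \<circ> (g \<circ> y \<circ> inv' g) = (g \<circ> y \<circ> inv' g) \<circ> ?r"
    unfolding conj_comp[OF pg, symmetric] using r by simp
  moreover have "?r \<in> H" by (rule conjH[OF assms(1) r(1)])
  ultimately have "?r \<in> Q" using assms(2) unfolding small_centralizer_def by blast
  then show "r \<in> Q" using conj_in_Q_iff[OF assms(1)] by simp
qed

end

locale self_centralizing_character = self_centralizing_perm_pair S Q b
  for S :: "'a set" and Q and b :: "('a \<Rightarrow> 'a) \<Rightarrow> 'f::field" +
  fixes w :: "(('a \<Rightarrow> 'a) \<Rightarrow> 'f) \<Rightarrow> 'f"
  assumes character: "central_character (group_algebra (perm_group H)) b w"
begin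

lemma w_add: "H.class_function x \<Longrightarrow> H.class_function y \<Longrightarrow> w (\<lambda>z. x z + y z) = w x + w y"
  and w_conv: "H.class_function x \<Longrightarrow> H.class_function y \<Longrightarrow> w (H.conv x y) = w x * w y"
  and w_smult: "H.class_function x \<Longrightarrow> w (\<lambda>z. c * x z) = c * w x"
  and w_b: "w b = 1"
  using character unfolding H.central_character_iff by blast+

lemma w_zero: "w (\<lambda>z. 0) = 0"
  using w_smult[OF H.class_function_zero, of 0] by simp

lemma b_class: "H.class_function b" "H.conv b b = b" "b \<noteq> (\<lambda>x. 0)"
  using blockb by (auto simp: H.block_iff)

text \<open>A nonzero value would make x invertible on the block; as Q is a normal 2-subgroup of H,
  an invertible element cannot vanish on the whole centralizer of Q. So w sees the values on C
  alone, which is what makes class sums of different groups comparable.\<close>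

lemma w_eq_zero_outside_C:
  assumes x: "H.class_function x" "\<And>u. u \<in> C \<Longrightarrow> u \<in> H \<Longrightarrow> x u = 0"
  shows "w x = 0"
proof (rule ccontr)
  assume "w x \<noteq> 0"
  then obtain x' where x': "H.class_function x'" "H.conv x x' = b"
    using H.central_character_unit[OF blockb character x(1)] by blast
  obtain k where k: "card Q = 2 ^ k" using card_Q by blast
  have "\<exists>u\<in>centralizer (perm_group H) Q. x u \<noteq> 0"
  proof (rule H.normal_p_subgroup_support[OF Q_trace(1) k two_is_prime_nat char2 _ b_class x(1) x'])
    fix g n assume "g \<in> carrier (perm_group H)" "n \<in> Q"
    then show "g \<otimes>\<^bsub>perm_group H\<^esub> n \<otimes>\<^bsub>perm_group H\<^esub> inv\<^bsub>perm_group H\<^esub> g \<in> Q"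
      using conjQ H_sub_\<Gamma> by (auto simp: H_inv)
  qed
  then show False using x(2) H_comm_Q_in_C by (auto simp: centralizer_def)
qed

lemma w_cong_on_C:
  assumes "H.class_function x" "H.class_function y" "\<And>u. u \<in> C \<Longrightarrow> u \<in> H \<Longrightarrow> x u = y u"
  shows "w x = w y"
proof -
  have cf: "H.class_function (\<lambda>z. (-1) * y z)" by (rule H.class_function_smult) fact
  have "w (\<lambda>z. x z + (-1) * y z) = 0"
    by (rule w_eq_zero_outside_C[OF H.class_function_add[OF assms(1) cf]]) (simp add: assms(3))
  then have "w x + (-1) * w y = 0"
    unfolding w_add[OF assms(1) cf] w_smult[OF assms(2)] .
  then show ?thesis by simp
qed

text \<open>b is a trace from Q, so a 2-element commuting with a point of its support is conjugate
  into Q, and Q is normal in H.\<close>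

lemma b_small_centralizer:
  assumes "b y \<noteq> 0"
  shows "small_centralizer y"
  unfolding small_centralizer_def
proof (intro ballI impI)
  fix r assume r: "r \<in> H" "r \<circ> y = y \<circ> r" "\<exists>j. r ^^ (2 ^ j) = id"
  then obtain j where j: "r ^^ (2 ^ j) = id" by blast
  have y: "y \<in> H" using assms b_class(1) by (auto simp: H_class_function_iff)
  obtain g where g: "g \<in> H" "inv' g \<circ> r \<circ> g \<in> Q"
    by (rule H.rel_trace_support_p_element[OF Q_trace assms two_is_prime_nat char2, of r j])
       (use r y j in \<open>auto simp: H_inv\<close>)
  have "g \<in> \<Gamma>" using g(1) H_sub_\<Gamma> by blast
  from conjQ[OF this g(2)] show "r \<in> Q"
    using conj_inv_conj(2)[OF permH[OF g(1)]] by simp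
qed

text \<open>\<open>\<beta>\<close> is the sum of the \<open>\<Gamma>\<close>-conjugates of \<open>b\<close>; as \<open>\<Gamma>/H\<close> has order at most 2, there are one or two of them.\<close>

lemma exists_invariant_idempotent:
  obtains \<beta> where "H.class_function \<beta>" "H.conv \<beta> \<beta> = \<beta>" "w \<beta> = 1"
    "\<And>y. \<beta> y \<noteq> 0 \<Longrightarrow> small_centralizer y"
    "\<And>g h. g \<in> \<Gamma> \<Longrightarrow> h \<in> H \<Longrightarrow> \<beta> (g \<circ> h \<circ> inv' g) = \<beta> h"
proof -
  \<comment> \<open>Q and the even elements of C lie in H, under which a class function is invariant
    anyway; what remains to be checked are the odd elements of C.\<close>
  have from_C: "\<beta> (g \<circ> h \<circ> inv' g) = \<beta> h"
    if "H.class_function \<beta>" "\<And>c h. c \<in> C \<Longrightarrow> \<not> evenperm c \<Longrightarrow> h \<in> H \<Longrightarrow> \<beta> (c \<circ> h \<circ> inv' c) = \<beta> h"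
      and g: "g \<in> \<Gamma>" and h: "h \<in> H" for \<beta> :: "('a \<Rightarrow> 'a) \<Rightarrow> 'f" and g h
  proof -
    obtain q c where qc: "q \<in> Q" "c \<in> C" "g = q \<circ> c" using g by (auto simp: \<Gamma>_def)
    have ch: "c \<circ> h \<circ> inv' c \<in> H" using qc h C_sub_\<Gamma> conjH by blast
    have "g \<circ> h \<circ> inv' g = q \<circ> (c \<circ> h \<circ> inv' c) \<circ> inv' q"
      unfolding qc(3) by (rule conj_conj[OF permQ[OF qc(1)] permC[OF qc(2)], symmetric])
    then have "\<beta> (g \<circ> h \<circ> inv' g) = \<beta> (c \<circ> h \<circ> inv' c)"
      using that(1) ch Q_sub_H qc(1) by (auto simp: H_class_function_iff)
    also have "\<dots> = \<beta> h"
      using that(1,2) h qc(2) C_even_in_H by (cases "evenperm c") (auto simp: H_class_function_iff)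
    finally show ?thesis .
  qed
  show thesis
  proof (cases "\<forall>c\<in>C. \<forall>h\<in>H. b (c \<circ> h \<circ> inv' c) = b h")
    case True
    then show thesis
      by (intro that[of b]) (use b_class w_b b_small_centralizer from_C[OF b_class(1)] in auto)
  next
    case False
    then obtain \<sigma> h0 where \<sigma>: "\<sigma> \<in> C" "h0 \<in> H" "b (\<sigma> \<circ> h0 \<circ> inv' \<sigma>) \<noteq> b h0" by blast
    have \<sigma>\<Gamma>: "\<sigma> \<in> \<Gamma>" using \<sigma> C_sub_\<Gamma> by blast
    note p\<sigma> = permC[OF \<sigma>(1)]
    have odd: "\<not> evenperm \<sigma>"
      using \<sigma> C_even_in_H b_class(1) by (auto simp: H_class_function_iff)
    define b' where "b' h = (if h \<in> H then b (\<sigma> \<circ> h \<circ> inv' \<sigma>) else 0)" for h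
    have bij: "bij_betw (\<lambda>h. \<sigma> \<circ> h \<circ> inv' \<sigma>) (carrier (perm_group H)) (carrier (perm_group H))"
      by (rule bij_betw_byWitness[where f' = "\<lambda>h. inv' \<sigma> \<circ> h \<circ> \<sigma>"])
         (use conjH[OF \<sigma>\<Gamma>] conjH[OF inv\<Gamma>[OF \<sigma>\<Gamma>]] permutes_inv_inv[OF p\<sigma>] in \<open>auto simp: conj_inv_conj[OF p\<sigma>]\<close>)
    have hom: "\<sigma> \<circ> (x \<circ> y) \<circ> inv' \<sigma> = (\<sigma> \<circ> x \<circ> inv' \<sigma>) \<circ> (\<sigma> \<circ> y \<circ> inv' \<sigma>)" for x y
      by (rule conj_comp[OF p\<sigma>])
    have b'cf: "H.class_function b'"
      unfolding H_class_function_iff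
    proof (intro conjI allI ballI impI)
      fix g x assume g: "g \<in> H" and x: "x \<in> H"
      have gs: "\<sigma> \<circ> g \<circ> inv' \<sigma> \<in> H" "\<sigma> \<circ> x \<circ> inv' \<sigma> \<in> H" using g x conjH[OF \<sigma>\<Gamma>] by auto
      have "\<sigma> \<circ> (g \<circ> x \<circ> inv' g) \<circ> inv' \<sigma> = (\<sigma> \<circ> g \<circ> inv' \<sigma>) \<circ> (\<sigma> \<circ> x \<circ> inv' \<sigma>) \<circ> inv' (\<sigma> \<circ> g \<circ> inv' \<sigma>)"
      proof -
        have "(\<sigma> \<circ> g \<circ> inv' \<sigma>) \<circ> (\<sigma> \<circ> x \<circ> inv' \<sigma>) = (\<sigma> \<circ> (g \<circ> x \<circ> inv' g) \<circ> inv' \<sigma>) \<circ> (\<sigma> \<circ> g \<circ> inv' \<sigma>)"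
          unfolding hom[symmetric] using permutes_inverses(2)[OF permH[OF g]] by (simp add: fun_eq_iff)
        then show ?thesis using conj_eq_iff[OF permH[OF gs(1)]] by metis
      qed
      then have "b (\<sigma> \<circ> (g \<circ> x \<circ> inv' g) \<circ> inv' \<sigma>) = b (\<sigma> \<circ> x \<circ> inv' \<sigma>)"
        using gs b_class(1) by (simp add: H_class_function_iff)
      moreover have "g \<circ> x \<circ> inv' g \<in> H" using g x H_sub_\<Gamma> conjH by blast
      ultimately show "b' (g \<circ> x \<circ> inv' g) = b' x" using x by (simp add: b'_def)
    qed (simp add: b'_def)
    \<comment> \<open>Two odd elements of C differ by an element of H, so every odd element
      interchanges b and b' just as \<sigma> does.\<close>
    have b_odd: "b (c \<circ> h \<circ> inv' c) = b' h" and b'_odd: "b' (c \<circ> h \<circ> inv' c) = b h"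
      if c: "c \<in> C" "\<not> evenperm c" and h: "h \<in> H" for c h
    proof -
      note pc = permC[OF c(1)]
      have "c \<circ> inv' \<sigma> \<in> H"
        using c \<sigma> odd by (intro C_even_in_H compC invC) (auto simp: evenperm_comp' evenperm_inv' pc p\<sigma> permutes_inv)
      moreover have "\<sigma> \<circ> h \<circ> inv' \<sigma> \<in> H" using conjH[OF \<sigma>\<Gamma> h] .
      ultimately have "b ((c \<circ> inv' \<sigma>) \<circ> (\<sigma> \<circ> h \<circ> inv' \<sigma>) \<circ> inv' (c \<circ> inv' \<sigma>)) = b (\<sigma> \<circ> h \<circ> inv' \<sigma>)"
        using b_class(1) by (simp add: H_class_function_iff)
      moreover have "(c \<circ> inv' \<sigma>) \<circ> (\<sigma> \<circ> h \<circ> inv' \<sigma>) \<circ> inv' (c \<circ> inv' \<sigma>) = (c \<circ> inv' \<sigma> \<circ> \<sigma>) \<circ> h \<circ> inv' (c \<circ> inv' \<sigma> \<circ> \<sigma>)"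
        by (rule conj_conj[OF permutes_compose[OF permutes_inv[OF p\<sigma>] pc] p\<sigma>])
      moreover have "c \<circ> inv' \<sigma> \<circ> \<sigma> = c" using permutes_inv_o(2)[OF p\<sigma>] by (simp add: comp_assoc)
      ultimately show "b (c \<circ> h \<circ> inv' c) = b' h" using h by (simp add: b'_def)
      have "\<sigma> \<circ> c \<in> H"
        using c \<sigma> odd by (intro C_even_in_H compC) (auto simp: evenperm_comp' pc p\<sigma>)
      then have "b ((\<sigma> \<circ> c) \<circ> h \<circ> inv' (\<sigma> \<circ> c)) = b h"
        using b_class(1) h by (simp add: H_class_function_iff)
      moreover have "c \<circ> h \<circ> inv' c \<in> H" using c(1) C_sub_\<Gamma> conjH h by blast
      ultimately show "b' (c \<circ> h \<circ> inv' c) = b h"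
        using conj_conj[OF p\<sigma> pc, of h] by (simp add: b'_def)
    qed
    have auto_conv: "H.conv (\<lambda>y. if y \<in> H then a (\<sigma> \<circ> y \<circ> inv' \<sigma>) else 0) (\<lambda>y. if y \<in> H then c (\<sigma> \<circ> y \<circ> inv' \<sigma>) else 0) x
        = H.conv a c (\<sigma> \<circ> x \<circ> inv' \<sigma>)" if "x \<in> H" for a c :: "('a \<Rightarrow> 'a) \<Rightarrow> 'f" and x
      using H.conv_automorphism[OF bij, of x a c] that hom by simp
    have b'_fun: "b' = (\<lambda>y. if y \<in> H then b (\<sigma> \<circ> y \<circ> inv' \<sigma>) else 0)"
      by (rule ext) (simp add: b'_def)
    have b_fun: "b = (\<lambda>y. if y \<in> H then b' (\<sigma> \<circ> y \<circ> inv' \<sigma>) else 0)"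
      using b'_odd[OF \<sigma>(1) odd] b_class(1) by (auto simp: fun_eq_iff H_class_function_iff)
    have b'_idem: "H.conv b' b' = b'"
    proof
      fix x
      show "H.conv b' b' x = b' x"
      proof (cases "x \<in> H")
        case True
        then show ?thesis using auto_conv[OF True, of b b] b_class(2) by (simp add: b'_fun)
      qed (simp add: H.conv_apply b'_def)
    qed
    have comm: "H.conv b' b = H.conv b b'"
      by (intro H.class_function_conv_comm H.class_function_supported b_class b'cf)
    \<comment> \<open>By primitivity the product is b or 0. If it were b, applying \<sigma>, which
      swaps b and b', would show that it is also b', against the choice of \<sigma>.\<close>
    have b'b: "H.conv b b' = (\<lambda>x. 0)"
    proof (rule ccontr)
      assume "H.conv b b' \<noteq> (\<lambda>x. 0)"
      then have bb': "H.conv b b' = b"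
        using H.block_mult_idempotent[OF blockb b'cf b'_idem] by blast
      have "H.conv b' b x = b' x" for x
      proof (cases "x \<in> H")
        case True
        have "H.conv b' b x = H.conv b b' (\<sigma> \<circ> x \<circ> inv' \<sigma>)"
          unfolding auto_conv[OF True, of b b', symmetric] b'_fun[symmetric] b_fun[symmetric] ..
        then show ?thesis using True bb' by (simp add: b'_def)
      qed (simp add: H.conv_apply b'_def)
      then have "b = b'" using comm bb' by (metis ext)
      then show False using \<sigma> by (metis b'_def)
    qed
    define \<beta> where "\<beta> = (\<lambda>x. b x + b' x)"
    have \<beta>cf: "H.class_function \<beta>"
      unfolding \<beta>_def by (intro H.class_function_add b_class b'cf)
    show thesis
    proof (rule that[OF \<beta>cf])
      show "H.conv \<beta> \<beta> = \<beta>"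
        unfolding \<beta>_def H.conv_add_left H.conv_add_right comm b'b b_class b'_idem by simp
      \<comment> \<open>As w b = 1, orthogonality makes w vanish on b', so the sum still has value
        1.\<close>
      have "w b * w b' = 0"
        using w_conv[OF b_class(1) b'cf] b'b w_zero by simp
      then show "w \<beta> = 1"
        unfolding \<beta>_def using w_add[OF b_class(1) b'cf] w_b by simp
      show "small_centralizer y" if "\<beta> y \<noteq> 0" for y
      proof -
        from that have "b y \<noteq> 0 \<or> b (\<sigma> \<circ> y \<circ> inv' \<sigma>) \<noteq> 0"
          by (auto simp: \<beta>_def b'_def split: if_splits)
        then show ?thesis
          using b_small_centralizer small_centralizer_conj[OF \<sigma>\<Gamma>] by blast
      qed
      show "\<beta> (g \<circ> h \<circ> inv' g) = \<beta> h" if "g \<in> \<Gamma>" "h \<in> H" for g h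
        by (rule from_C[OF \<beta>cf _ that]) (simp add: \<beta>_def b_odd b'_odd)
    qed
  qed
qed

lemma \<Gamma>_class_function_truncate:
  "\<Gamma>.class_function a \<Longrightarrow> H.class_function (Defs.truncate H a)"
  using H_sub_\<Gamma> conjH by (auto simp: \<Gamma>_class_function_iff H_class_function_iff Defs.truncate_def subsetD)

lemma \<Gamma>_class_sum_H:
  assumes "u \<in> H"
  shows "H.class_function (\<Gamma>.class_sum u :: _ \<Rightarrow> 'f)" "Defs.truncate H (\<Gamma>.class_sum u) = (\<Gamma>.class_sum u :: _ \<Rightarrow> 'f)"
proof -
  have "\<Gamma>.conj_class u \<subseteq> H"
    using conjH assms by (auto simp: \<Gamma>.conj_class_def \<Gamma>_inv)
  then show eq: "Defs.truncate H (\<Gamma>.class_sum u) = (\<Gamma>.class_sum u :: _ \<Rightarrow> 'f)"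
    by (auto simp: Defs.truncate_def \<Gamma>.class_sum_def fun_eq_iff)
  show "H.class_function (\<Gamma>.class_sum u :: _ \<Rightarrow> 'f)"
    using \<Gamma>_class_function_truncate[OF \<Gamma>.class_function_class_sum[where 'c = 'f], of u] assms H_sub_\<Gamma>
    unfolding eq by auto
qed

text \<open>The search runs over \<open>\<Gamma>\<close>-classes, on which \<beta> is constant. The
  2-part of the representative turns out to be central in \<open>\<Gamma>\<close> and can be split
  off, leaving an element u of odd order, to which \<open>odd_order_fixes_\<Omega>\<close>
  applies.\<close>

lemma exists_class:
  obtains \<beta> :: "('a \<Rightarrow> 'a) \<Rightarrow> 'f" and \<zeta> u m where
    "H.class_function \<beta>" "H.conv \<beta> \<beta> = \<beta>" "\<And>y. \<beta> y \<noteq> 0 \<Longrightarrow> small_centralizer y"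
    "\<And>g h. g \<in> \<Gamma> \<Longrightarrow> h \<in> H \<Longrightarrow> \<beta> (g \<circ> h \<circ> inv' g) = \<beta> h"
    "\<beta> (\<zeta> \<circ> u) \<noteq> 0" "\<zeta> \<in> Q" "u \<in> C" "evenperm u" "u ^^ m = id" "odd m" "small_centralizer u"
    "w (\<Gamma>.class_sum u) \<noteq> 0"
proof -
  obtain \<beta> where \<beta>: "H.class_function \<beta>" "H.conv \<beta> \<beta> = \<beta>" "w \<beta> = 1"
    "\<And>y. \<beta> y \<noteq> 0 \<Longrightarrow> small_centralizer y"
    "\<And>g h. g \<in> \<Gamma> \<Longrightarrow> h \<in> H \<Longrightarrow> \<beta> (g \<circ> h \<circ> inv' g) = \<beta> h"
    using exists_invariant_idempotent by blast
  \<comment> \<open>Cutting \<beta> down to C does not change the value of w and ensures that the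
    class found consists of elements of C.\<close>
  define \<beta>C where "\<beta>C x = (if x \<in> C then \<beta> x else 0)" for x
  have \<beta>C\<Gamma>: "\<Gamma>.class_function \<beta>C"
    unfolding \<Gamma>_class_function_iff
  proof (intro conjI allI impI ballI)
    show "\<beta>C x = 0" if "x \<notin> \<Gamma>" for x using that C_sub_\<Gamma> by (auto simp: \<beta>C_def)
    show "\<beta>C (g \<circ> x \<circ> inv' g) = \<beta>C x" if g: "g \<in> \<Gamma>" and x: "x \<in> \<Gamma>" for g x
    proof (cases "x \<in> H")
      case True
      then show ?thesis using \<beta>(5)[OF g True] conj_in_C_iff[OF g] by (simp add: \<beta>C_def)
    next
      case False
      then have "\<beta> x = 0" "\<beta> (g \<circ> x \<circ> inv' g) = 0"
        using \<beta>(1) conj_in_H_iff[OF g] by (auto simp: H_class_function_iff)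
      then show ?thesis by (simp add: \<beta>C_def)
    qed
  qed
  have tr: "Defs.truncate H \<beta>C = \<beta>C"
    using \<beta>(1) by (auto simp: Defs.truncate_def \<beta>C_def fun_eq_iff H_class_function_iff)
  have \<beta>CH: "H.class_function \<beta>C"
    using \<Gamma>_class_function_truncate[OF \<beta>C\<Gamma>] tr by simp
  have w\<beta>C: "w \<beta>C = 1"
    using w_cong_on_C[OF \<beta>CH \<beta>(1)] \<beta>(3) by (simp add: \<beta>C_def)
  obtain y where y: "y \<in> \<Gamma>" "\<beta>C y \<noteq> 0" "w (Defs.truncate H (\<Gamma>.class_sum y)) \<noteq> 0"
  proof (rule \<Gamma>.functional_nonzero_on_class_sum[OF \<beta>C\<Gamma>, of "\<lambda>a. w (Defs.truncate H a)"])
    show "w (Defs.truncate H \<beta>C) \<noteq> 0" by (simp add: tr w\<beta>C)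
    show "w (Defs.truncate H (\<lambda>x. a x + c x)) = w (Defs.truncate H a) + w (Defs.truncate H c)"
      if "\<Gamma>.class_function a" "\<Gamma>.class_function c" for a c
    proof -
      have "Defs.truncate H (\<lambda>x. a x + c x) = (\<lambda>x. Defs.truncate H a x + Defs.truncate H c x)"
        by (auto simp: Defs.truncate_def)
      then show ?thesis using w_add[OF that[THEN \<Gamma>_class_function_truncate]] by simp
    qed
    show "w (Defs.truncate H (\<lambda>x. k * a x)) = k * w (Defs.truncate H a)" if "\<Gamma>.class_function a" for k a
    proof -
      have "Defs.truncate H (\<lambda>x. k * a x) = (\<lambda>x. k * Defs.truncate H a x)"
        by (auto simp: Defs.truncate_def)
      then show ?thesis using w_smult[OF that[THEN \<Gamma>_class_function_truncate]] by simp
    qed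
  qed auto
  have yC: "y \<in> C" and \<beta>y: "\<beta> y \<noteq> 0" using y(2) by (auto simp: \<beta>C_def split: if_splits)
  have yH: "y \<in> H" using \<beta>y \<beta>(1) by (auto simp: H_class_function_iff)
  obtain a m i j where d: "odd m" "y = y ^^ i \<circ> y ^^ j" "(y ^^ i) ^^ (2 ^ a) = id" "(y ^^ j) ^^ m = id"
    using two_part_decomposition[OF finS permC[OF yC]] by metis
  define \<zeta> u where "\<zeta> = y ^^ i" and "u = y ^^ j"
  have \<zeta>H: "\<zeta> \<in> H" and uH: "u \<in> H"
    unfolding \<zeta>_def u_def by (intro perm_closed_funpow[OF closedH yH])+
  have \<zeta>C: "\<zeta> \<in> C" and uC: "u \<in> C"
    unfolding \<zeta>_def u_def by (intro perm_closed_funpow[OF closedC yC])+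
  have "\<zeta> \<circ> y = y \<circ> \<zeta>" unfolding \<zeta>_def using funpow_commute[of y y i] by simp
  \<comment> \<open>\<zeta> is a power of y, hence a 2-element of H commuting with y, and y is in
    the support of \<beta>. Lying in both Q and C, it is central in \<open>\<Gamma>\<close>.\<close>
  then have \<zeta>Q: "\<zeta> \<in> Q"
    using \<beta>(4)[OF \<beta>y] \<zeta>H d(3) unfolding small_centralizer_def \<zeta>_def by blast
  have y_eq: "y = \<zeta> \<circ> u" using d(2) by (simp add: \<zeta>_def u_def)
  have \<zeta>\<Gamma>: "g \<circ> \<zeta> = \<zeta> \<circ> g" if g: "g \<in> \<Gamma>" for g
  proof -
    obtain q c where "q \<in> Q" "c \<in> C" "g = q \<circ> c" using g by (auto simp: \<Gamma>_def)
    then show ?thesis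
      using commC[OF \<zeta>C] commC[of c \<zeta>] \<zeta>Q by (simp add: fun_eq_iff)
  qed
  have \<zeta>_cf: "H.class_function (H.delta \<zeta> :: _ \<Rightarrow> 'f)"
    unfolding H_class_function_iff
  proof (intro conjI allI impI ballI)
    show "H.delta \<zeta> x = (0::'f)" if "x \<notin> H" for x using that \<zeta>H by (auto simp: H.delta_def)
    show "H.delta \<zeta> (g \<circ> x \<circ> inv' g) = (H.delta \<zeta> x :: 'f)" if g: "g \<in> H" and x: "x \<in> H" for g x
    proof -
      have "g \<circ> x \<circ> inv' g = \<zeta> \<longleftrightarrow> x = \<zeta>"
        unfolding conj_eq_iff[OF permH[OF g]] \<zeta>\<Gamma>[OF subsetD[OF H_sub_\<Gamma> g], symmetric]
        using permutes_inv_o(2)[OF permH[OF g]] by (metis comp_assoc id_comp)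
      then show ?thesis by (simp add: H.delta_def)
    qed
  qed
  \<comment> \<open>By centrality of \<zeta> the class of y is \<zeta> times the class of u, and
    multiplicativity of w passes the nonvanishing on to u.\<close>
  have "\<Gamma>.class_sum y = H.conv (H.delta \<zeta>) (\<Gamma>.class_sum u :: _ \<Rightarrow> 'f)"
  proof
    fix x
    have "g \<circ> y \<circ> inv' g = \<zeta> \<circ> (g \<circ> u \<circ> inv' g)" if "g \<in> \<Gamma>" for g
      using \<zeta>\<Gamma>[OF that] unfolding y_eq by (metis comp_assoc)
    then have "\<Gamma>.conj_class y = (\<lambda>v. \<zeta> \<circ> v) ` \<Gamma>.conj_class u"
      unfolding \<Gamma>.conj_class_def image_image by (intro image_cong) (auto simp: \<Gamma>_inv)
    moreover have "x \<in> (\<lambda>v. \<zeta> \<circ> v) ` \<Gamma>.conj_class u \<longleftrightarrow> inv' \<zeta> \<circ> x \<in> \<Gamma>.conj_class u"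
    proof
      assume "x \<in> (\<lambda>v. \<zeta> \<circ> v) ` \<Gamma>.conj_class u"
      then obtain v where "v \<in> \<Gamma>.conj_class u" "x = \<zeta> \<circ> v" by blast
      then show "inv' \<zeta> \<circ> x \<in> \<Gamma>.conj_class u"
        using permutes_inv_o(2)[OF permH[OF \<zeta>H]] by (simp add: comp_assoc[symmetric])
    next
      assume "inv' \<zeta> \<circ> x \<in> \<Gamma>.conj_class u"
      moreover have "x = \<zeta> \<circ> (inv' \<zeta> \<circ> x)"
        using permutes_inv_o(1)[OF permH[OF \<zeta>H]] by (simp add: comp_assoc[symmetric])
      ultimately show "x \<in> (\<lambda>v. \<zeta> \<circ> v) ` \<Gamma>.conj_class u" by blast
    qed
    ultimately have *: "\<Gamma>.class_sum y x = (\<Gamma>.class_sum u (inv' \<zeta> \<circ> x) :: 'f)"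
      by (simp add: \<Gamma>.class_sum_def)
    show "\<Gamma>.class_sum y x = H.conv (H.delta \<zeta>) (\<Gamma>.class_sum u :: _ \<Rightarrow> 'f) x"
    proof (cases "x \<in> H")
      case True
      then show ?thesis using * \<zeta>H by (simp add: H.delta_conv H_inv)
    next
      case False
      then show ?thesis
        using \<Gamma>_class_sum_H(1)[OF yH] by (simp add: H.conv_apply H_class_function_iff)
    qed
  qed
  then have "w (H.delta \<zeta>) * w (\<Gamma>.class_sum u) \<noteq> 0"
    using y(3) \<Gamma>_class_sum_H[OF yH] w_conv[OF \<zeta>_cf \<Gamma>_class_sum_H(1)[OF uH]] by simp
  then have wu: "w (\<Gamma>.class_sum u) \<noteq> 0" by simp
  have "small_centralizer u"
    unfolding small_centralizer_def
  proof (intro ballI impI)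
    fix r assume r: "r \<in> H" "r \<circ> u = u \<circ> r" "\<exists>j. r ^^ (2 ^ j) = id"
    have "r \<circ> y = y \<circ> r"
      using \<zeta>\<Gamma>[of r] r H_sub_\<Gamma> unfolding y_eq by (metis comp_assoc subsetD)
    then show "r \<in> Q" using \<beta>(4)[OF \<beta>y] r unfolding small_centralizer_def by blast
  qed
  moreover have "evenperm u" using uH by (simp add: H_def)
  moreover have "\<beta> (\<zeta> \<circ> u) \<noteq> 0" using \<beta>y unfolding y_eq .
  moreover have "u ^^ m = id" using d(4) by (simp add: u_def)
  ultimately show thesis
    using that[OF \<beta>(1,2,4,5) _ \<zeta>Q uC _ _ d(1) _ wu] by blast
qed

end

subsection \<open>The defect group of the Brauer correspondent\<close>

lemma odd_order_square_fix:
  assumes "u (u x) = x" "u ^^ m = id" "odd m"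
  shows "u x = x"
proof -
  obtain k where k: "m = Suc (2 * k)" using assms(3) by (metis oddE Suc_eq_plus1)
  have "(u ^^ (2 * k)) x = x"
    by (induction k) (simp_all add: assms(1))
  then have "(u ^^ m) x = u x" by (simp add: k)
  then show ?thesis using assms(2) by simp
qed

context perm_2_group
begin

definition Alt where "Alt = {g. g permutes S \<and> evenperm g}"

lemma closedAlt: "perm_closed S Alt"
  by (auto simp: perm_closed_def Alt_def permutes_id evenperm_comp' intro: permutes_compose)

sublocale A: finite_group "perm_group Alt"
  by (rule finite_group_perm_group[OF finS closedAlt])

lemma A_inv: "g \<in> Alt \<Longrightarrow> inv\<^bsub>perm_group Alt\<^esub> g = inv' g"
  by (rule perm_group_inv[OF finS closedAlt])

lemma H_sub_Alt: "H \<subseteq> Alt"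
  using permH by (auto simp: H_def Alt_def)

text \<open>The 2-group N acts on its moved points without a common fixed point.\<close>

lemma even_card_moved:
  assumes N: "perm_closed S N" "\<exists>k. card N = 2 ^ k" and "CHAR('f::comm_ring_1) = 2"
  shows "even (card {x. \<exists>r\<in>N. r x \<noteq> x})"
proof -
  let ?X = "{x. \<exists>r\<in>N. r x \<noteq> x}"
  have perm: "r permutes S" if "r \<in> N" for r using N that by (simp add: perm_closed_def)
  have "?X \<subseteq> S" using perm by (auto simp: permutes_def)
  then have fin: "finite ?X" using finS finite_subset by blast
  have act: "r x \<in> ?X" if r: "r \<in> N" and x: "x \<in> ?X" for r x
  proof (rule ccontr)
    assume "r x \<notin> ?X"
    then have fixed: "s (r x) = r x" if "s \<in> N" for s using that by blast
    have "inv' r (r x) = r x" by (rule fixed) (rule perm_closed_inv[OF finS N(1) r])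
    then have "r x = x" using permutes_inverses(2)[OF perm[OF r]] by simp
    then show False using fixed x by auto
  qed
  have "(\<Sum>x\<in>?X. 1) = (\<Sum>x\<in>{x \<in> ?X. \<forall>r\<in>N. r x = x}. (1::'f))"
    by (rule sum_fixed_points_perms[OF assms(3) N fin act]) simp_all
  also have "{x \<in> ?X. \<forall>r\<in>N. r x = x} = {}" by blast
  finally have "of_nat (card ?X) = (0::'f)" by simp
  then show ?thesis using assms(3) by (simp add: of_nat_eq_0_iff_char_dvd)
qed

end

context self_centralizing_character
begin

text \<open>If the involution induced by \<rho> on the points moved by u were always even,
  \<open>small_centralizer u\<close> would suffice. It can be odd: for u = (1 2 3)(4 5 6) it may be
  (1 4)(2 5)(3 6), and a product of two of its transpositions no longer commutes with u. Therefore
  \<beta> is carried to the centralizer \<open>D\<close> of the involution by a Brauer homomorphism.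
  There \<open>V\<close> is a normal 2-subgroup, so some d in the support of \<beta> commutes with
  all of \<open>V\<close>, and \<open>small_centralizer d\<close> puts \<open>V\<close> into
  Q.\<close>

lemma two_element_fixes_moved:
  fixes \<beta> :: "('a \<Rightarrow> 'a) \<Rightarrow> 'f"
  assumes \<beta>: "H.class_function \<beta>" "H.conv \<beta> \<beta> = \<beta>" "\<And>y. \<beta> y \<noteq> 0 \<Longrightarrow> small_centralizer y"
      "\<And>g h. g \<in> \<Gamma> \<Longrightarrow> h \<in> H \<Longrightarrow> \<beta> (g \<circ> h \<circ> inv' g) = \<beta> h"
    and y: "\<beta> (\<zeta> \<circ> u) \<noteq> 0" "\<zeta> \<in> Q" and u: "u \<in> C" "u ^^ m = id" "odd m"
    and \<rho>: "\<rho> permutes S" "\<rho> \<circ> u = u \<circ> \<rho>" "\<rho> ^^ (2 ^ j) = id" and x: "u x \<noteq> x"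
  shows "\<rho> x = x"
proof (rule ccontr)
  assume "\<rho> x \<noteq> x"
  \<comment> \<open>The exponent 2^i is chosen so that this power of \<rho> still moves a point
    moved by u while its square moves none; on those points it is therefore an involution.\<close>
  let ?P = "\<lambda>i. \<forall>v. u v \<noteq> v \<longrightarrow> (\<rho> ^^ (2 ^ i)) v = v"
  have "?P j" using \<rho>(3) by simp
  moreover have "\<not> ?P 0" using x \<open>\<rho> x \<noteq> x\<close> by auto
  ultimately obtain i where i: "\<not> ?P i" "?P (Suc i)" using ex_least_nat_less[of ?P j] by blast
  define t' where "t' = \<rho> ^^ (2 ^ i)"
  have t'u: "t' (u v) = u (t' v)" for v
    using funpow_commute[of u \<rho> "2 ^ i"] \<rho>(2) by (simp add: t'_def fun_eq_iff)
  have t't': "t' (t' v) = v" if "u v \<noteq> v" for v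
    using i(2) that by (simp add: t'_def mult_2 funpow_add)
  have pu: "u permutes S" by (rule permC[OF u(1)])
  have u\<Omega>: "u v = v" if "v \<in> \<Omega>" for v by (rule odd_order_fixes_\<Omega>[OF u that])
  define t where "t v = (if u v \<noteq> v then t' v else v)" for v
  have t'moved: "u (t' v) \<noteq> t' v" if "u v \<noteq> v" for v
    using t'u[of v] that inj_fn[OF permutes_inj[OF \<rho>(1)], of "2 ^ i"] unfolding t'_def by (metis injD)
  have tt: "t (t v) = v" for v using t't' t'moved by (simp add: t_def)
  have pt: "t permutes S"
    unfolding permutes_def
  proof (intro conjI allI impI)
    show "t v = v" if "v \<notin> S" for v using that pu by (simp add: t_def permutes_not_in)
    show "\<exists>!v. t v = z" for z using tt by metis
  qed
  have tu: "t \<circ> u = u \<circ> t"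
    using t'u permutes_inj[OF pu] by (auto simp: t_def fun_eq_iff dest: injD)
  have t\<Omega>: "t v = v" if "v \<in> \<Omega>" for v using u\<Omega>[OF that] by (simp add: t_def)
  have tC: "t \<in> C" using sup_compl_in_C[OF pt t\<Omega>] .
  have t\<Gamma>: "t \<in> \<Gamma>" using tC C_sub_\<Gamma> by blast
  obtain x0 where x0: "u x0 \<noteq> x0" "t x0 \<noteq> x0"
    using i(1) by (auto simp: t_def t'_def)
  have x0\<Omega>: "x0 \<notin> \<Omega>" using x0 u\<Omega> by blast
  have inv_t: "inv' t = t" by (rule inv_unique_comp) (simp_all add: fun_eq_iff tt)
  define D where "D = {h \<in> H. h \<circ> t = t \<circ> h}"
  have DH: "D \<subseteq> H" by (auto simp: D_def)
  have closedD: "perm_closed S D"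
    using closedH by (auto simp: perm_closed_def D_def) (metis comp_assoc)
  interpret D: finite_group "perm_group D" by (rule finite_group_perm_group[OF finS closedD])
  have D_inv: "inv\<^bsub>perm_group D\<^esub> g = inv' g" if "g \<in> D" for g
    by (rule perm_group_inv[OF finS closedD that])
  \<comment> \<open>The even part of the elementary abelian group generated by the transpositions of
    \<open>t\<close>.\<close>
  define V where "V = {v. v permutes S \<and> evenperm v \<and> (\<forall>z. v z = z \<or> v z = t z)}"
  have pV: "v permutes S" if "v \<in> V" for v using that by (simp add: V_def)
  have Vz: "v z = z \<or> v z = t z" if "v \<in> V" for v z using that by (simp add: V_def)
  have closedV: "perm_closed S V"
  proof -
    have "v \<circ> v' \<in> V" if v: "v \<in> V" "v' \<in> V" for v v'
    proof -
      have "(v \<circ> v') z = z \<or> (v \<circ> v') z = t z" for z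
        using Vz[OF v(2), of z] Vz[OF v(1), of z] Vz[OF v(1), of "t z"] tt[of z] by auto
      moreover have "evenperm (v \<circ> v')" using v evenperm_comp'[OF pV pV] by (simp add: V_def)
      ultimately show ?thesis using permutes_compose[OF pV[OF v(2)] pV[OF v(1)]] by (simp add: V_def)
    qed
    then show ?thesis by (auto simp: perm_closed_def pV) (simp add: V_def permutes_id)
  qed
  have injV: "v z = v z' \<Longrightarrow> z = z'" if "v \<in> V" for v z z'
    using permutes_inj[OF pV[OF that]] by (auto dest: injD)
  have VV: "v (v z) = z" and Vt: "v (t z) = t (v z)" if v: "v \<in> V" for v z
    using Vz[OF v, of z] Vz[OF v, of "t z"] tt[of z] injV[OF v, of z "t z"] by metis+
  have V\<Omega>: "v z = z" if "v \<in> V" "z \<in> \<Omega>" for v z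
    using Vz[OF that(1), of z] t\<Omega>[OF that(2)] by auto
  have VC: "v \<in> C" if "v \<in> V" for v
    by (rule sup_compl_in_C[OF pV[OF that] V\<Omega>[OF that]])
  have Veven: "evenperm v" if "v \<in> V" for v using that by (simp add: V_def)
  have VD: "V \<subseteq> D"
    using C_even_in_H[OF VC Veven] Vt by (auto simp: D_def fun_eq_iff)
  have V2: "v ^^ (2 ^ 1) = id" if "v \<in> V" for v
    using VV[OF that] by (simp add: fun_eq_iff numeral_2_eq_2)
  obtain k where cardV: "card V = 2 ^ k"
    using card_2_power_if_2_elements[OF closedV] V2 by blast
  \<comment> \<open>the image of \<open>\<beta>\<close> under the Brauer homomorphism of the group generated by \<open>t\<close>\<close>
  define e where "e h = (if h \<in> D then \<beta> h else 0)" for h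
  have e_cf: "D.class_function e"
    unfolding D.class_function_def D.supported_def
  proof (intro conjI allI impI ballI)
    fix g h assume "g \<in> carrier (perm_group D)" "h \<in> carrier (perm_group D)"
    then have gh: "g \<in> D" "h \<in> D" "g \<in> \<Gamma>" "h \<in> H" using DH H_sub_\<Gamma> by auto
    have "g \<otimes>\<^bsub>perm_group D\<^esub> h \<otimes>\<^bsub>perm_group D\<^esub> inv\<^bsub>perm_group D\<^esub> g \<in> carrier (perm_group D)"
      using gh by (intro D.m_closed D.inv_closed) auto
    then have "g \<circ> h \<circ> inv' g \<in> D" using D_inv[OF gh(1)] by simp
    then show "e (g \<otimes>\<^bsub>perm_group D\<^esub> h \<otimes>\<^bsub>perm_group D\<^esub> inv\<^bsub>perm_group D\<^esub> g) = e h"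
      using \<beta>(4)[OF gh(3,4)] gh D_inv[OF gh(1)] by (simp add: e_def)
  qed (simp add: e_def)
  have pH: "g permutes S" if "g \<in> H" for g by (rule permH[OF that])
  \<comment> \<open>For d in \<open>D\<close>, conjugation by t preserves the terms of the
    convolution of \<beta> with itself at d, so in characteristic 2 the terms with g outside
    \<open>D\<close> cancel in pairs.\<close>
  have e_idem: "D.conv e e = e"
  proof
    fix d
    show "D.conv e e d = e d"
    proof (cases "d \<in> D")
      case d: True
      have dH: "d \<in> H" using d DH by blast
      let ?act = "\<lambda>r g. r \<circ> g \<circ> inv' r"
      let ?f = "\<lambda>g. \<beta> g * \<beta> (inv' g \<circ> d)"
      have "\<beta> d = H.conv \<beta> \<beta> d" by (simp add: \<beta>(2))
      also have "\<dots> = (\<Sum>g\<in>H. ?f g)"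
        using dH by (simp add: H.conv_apply H_inv cong: sum.cong)
      also have "\<dots> = (\<Sum>g\<in>{g \<in> H. \<forall>r\<in>{id, t}. ?act r g = g}. ?f g)"
      proof (rule sum_fixed_points_perms[OF char2])
        show "perm_closed S {id, t}"
          using pt tt by (auto simp: perm_closed_def permutes_id fun_eq_iff)
        have "t \<noteq> id" using x0 by auto
        then have "card {id, t} = 2 ^ 1" by simp
        then show "\<exists>k. card {id, t} = 2 ^ k" by blast
        show "finite H" using H.finite_carrier by simp
        fix r g assume r: "r \<in> {id, t}" and g: "g \<in> H"
        have r\<Gamma>: "r \<in> \<Gamma>" using r t\<Gamma> closed\<Gamma> by (auto simp: perm_closed_def)
        show rg: "?act r g \<in> H" by (rule conjH[OF r\<Gamma> g])
        have gd: "inv' g \<circ> d \<in> H" using perm_closed_inv[OF finS closedH g] dH closedH by (simp add: perm_closed_def)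
        have "inv' (?act r g) \<circ> d = ?act r (inv' g \<circ> d)"
        proof -
          have rd: "r \<circ> d = d \<circ> r" using r d by (auto simp: D_def)
          have "inv' (?act r g) = ?act r (inv' g)"
            using permutes_inverses[OF perm\<Gamma>[OF r\<Gamma>]] permutes_inverses[OF pH[OF g]]
            by (intro inv_unique_comp) (simp_all add: fun_eq_iff)
          moreover have "?act r (inv' g) \<circ> d = ?act r (inv' g \<circ> d)"
            unfolding conj_comp[OF perm\<Gamma>[OF r\<Gamma>]] using conj_eq_iff[OF perm\<Gamma>[OF r\<Gamma>], of d d] rd by simp
          ultimately show ?thesis by simp
        qed
        then show "?f (?act r g) = ?f g"
          using \<beta>(4)[OF r\<Gamma> g] \<beta>(4)[OF r\<Gamma> gd] by simp
      next
        fix r r' g assume "r \<in> {id, t}" "r' \<in> {id, t}"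
        then have "r permutes S" "r' permutes S" using pt by (auto simp: permutes_id)
        then show "?act (r \<circ> r') g = ?act r (?act r' g)"
          by (simp only: conj_conj)
      qed simp
      also have "{g \<in> H. \<forall>r\<in>{id, t}. ?act r g = g} = D"
        using conj_eq_iff[OF pt] by (auto simp: D_def simp del: o_apply)
      also have "(\<Sum>g\<in>D. ?f g) = (\<Sum>g\<in>D. e g * e (inv' g \<circ> d))"
      proof (rule sum.cong[OF refl])
        fix g assume g: "g \<in> D"
        have "inv' g \<circ> d \<in> D" using perm_closed_inv[OF finS closedD g] closedD d by (simp add: perm_closed_def)
        then show "?f g = e g * e (inv' g \<circ> d)" using g by (simp add: e_def)
      qed
      also have "\<dots> = D.conv e e d"
        using d by (simp add: D.conv_apply D_inv cong: sum.cong)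
      finally show ?thesis using d by (simp add: e_def)
    qed (simp add: D.conv_apply e_def)
  qed
  have "\<zeta> \<circ> u \<in> D"
  proof -
    have "\<zeta> \<circ> u \<in> H" using y(1) \<beta>(1) by (auto simp: H_class_function_iff)
    moreover have "t \<circ> \<zeta> = \<zeta> \<circ> t"
      by (rule fixing_compl_comm_fixing) (use t\<Omega> Q_fixes[OF y(2)] pt permQ[OF y(2)] in auto)
    then have "(\<zeta> \<circ> u) \<circ> t = t \<circ> (\<zeta> \<circ> u)" using tu by (metis comp_assoc)
    ultimately show ?thesis by (simp add: D_def)
  qed
  then have "e (\<zeta> \<circ> u) \<noteq> 0" using y(1) by (simp add: e_def)
  then have e0: "e \<noteq> (\<lambda>x. 0)" by auto
  have "\<exists>d\<in>centralizer (perm_group D) V. e d \<noteq> 0"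
  proof (rule D.normal_p_subgroup_support[OF _ cardV two_is_prime_nat char2 _ e_cf e_idem e0 e_cf e_cf e_idem])
    show "subgroup V (perm_group D)" by (rule subgroup_perm_group[OF finS closedD closedV VD])
    fix d v assume d: "d \<in> carrier (perm_group D)" and v: "v \<in> V"
    then have dD: "d \<in> D" by simp
    have pd: "d permutes S" using dD DH pH by blast
    have "(d \<circ> v \<circ> inv' d) z = z \<or> (d \<circ> v \<circ> inv' d) z = t z" for z
    proof -
      have "d (t (inv' d z)) = t z"
        using dD permutes_inverses(1)[OF pd] by (auto simp: D_def fun_eq_iff)
      then show ?thesis using Vz[OF v, of "inv' d z"] permutes_inverses(1)[OF pd] by auto
    qed
    moreover have "d \<circ> v \<circ> inv' d permutes S" "evenperm (d \<circ> v \<circ> inv' d)"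
      using pd pV[OF v] Veven[OF v] evenperm_conj by (auto intro!: permutes_compose permutes_inv simp del: o_apply)
    ultimately show "d \<otimes>\<^bsub>perm_group D\<^esub> v \<otimes>\<^bsub>perm_group D\<^esub> inv\<^bsub>perm_group D\<^esub> d \<in> V"
      using D_inv[OF dD] by (simp add: V_def)
  qed
  then obtain d where d: "d \<in> D" "\<And>v. v \<in> V \<Longrightarrow> d \<circ> v = v \<circ> d" "\<beta> d \<noteq> 0"
    by (auto simp: centralizer_def e_def split: if_splits)
  \<comment> \<open>Two transpositions of t make v even. The second is the image of the first under
    u, and it is a different one because u has odd order. Since v moves \<open>x0\<close>, which Q
    fixes, it cannot lie in Q.\<close>
  define v where "v = transpose x0 (t x0) \<circ> transpose (u x0) (t (u x0))"
  have tux: "t (u x0) = u (t x0)" using tu by (auto simp: fun_eq_iff)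
  have ux_t: "u x0 \<noteq> t x0"
  proof
    assume "u x0 = t x0"
    then have "u (u x0) = x0" using tux tt by metis
    then show False using odd_order_square_fix[OF _ u(2,3)] x0 by blast
  qed
  have dist: "t (u x0) \<noteq> u x0" "t (u x0) \<noteq> x0" "t (u x0) \<noteq> t x0"
    using tux x0 ux_t tt permutes_inj[OF pu] by (metis injD)+
  have xS: "x0 \<in> S" using x0(1) pu by (meson permutes_not_in)
  have memS: "t x0 \<in> S" "u x0 \<in> S" "t (u x0) \<in> S"
    using xS permutes_in_image[OF pt] permutes_in_image[OF pu] by auto
  have "v permutes S"
    unfolding v_def using xS memS by (intro permutes_compose permutes_swap_id)
  moreover have "evenperm v"
    unfolding v_def using evenperm_comp'[OF permutes_swap_id permutes_swap_id] xS memS x0 dist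
    by (simp add: evenperm_swap)
  moreover have "v z = z \<or> v z = t z" for z
    using tt x0 ux_t dist by (auto simp: v_def transpose_def)
  ultimately have vV: "v \<in> V" by (simp add: V_def)
  have "v \<in> Q"
    by (rule small_centralizerD[OF \<beta>(3)[OF d(3)] VC[OF vV] Veven[OF vV] _ V2[OF vV]]) (simp add: d(2)[OF vV])
  then have "v x0 = x0" by (rule Q_fixes[OF _ x0\<Omega>])
  moreover have "v x0 = t x0" using x0 ux_t dist by (auto simp: v_def transpose_def)
  ultimately show False using x0 by simp
qed

text \<open>Elements of C of odd order move no point of \<Omega>, so a conjugating permutation
  matters only on the points moved by u and may be altered elsewhere. In one direction it is made
  trivial on \<Omega> to land in C; in the other a transposition inside \<Omega> corrects its
  parity, hence \<Omega> is nonempty.\<close>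

lemma A_conj_class_in_C:
  assumes u: "u \<in> C" "evenperm u" "u ^^ m = id" "odd m" and \<Omega>: "\<Omega> \<noteq> {}" and v: "v \<in> C"
  shows "v \<in> A.conj_class u \<longleftrightarrow> v \<in> \<Gamma>.conj_class u"
proof
  have pu: "u permutes S" by (rule permC[OF u(1)])
  have u\<Omega>: "u x = x" if "x \<in> \<Omega>" for x by (rule odd_order_fixes_\<Omega>[OF u(1,3,4) that])
  {
    assume "v \<in> A.conj_class u"
    then obtain g where g: "g \<in> Alt" "v = g \<circ> u \<circ> inv' g" by (auto simp: A.conj_class_def A_inv)
    have pg: "g permutes S" using g by (simp add: Alt_def)
    have "v ^^ m = id" unfolding g(2) conj_funpow[OF pg] u(3) using permutes_inv_o(1)[OF pg] by simp
    then have v\<Omega>: "v x = x" if "x \<in> \<Omega>" for x using odd_order_fixes_\<Omega>[OF v _ u(4) that] by blast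
    have gu: "g (u x) = v (g x)" for x using g(2) permutes_inverses(2)[OF pg] by simp
    have pv: "v permutes S" by (rule permC[OF v])
    define M N K where "M = {x. u x \<noteq> x}" and "N = {x. v x \<noteq> x}" and "K = S - \<Omega>"
    have MK: "M \<subseteq> K" using u\<Omega> permutes_not_in[OF pu] by (auto simp: M_def K_def)
    have NK: "N \<subseteq> K" using v\<Omega> permutes_not_in[OF pv] by (auto simp: N_def K_def)
    have finK: "finite K" by (simp add: K_def)
    have ginj: "g x = g z \<longleftrightarrow> x = z" for x z using permutes_inj[OF pg] by (auto dest: injD)
    have gM: "g ` M = N"
    proof
      show "g ` M \<subseteq> N" using gu ginj by (auto simp: M_def N_def simp flip: gu)
      show "N \<subseteq> g ` M"
      proof
        fix x assume "x \<in> N"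
        then have "inv' g x \<in> M" using gu[of "inv' g x"] permutes_inverses(1)[OF pg] by (auto simp: M_def N_def)
        then show "x \<in> g ` M" using permutes_inverses(1)[OF pg] by (metis imageI)
      qed
    qed
    have bM: "bij_betw g M N" using gM ginj by (auto simp: bij_betw_def inj_on_def)
    have "card (K - M) = card (K - N)"
      using bij_betw_same_card[OF bM] MK NK finK by (simp add: card_Diff_subset finite_subset)
    then obtain f where f: "bij_betw f (K - M) (K - N)"
      using finite_same_card_bij finK by (metis finite_Diff)
    \<comment> \<open>\<open>f\<close> is any bijection between the points of \<open>K\<close> fixed
      by u and those fixed by v; on them the conjugation equation holds trivially.\<close>
    define s where "s x = (if x \<in> M then g x else if x \<in> K then f x else x)" for x
    have "bij_betw s (M \<union> (K - M)) (N \<union> (K - N))"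
    proof (rule bij_betw_combine)
      show "bij_betw s M N" by (rule bij_betw_cong[THEN iffD1, OF _ bM]) (simp add: s_def)
      show "bij_betw s (K - M) (K - N)" by (rule bij_betw_cong[THEN iffD1, OF _ f]) (simp add: s_def)
    qed auto
    then have "bij_betw s K K" using MK NK by (simp add: Un_absorb1)
    then have "s permutes K" using MK by (intro bij_imp_permutes) (auto simp: s_def)
    then have ps: "s permutes S" by (rule permutes_subset) (simp add: K_def)
    have sC: "s \<in> C" by (rule sup_compl_in_C[OF ps]) (use MK in \<open>auto simp: s_def K_def\<close>)
    have "s (u x) = v (s x)" for x
    proof (cases "x \<in> M")
      case True
      then have "u x \<in> M" using permutes_inj[OF pu] by (auto simp: M_def dest: injD)
      then show ?thesis using True gu by (simp add: s_def)
    next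
      case False
      then have ux: "u x = x" by (simp add: M_def)
      have "s x \<notin> N"
        using False f NK by (auto simp: s_def bij_betw_def)
      then show ?thesis using ux by (simp add: N_def)
    qed
    then have "s \<circ> u = v \<circ> s" by (simp add: fun_eq_iff)
    then have "v = s \<circ> u \<circ> inv' s" using conj_eq_iff[OF ps] by metis
    then show "v \<in> \<Gamma>.conj_class u"
      using sC C_sub_\<Gamma> by (auto simp: \<Gamma>.conj_class_def \<Gamma>_inv intro!: image_eqI[of _ _ s])
  next
    assume "v \<in> \<Gamma>.conj_class u"
    then obtain \<gamma> where \<gamma>: "\<gamma> \<in> \<Gamma>" "v = \<gamma> \<circ> u \<circ> inv' \<gamma>" by (auto simp: \<Gamma>.conj_class_def \<Gamma>_inv)
    then obtain q c where qc: "q \<in> Q" "c \<in> C" "\<gamma> = q \<circ> c" by (auto simp: \<Gamma>_def)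
    have vc: "v = c \<circ> u \<circ> inv' c" using conj_\<Gamma>_C[OF qc(1,2) u(1)] \<gamma>(2) qc(3) by simp
    have pc: "c permutes S" by (rule permC[OF qc(2)])
    have "\<exists>g\<in>Alt. v = g \<circ> u \<circ> inv' g"
    proof (cases "evenperm c")
      case True
      then show ?thesis using pc vc by (auto simp: Alt_def)
    next
      case False
      obtain x r where x: "x \<in> \<Omega>" "r \<in> Q" "r x \<noteq> x" using \<Omega> by (auto simp: \<Omega>_def)
      have rx: "r x \<in> \<Omega>" using Q_\<Omega>[OF x(2)] x(1) by simp
      define \<tau> where "\<tau> = transpose x (r x)"
      have p\<tau>: "\<tau> permutes S" unfolding \<tau>_def using x rx \<Omega>_sub_S by (intro permutes_swap_id) auto
      have "u \<circ> \<tau> = \<tau> \<circ> u"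
      proof (rule fixing_compl_comm_fixing[OF u\<Omega> _ pu p\<tau>])
        show "\<tau> z = z" if "z \<notin> \<Omega>" for z using that x rx by (auto simp: \<tau>_def transpose_def)
      qed
      moreover have "c \<circ> u = v \<circ> c" using vc conj_eq_iff[OF pc] by metis
      ultimately have "(c \<circ> \<tau>) \<circ> u = v \<circ> (c \<circ> \<tau>)" by (metis comp_assoc)
      moreover have pct: "c \<circ> \<tau> permutes S" by (rule permutes_compose[OF p\<tau> pc])
      ultimately have "v = (c \<circ> \<tau>) \<circ> u \<circ> inv' (c \<circ> \<tau>)" using conj_eq_iff[OF pct] by metis
      moreover have "evenperm (c \<circ> \<tau>)"
        using evenperm_comp'[OF pc p\<tau>] False x by (simp add: \<tau>_def evenperm_swap)
      ultimately show ?thesis using pct by (auto simp: Alt_def)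
    qed
    then show "v \<in> A.conj_class u" by (auto simp: A.conj_class_def A_inv)
  }
qed

text \<open>On C the truncated alternating class sum of u agrees with its
  \<open>\<Gamma>\<close>-class sum, and w depends only on C. So the character of B does not vanish
  on the class of u, which makes B a trace from a Sylow 2-subgroup of the centralizer of u; P is
  conjugate into that subgroup.\<close>

lemma defect_group_centralizes_conjugate:
  assumes u: "u \<in> C" "evenperm u" "u ^^ m = id" "odd m" and \<Omega>: "\<Omega> \<noteq> {}"
    and wu: "w (\<Gamma>.class_sum u) \<noteq> 0"
    and B: "block (group_algebra (perm_group Alt)) B"
      "central_character (group_algebra (perm_group Alt)) B (\<lambda>z. w (Defs.truncate H z))"
    and P: "defect_group (perm_group Alt) B P"
  obtains k g where "card P = 2 ^ k" "g \<in> Alt" "\<And>r. r \<in> P \<Longrightarrow> (inv' g \<circ> r \<circ> g) \<circ> u = u \<circ> (inv' g \<circ> r \<circ> g)"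
proof -
  have uH: "u \<in> H" using C_even_in_H u by blast
  have uA: "u \<in> carrier (perm_group Alt)" using uH H_sub_Alt by auto
  have cf: "H.class_function (Defs.truncate H (A.class_sum u :: _ \<Rightarrow> 'f))"
  proof -
    have "A.class_function (A.class_sum u :: _ \<Rightarrow> 'f)" by (rule A.class_function_class_sum[OF uA])
    then have *: "(A.class_sum u (g \<circ> x \<circ> inv' g) :: 'f) = A.class_sum u x" if "g \<in> H" "x \<in> H" for g x
      using that H_sub_Alt A.class_functionD[of "A.class_sum u" g x] by (auto simp: A_inv subsetD)
    have "g \<circ> x \<circ> inv' g \<in> H" if "g \<in> H" "x \<in> H" for g x
      using conjH that H_sub_\<Gamma> by blast
    then show ?thesis using * by (simp add: H_class_function_iff Defs.truncate_def)
  qed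
  have "w (Defs.truncate H (A.class_sum u)) = w (\<Gamma>.class_sum u)"
  proof (rule w_cong_on_C[OF cf \<Gamma>_class_sum_H(1)[OF uH]])
    fix v assume "v \<in> C" "v \<in> H"
    then show "Defs.truncate H (A.class_sum u) v = (\<Gamma>.class_sum u v :: 'f)"
      using A_conj_class_in_C[OF u \<Omega>] by (simp add: Defs.truncate_def A.class_sum_def \<Gamma>.class_sum_def)
  qed
  then have w0: "w (Defs.truncate H (A.class_sum u)) \<noteq> 0" using wu by simp
  have cent: "subgroup (centralizer (perm_group Alt) {u}) (perm_group Alt)"
    by (rule A.subgroup_centralizer) (use uA in auto)
  obtain R a k where R: "subgroup R (perm_group Alt)" "R \<subseteq> centralizer (perm_group Alt) {u}"
      "card R = 2 ^ a" "card R * k = card (centralizer (perm_group Alt) {u})" "\<not> 2 dvd k"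
    using A.exists_sylow_subgroup[OF two_is_prime_nat cent] by blast
  have "B \<in> rel_trace (perm_group Alt) R ` fixed_elements (perm_group Alt) R"
    by (rule A.block_in_rel_trace_of_class[OF B uA w0 R(1) _ R(4)])
       (use R(2,5) char2 in \<open>auto simp: centralizer_def\<close>)
  from A.defect_group_in_conjugate[OF two_is_prime_nat char2 B P R(1) this]
  obtain k' g where g: "card P = 2 ^ k'" "g \<in> Alt"
    "\<And>r. r \<in> P \<Longrightarrow> inv\<^bsub>perm_group Alt\<^esub> g \<otimes>\<^bsub>perm_group Alt\<^esub> r \<otimes>\<^bsub>perm_group Alt\<^esub> g \<in> R"
    by (metis perm_group_simps(1))
  show thesis
  proof (rule that[OF g(1,2)])
    fix r assume "r \<in> P"
    then have "inv' g \<circ> r \<circ> g \<in> centralizer (perm_group Alt) {u}"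
      using g(3) R(2) A_inv[OF g(2)] by auto
    then show "(inv' g \<circ> r \<circ> g) \<circ> u = u \<circ> (inv' g \<circ> r \<circ> g)" by (simp add: centralizer_def)
  qed
qed

lemma C_alt_moved_sub_Q:
  assumes \<Omega>: "\<Omega> \<noteq> {}"
    and B: "block (group_algebra (perm_group Alt)) B"
      "central_character (group_algebra (perm_group Alt)) B (\<lambda>z. w (Defs.truncate H z))"
    and P: "defect_group (perm_group Alt) B P" "Q \<subseteq> P"
    and g: "g \<in> C" "evenperm g" "\<And>x. (\<And>r. r \<in> P \<Longrightarrow> r x = x) \<Longrightarrow> g x = x"
  shows "g \<in> Q"
proof -
  obtain \<beta> :: "('a \<Rightarrow> 'a) \<Rightarrow> 'f" and \<zeta> u m where
    \<beta>: "H.class_function \<beta>" "H.conv \<beta> \<beta> = \<beta>" "\<And>y. \<beta> y \<noteq> 0 \<Longrightarrow> small_centralizer y"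
      "\<And>g h. g \<in> \<Gamma> \<Longrightarrow> h \<in> H \<Longrightarrow> \<beta> (g \<circ> h \<circ> inv' g) = \<beta> h"
      "\<beta> (\<zeta> \<circ> u) \<noteq> 0" "\<zeta> \<in> Q"
    and u: "u \<in> C" "evenperm u" "u ^^ m = id" "odd m" and su: "small_centralizer u"
    and wu: "w (\<Gamma>.class_sum u) \<noteq> 0"
    using exists_class by blast
  obtain k h where Pcard: "card P = 2 ^ k" and h: "h \<in> Alt"
    and Pu: "\<And>r. r \<in> P \<Longrightarrow> (inv' h \<circ> r \<circ> h) \<circ> u = u \<circ> (inv' h \<circ> r \<circ> h)"
    using defect_group_centralizes_conjugate[OF u \<Omega> wu B P(1)] by blast
  have Psub: "subgroup P (perm_group Alt)" using P(1) by (simp add: defect_group_def)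
  interpret P: perm_2_group S P
    by unfold_locales
       (use perm_closed_of_subgroup[OF finS closedAlt Psub] subgroup.subset[OF Psub] Pcard in \<open>auto simp: Alt_def\<close>)
  have ph: "h permutes S" using h by (simp add: Alt_def)
  have pu: "u permutes S" by (rule permC[OF u(1)])
  have u\<Omega>: "u x = x" if "x \<in> \<Omega>" for x by (rule odd_order_fixes_\<Omega>[OF u(1,3,4) that])
  define J where "J = {x \<in> S. x \<notin> \<Omega> \<and> u x = x}"
  define \<Delta> where "\<Delta> = P.\<Omega> - \<Omega>"
  have \<Omega>P: "\<Omega> \<subseteq> P.\<Omega>" using P(2) by (auto simp: \<Omega>_def P.\<Omega>_def)
  have fin: "finite J" "finite \<Omega>" "finite P.\<Omega>"
    using finite_subset[OF \<Omega>_sub_S finS] finite_subset[OF P.\<Omega>_sub_S finS] by (simp_all add: J_def)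
  \<comment> \<open>The conjugate h^-1 P h commutes with u, so by
    \<open>two_element_fixes_moved\<close> every point it moves is fixed by u.\<close>
  have "inv' h ` P.\<Omega> \<subseteq> \<Omega> \<union> J"
  proof (rule image_subsetI)
    fix x assume x: "x \<in> P.\<Omega>"
    then obtain r where r: "r \<in> P" "r x \<noteq> x" by (auto simp: P.\<Omega>_def)
    obtain j where j: "r ^^ (2 ^ j) = id" using P.two_element_Q[OF r(1)] by blast
    let ?r = "inv' h \<circ> r \<circ> inv' (inv' h)"
    have pih: "inv' h permutes S" by (rule permutes_inv[OF ph])
    have ii: "inv' (inv' h) = h" by (rule permutes_inv_inv[OF ph])
    have "?r ^^ (2 ^ j) = id"
      unfolding conj_funpow[OF pih] j using permutes_inv_o(1)[OF pih] by simp
    moreover have "?r permutes S"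
      using pih P.permQ[OF r(1)] ph by (auto simp: ii intro!: permutes_compose simp del: o_apply)
    moreover have "?r (inv' h x) \<noteq> inv' h x"
      unfolding ii using r(2) permutes_inverses(1)[OF ph] permutes_inj[OF pih] by (auto dest: injD)
    ultimately have "u (inv' h x) = inv' h x"
      using two_element_fixes_moved[OF \<beta> u(1,3,4)] Pu[OF r(1)] unfolding ii by metis
    moreover have "inv' h x \<in> S" using x P.\<Omega>_sub_S permutes_in_image[OF pih] by blast
    ultimately show "inv' h x \<in> \<Omega> \<union> J" by (auto simp: J_def)
  qed
  then have "card P.\<Omega> \<le> card (\<Omega> \<union> J)"
    using fin permutes_inj_on[OF permutes_inv[OF ph]] by (metis card_inj_on_le finite_UnI)
  also have "\<dots> \<le> card \<Omega> + card J" by (rule card_Un_le)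
  finally have "card P.\<Omega> \<le> card \<Omega> + card J" .
  moreover have "card \<Delta> = card P.\<Omega> - card \<Omega>" "card \<Omega> \<le> card P.\<Omega>"
    using \<Omega>P fin by (simp_all add: \<Delta>_def card_Diff_subset card_mono)
  moreover have "even (card \<Omega>)" "even (card P.\<Omega>)"
    using even_card_moved[OF closedQ card_Q char2] even_card_moved[OF P.closedQ P.card_Q char2]
    by (simp_all add: \<Omega>_def P.\<Omega>_def)
  ultimately have \<Delta>J: "card \<Delta> \<le> card J" "even (card \<Delta>)" by auto
  have transp: "transpose x y \<in> C" "transpose x y permutes S" "transpose x y \<circ> u = u \<circ> transpose x y"
    if "x \<in> J" "y \<in> J" for x y
  proof -
    show p: "transpose x y permutes S" using that by (intro permutes_swap_id) (auto simp: J_def)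
    show "transpose x y \<in> C" using that by (intro sup_compl_in_C[OF p]) (auto simp: J_def transpose_def)
    show "transpose x y \<circ> u = u \<circ> transpose x y"
    proof
      fix z
      have "u z = x \<longleftrightarrow> z = x" "u z = y \<longleftrightarrow> z = y"
        using that injD[OF permutes_inj[OF pu], of z x] injD[OF permutes_inj[OF pu], of z y] by (auto simp: J_def)
      then show "(transpose x y \<circ> u) z = (u \<circ> transpose x y) z"
        using that by (auto simp: J_def transpose_def)
    qed
  qed
  have J3: "card J \<le> 3"
  proof (rule ccontr)
    assume "\<not> card J \<le> 3"
    then have "4 \<le> card J" by simp
    then obtain T where T: "T \<subseteq> J" "card T = 4" by (meson obtain_subset_with_card_n)
    then obtain a b c d where abcd: "T = {a, b, c, d}" "a \<noteq> b" "a \<noteq> c" "a \<noteq> d" "b \<noteq> c" "b \<noteq> d" "c \<noteq> d"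
      by (auto simp: card_Suc_eq numeral_eq_Suc)
    then have J: "a \<in> J" "b \<in> J" "c \<in> J" "d \<in> J" using T by auto
    let ?v = "transpose a b \<circ> transpose c d"
    have "?v \<in> Q"
    proof (rule small_centralizerD[OF su])
      show "?v \<in> C" by (rule compC) (use transp J in auto)
      show "evenperm ?v" using evenperm_comp'[OF transp(2) transp(2)] J abcd by (simp add: evenperm_swap)
      show "?v \<circ> u = u \<circ> ?v" using transp(3)[OF J(1,2)] transp(3)[OF J(3,4)] by (metis comp_assoc)
      show "?v ^^ (2 ^ 1) = id" using abcd by (auto simp: fun_eq_iff transpose_def numeral_2_eq_2)
    qed
    then have "?v a = a" by (rule Q_fixes) (use J in \<open>simp add: J_def\<close>)
    then show False using abcd by (auto simp: transpose_def)
  qed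
  have J1: "card J \<le> 1" if e: "e \<in> C" "\<And>x. x \<notin> \<Omega> \<Longrightarrow> e x = x" "\<not> evenperm e" for e
  proof (rule ccontr)
    assume "\<not> card J \<le> 1"
    then obtain a b where ab: "a \<in> J" "b \<in> J" "a \<noteq> b"
      by (metis One_nat_def card_le_Suc0_iff_eq fin(1))
    let ?\<tau> = "transpose a b"
    have pe: "e permutes S" by (rule permC[OF e(1)])
    have comm: "e \<circ> ?\<tau> = ?\<tau> \<circ> e"
      by (rule fixing_compl_comm_fixing[symmetric]) (use ab e(2) pe transp(2) in \<open>auto simp: J_def transpose_def\<close>)
    have eu: "e \<circ> u = u \<circ> e"
      by (rule fixing_compl_comm_fixing[symmetric]) (use e(2) pe pu u\<Omega> in auto)
    obtain j where j: "e ^^ (2 ^ j) = id" using C_two_element_on_\<Omega>[OF e(1,2)] by blast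
    have "e \<circ> ?\<tau> \<in> Q"
    proof (rule small_centralizerD[OF su])
      show "e \<circ> ?\<tau> \<in> C" by (rule compC) (use e transp ab in auto)
      show "evenperm (e \<circ> ?\<tau>)" using evenperm_comp'[OF pe transp(2)] ab e(3) by (simp add: evenperm_swap)
      show "e \<circ> ?\<tau> \<circ> u = u \<circ> (e \<circ> ?\<tau>)" using transp(3)[OF ab(1,2)] eu by (metis comp_assoc)
      have "?\<tau> ^^ 2 = id" by (simp add: fun_eq_iff numeral_2_eq_2)
      then have "?\<tau> ^^ (2 * 2 ^ j) = id" by (metis funpow_mult id_funpow)
      moreover have "e ^^ (2 * 2 ^ j) = id" using j by (simp add: mult_2 funpow_add)
      ultimately show "(e \<circ> ?\<tau>) ^^ (2 ^ Suc j) = id"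
        by (simp add: funpow_comp_commute[OF comm])
    qed
    then have "(e \<circ> ?\<tau>) a = a" by (rule Q_fixes) (use ab in \<open>simp add: J_def\<close>)
    then show False using ab e(2) by (auto simp: J_def)
  qed
  have pg: "g permutes S" by (rule permC[OF g(1)])
  have g_out: "g x = x" if "x \<notin> P.\<Omega>" for x
    using g(3) that by (auto simp: P.\<Omega>_def)
  have g\<Delta>: "g x \<in> \<Delta>" if "x \<in> \<Delta>" for x
  proof -
    have "g x \<notin> \<Omega>" using C_\<Omega>[OF g(1)] that by (simp add: \<Delta>_def)
    moreover have "g x \<in> P.\<Omega>"
      using that g_out permutes_inj[OF pg] by (metis DiffD1 \<Delta>_def injD)
    ultimately show ?thesis by (simp add: \<Delta>_def)
  qed
  have "g x = x" if x: "x \<notin> \<Omega>" for x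
  proof (rule ccontr)
    assume gx: "g x \<noteq> x"
    then have x\<Delta>: "x \<in> \<Delta>" using x g_out by (auto simp: \<Delta>_def)
    have "card {x, g x} \<le> card \<Delta>"
      using x\<Delta> g\<Delta> fin by (intro card_mono) (auto simp: \<Delta>_def)
    \<comment> \<open>The size of \<Delta> is even, at least 2 because g moves x within \<Delta>,
      and at most 3.\<close>
    then have c2: "card \<Delta> = 2" using \<Delta>J J3 gx by (auto elim!: evenE)
    then have \<Delta>: "\<Delta> = {x, g x}"
      using x\<Delta> g\<Delta> gx fin by (intro card_subset_eq[symmetric]) (auto simp: \<Delta>_def)
    have "g (g x) = x"
      using g\<Delta>[OF g\<Delta>[OF x\<Delta>]] gx permutes_inj[OF pg] unfolding \<Delta> by (auto dest: injD)
    let ?\<tau> = "transpose x (g x)"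
    have xS: "x \<in> S" "g x \<in> S" using x\<Delta> g\<Delta>[OF x\<Delta>] P.\<Omega>_sub_S by (auto simp: \<Delta>_def)
    have p\<tau>: "?\<tau> permutes S" using xS by (intro permutes_swap_id)
    have "?\<tau> \<in> C"
      by (rule sup_compl_in_C[OF p\<tau>]) (use x C_\<Omega>[OF g(1)] in \<open>auto simp: transpose_def\<close>)
    then have "?\<tau> \<circ> g \<in> C" by (rule compC[OF _ g(1)])
    moreover have "(?\<tau> \<circ> g) z = z" if "z \<notin> \<Omega>" for z
    proof (cases "z \<in> \<Delta>")
      case True
      then show ?thesis using \<open>g (g x) = x\<close> unfolding \<Delta> by auto
    next
      case False
      then have "z \<notin> P.\<Omega>" "z \<noteq> x" "z \<noteq> g x" using that x\<Delta> g\<Delta>[OF x\<Delta>] by (auto simp: \<Delta>_def)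
      then show ?thesis using g_out by (simp add: transpose_def)
    qed
    \<comment> \<open>Cancelling the swap that g performs on \<Delta> leaves an odd member of C
      supported on \<Omega>. Then \<open>J\<close> has at most one point, too few for the two points
      of \<Delta>.\<close>
    moreover have "\<not> evenperm (?\<tau> \<circ> g)"
      using evenperm_comp'[OF p\<tau> pg] g(2) gx by (simp add: evenperm_swap)
    ultimately have "card J \<le> 1" by (rule J1)
    then show False using c2 \<Delta>J by simp
  qed
  then show ?thesis using C_alt_\<Omega>_sub_Q[OF g(1) _ g(2)] by blast
qed

end

subsection \<open>Self-centralizing Brauer pairs of alternating groups\<close>

theorem theorem4p5:
  fixes n :: nat
    and Q :: "(nat \<Rightarrow> nat) set"
    and b :: "(nat \<Rightarrow> nat) \<Rightarrow> 'f::alg_closed_field"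
  assumes "CHAR('f) = 2"
    and "self_centralizing_brauer_pair (alt_group n) Q b"
  shows "(\<forall>\<Omega>. \<Omega> \<subseteq> {1..n} \<and> acts_fixed_point_freely Q \<Omega> \<and> fixes_pointwise Q ({1..n} - \<Omega>) \<longrightarrow>
            centralizer ((alt_group n)\<lparr>carrier := alt_on \<Omega>\<rparr>) Q
              = centre ((alt_group n)\<lparr>carrier := Q\<rparr>)) \<and>
         (\<forall>B P \<Omega>'.
            brauer_correspondent (alt_group n)
              (Q <#>\<^bsub>alt_group n\<^esub> centralizer (alt_group n) Q) b B \<and>
            defect_group (alt_group n) B P \<and>
            centralizer ((alt_group n)\<lparr>carrier := P\<rparr>) Q \<subseteq> Q \<and> Q \<subseteq> P \<and>
            \<Omega>' \<subseteq> {1..n} \<and> acts_fixed_point_freely P \<Omega>' \<and> fixes_pointwise P ({1..n} - \<Omega>') \<longrightarrow>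
            centralizer ((alt_group n)\<lparr>carrier := alt_on \<Omega>'\<rparr>) Q
              = centre ((alt_group n)\<lparr>carrier := Q\<rparr>))"
proof -
  define S where "S = {1..n}"
  have alt: "alt_group n = perm_group {g. g permutes S \<and> evenperm g}"
    by (simp add: alt_group_def sym_group_def perm_group_def S_def)
  have finS: "finite S" by (simp add: S_def)
  then have "permutation g" if "g permutes S" for g
    using that permutation_permutes by blast
  then have closedA: "perm_closed S {g. g permutes S \<and> evenperm g}"
    by (auto simp: perm_closed_def permutes_id evenperm_comp intro: permutes_compose)
  have Q: "subgroup Q (alt_group n)" "\<exists>k. card Q = 2 ^ k"
    and bl: "block (group_algebra ((alt_group n)\<lparr>carrier := Q <#>\<^bsub>alt_group n\<^esub> centralizer (alt_group n) Q\<rparr>)) b"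
    and def: "defect_group ((alt_group n)\<lparr>carrier := Q <#>\<^bsub>alt_group n\<^esub> centralizer (alt_group n) Q\<rparr>) b Q"
    using assms by (auto simp: self_centralizing_brauer_pair_def brauer_pair_def p_subgroup_def)
  have Qsub: "subgroup Q (perm_group {g. g permutes S \<and> evenperm g})" using Q(1) unfolding alt .
  interpret L: perm_2_group S Q
    by unfold_locales
       (use perm_closed_of_subgroup[OF finS closedA Qsub] subgroup.subset[OF Qsub] Q(2) finS in auto)
  have alt': "alt_group n = perm_group L.Alt" by (simp add: alt L.Alt_def)
  have Heq: "Q <#>\<^bsub>alt_group n\<^esub> centralizer (alt_group n) Q = L.H"
  proof -
    have "centralizer (alt_group n) Q = {c \<in> cent_perms S Q. evenperm c}"
      by (auto simp: alt centralizer_def cent_perms_def)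
    then have "Q <#>\<^bsub>alt_group n\<^esub> centralizer (alt_group n) Q = {q \<circ> c | q c. q \<in> Q \<and> c \<in> cent_perms S Q \<and> evenperm c}"
      by (auto simp: set_mult_def alt)
    also have "\<dots> = L.H"
      using L.evenperm_comp'[OF L.permQ L.permC] L.evenQ by (auto simp: L.H_def L.\<Gamma>_def)
    finally show ?thesis .
  qed
  interpret L: self_centralizing_perm_pair S Q b
    by unfold_locales (use assms(1) bl[unfolded Heq] def[unfolded Heq] in \<open>simp_all add: alt'\<close>)
  \<comment> \<open>The hypotheses determine the set from the group as its set of moved points, so
    both parts can be stated for moved points.\<close>
  have moved: "T = {x. \<exists>r\<in>R. r x \<noteq> x}"
    if "T \<subseteq> S" "acts_fixed_point_freely R T" "fixes_pointwise R (S - T)" "\<And>r. r \<in> R \<Longrightarrow> r permutes S" for T R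
    using that by (auto simp: acts_fixed_point_freely_def fixes_pointwise_def) (metis DiffI permutes_not_in)
  \<comment> \<open>Z(Q) is contained in the centralizer as soon as T contains the points moved by
    Q. Both parts thus come down to placing the even elements of C supported on T inside Q.\<close>
  have reduce: "centralizer ((alt_group n)\<lparr>carrier := alt_on T\<rparr>) Q = centre ((alt_group n)\<lparr>carrier := Q\<rparr>)"
    if T: "T \<subseteq> S" "\<And>q x. q \<in> Q \<Longrightarrow> x \<notin> T \<Longrightarrow> q x = x"
      and sub: "\<And>g. g \<in> cent_perms S Q \<Longrightarrow> evenperm g \<Longrightarrow> (\<And>x. x \<notin> T \<Longrightarrow> g x = x) \<Longrightarrow> g \<in> Q" for T
  proof (intro equalityI subsetI)
    fix g assume "g \<in> centralizer ((alt_group n)\<lparr>carrier := alt_on T\<rparr>) Q"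
    then have g: "g permutes T" "evenperm g" "\<forall>q\<in>Q. g \<circ> q = q \<circ> g"
      by (auto simp: centralizer_def alt alt_on_def)
    have "g \<in> Q"
      by (rule sub) (use g permutes_subset[OF g(1) T(1)] permutes_not_in[OF g(1)] in \<open>auto simp: cent_perms_def\<close>)
    then show "g \<in> centre ((alt_group n)\<lparr>carrier := Q\<rparr>)" using g by (simp add: centre_def alt)
  next
    fix g assume "g \<in> centre ((alt_group n)\<lparr>carrier := Q\<rparr>)"
    then have g: "g \<in> Q" "\<forall>q\<in>Q. g \<circ> q = q \<circ> g" by (auto simp: centre_def alt)
    have "g permutes T" by (rule permutes_superset[OF L.permQ[OF g(1)]]) (use T(2) g(1) in auto)
    then show "g \<in> centralizer ((alt_group n)\<lparr>carrier := alt_on T\<rparr>) Q"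
      using g L.evenQ by (simp add: centralizer_def alt alt_on_def)
  qed
  have part_a: "centralizer ((alt_group n)\<lparr>carrier := alt_on L.\<Omega>\<rparr>) Q = centre ((alt_group n)\<lparr>carrier := Q\<rparr>)"
    by (rule reduce[OF L.\<Omega>_sub_S]) (auto intro: L.C_alt_\<Omega>_sub_Q L.Q_fixes)
  show ?thesis
  proof (intro conjI allI impI; elim conjE)
    fix \<Omega> assume "\<Omega> \<subseteq> {1..n}" "acts_fixed_point_freely Q \<Omega>" "fixes_pointwise Q ({1..n} - \<Omega>)"
    then have "\<Omega> = L.\<Omega>"
      using moved[of \<Omega> Q] L.permQ by (simp add: S_def L.\<Omega>_def)
    then show "centralizer ((alt_group n)\<lparr>carrier := alt_on \<Omega>\<rparr>) Q = centre ((alt_group n)\<lparr>carrier := Q\<rparr>)"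
      using part_a by simp
  next
    fix B P \<Omega>'
    assume cor: "brauer_correspondent (alt_group n) (Q <#>\<^bsub>alt_group n\<^esub> centralizer (alt_group n) Q) b B"
      and P: "defect_group (alt_group n) B P"
      and cP: "centralizer ((alt_group n)\<lparr>carrier := P\<rparr>) Q \<subseteq> Q" and QP: "Q \<subseteq> P"
      and \<Omega>': "\<Omega>' \<subseteq> {1..n}" "acts_fixed_point_freely P \<Omega>'" "fixes_pointwise P ({1..n} - \<Omega>')"
    have "subgroup P (alt_group n)" using P by (simp add: defect_group_def)
    then have pP: "r permutes S" if "r \<in> P" for r
      using that subgroup.subset[of P "alt_group n"] by (auto simp: alt)
    have \<Omega>'_eq: "\<Omega>' = {x. \<exists>r\<in>P. r x \<noteq> x}"
      by (rule moved) (use \<Omega>' pP in \<open>auto simp: S_def\<close>)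
    show "centralizer ((alt_group n)\<lparr>carrier := alt_on \<Omega>'\<rparr>) Q = centre ((alt_group n)\<lparr>carrier := Q\<rparr>)"
    \<comment> \<open>A trivial Q is treated apart, because no transposition inside \<Omega> is then
      available to correct parities. In this case P centralizes Q, so the condition on the
      centralizer of Q in P forces P = Q and (a) applies.\<close>
    proof (cases "L.\<Omega> = {}")
      case True
      then have "Q \<subseteq> {id}" by (auto simp: L.\<Omega>_def fun_eq_iff)
      then have "P \<subseteq> centralizer ((alt_group n)\<lparr>carrier := P\<rparr>) Q" by (auto simp: centralizer_def alt)
      then have "P \<subseteq> Q" using cP by blast
      then have "\<Omega>' = L.\<Omega>" using QP unfolding \<Omega>'_eq L.\<Omega>_def by blast
      then show ?thesis using part_a by simp
    next
      case False
      obtain w where w: "block (group_algebra (perm_group L.Alt)) B"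
        "central_character (group_algebra (perm_group L.H)) b w"
        "central_character (group_algebra (perm_group L.Alt)) B (\<lambda>z. w (Defs.truncate L.H z))"
        using cor unfolding brauer_correspondent_def Heq by (auto simp: alt')
      interpret L: self_centralizing_character S Q b w
        by unfold_locales (rule w(2))
      have "g \<in> Q" if "g \<in> cent_perms S Q" "evenperm g" "\<And>x. x \<notin> \<Omega>' \<Longrightarrow> g x = x" for g
        by (rule L.C_alt_moved_sub_Q[OF False w(1,3) _ QP that(1,2)]) (use P that(3) in \<open>auto simp: alt' \<Omega>'_eq\<close>)
      then show ?thesis
        by (intro reduce) (use \<Omega>'(1) QP in \<open>auto simp: S_def \<Omega>'_eq\<close>)
    qed
  qed
qed

end
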